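(* Let $(A,\Phi)$ be a compact quantum group with Haar measure $h$, let $\mathcal H$ be the GNS space of $h$ with cyclic vector $\xi_0$, let $A$ act faithfully and non-degenerately on a Hilbert space $\mathcal K$, and let $u\in M(\mathcal B_0(\mathcal H)\otimes A)\subseteq \mathcal B(\mathcal H\otimes\mathcal K)$ be the unitary determined by $u(a\xi_0\otimes\eta)=\Phi(a)(\xi_0\otimes\eta)$ for $a\in A$, $\eta\in\mathcal K$. Then $$(\iota\otimes\Phi)(u)=u_{(12)}u_{(13)},$$ and therefore $u$ is a unitary representation of the compact quantum group $(A,\Phi)$.
   Context: $\otimes$ between C$^*$-algebras is the minimal C$^*$-tensor product, $\iota$ the identity map, $M(\cdot)$ the multiplier algebra, $\mathcal B_0(\mathcal H)$ the compact operators on $\mathcal H$. A comultiplication on a unital C$^*$-algebra $A$ is a unital $^*$-homomorphism $\Phi:A\to A\otimes A$ with $(\Phi\otimes\iota)\Phi=(\iota\otimes\Phi)\Phi$. A compact quantum group is a pair $(A,\Phi)$ of a unital C$^*$-algebra $A$ and a comultiplication $\Phi$ such that $\Phi(A)(1\otimes A)$ and $\Phi(A)(A\otimes 1)$ (linear spans of the products) are dense in $A\otimes A$. Its Haar measure is the unique state $h$ on $A$ with $(\iota\otimes h)\Phi(a)=h(a)1=(h\otimes\iota)\Phi(a)$ for all $a\in A$. Right regular representation: in the GNS representation $\pi_h$ of $A$ on $\mathcal H$ one writes $a\xi$ for $\pi_h(a)\xi$ ($\pi_h$ need not be faithful); on $\mathcal K$ one also writes $a\xi$ for the action of $a$. Elements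 of $A\otimes A$, such as $\Phi(a)$, act on $\mathcal H\otimes\mathcal K$ by the tensor product of these two representations. $\mathcal B_0(\mathcal H)\otimes A$ acts faithfully and non-degenerately on $\mathcal H\otimes\mathcal K$, so $M(\mathcal B_0(\mathcal H)\otimes A)$ is regarded as a subalgebra of $\mathcal B(\mathcal H\otimes\mathcal K)$. The formula for $u$ gives a well-defined unitary operator on $\mathcal H\otimes\mathcal K$ which belongs to $M(\mathcal B_0(\mathcal H)\otimes A)$; $u$ is called the right regular representation. A representation of $(A,\Phi)$ on a Hilbert space $\mathcal H$ is an element $v\in M(\mathcal B_0(\mathcal H)\otimes A)$ with $(\iota\otimes\Phi)(v)=v_{(12)}v_{(13)}$ in $M(\mathcal B_0(\mathcal H)\otimes A\otimes A)$; it is unitary if $v$ is unitary. Here $\iota\otimes\Phi$ is extended to multiplier algebras, $v_{(12)}$ is the image of $v$ under the extension of $x\otimes a\mapsto x\otimes a\otimes 1$, and $v_{(13)}$ the image under the extension of $x\otimes a\mapsto x\otimes 1\otimes a$. *)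

theory Defs
  imports "HOL-Analysis.Analysis"
begin

class complex_vector = real_vector +
  fixes scaleC :: "complex \<Rightarrow> 'a \<Rightarrow> 'a"  (infixr \<open>*\<^sub>C\<close> 75)
  assumes scaleC_add_right: "a *\<^sub>C (x + y) = a *\<^sub>C x + a *\<^sub>C y"
    and scaleC_add_left: "(a + b) *\<^sub>C x = a *\<^sub>C x + b *\<^sub>C x"
    and scaleC_scaleC: "a *\<^sub>C b *\<^sub>C x = (a * b) *\<^sub>C x"
    and scaleR_scaleC: "r *\<^sub>R x = complex_of_real r *\<^sub>C x"

interpretation cvec: vector_space "scaleC :: complex \<Rightarrow> 'a \<Rightarrow> 'a::complex_vector"
proof
  show "1 *\<^sub>C x = x" for x :: 'a
    using scaleR_scaleC[of 1 x] by simp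
qed (fact scaleC_add_right scaleC_add_left scaleC_scaleC)+

abbreviation cspan :: "'a::complex_vector set \<Rightarrow> 'a set"
  where "cspan \<equiv> module.span scaleC"

class complex_normed_vector = complex_vector + real_normed_vector +
  assumes norm_scaleC: "norm (a *\<^sub>C x) = cmod a * norm x"

text \<open>The inner product is linear in its first argument.\<close>

class chilbert_space = complex_normed_vector + complete_space +
  fixes cinner :: "'a \<Rightarrow> 'a \<Rightarrow> complex"
  assumes cinner_add_left: "cinner (x + y) z = cinner x z + cinner y z"
    and cinner_scaleC_left: "cinner (a *\<^sub>C x) y = a * cinner x y"
    and cinner_commute: "cinner x y = cnj (cinner y x)"
    and cinner_self: "cinner x x = complex_of_real ((norm x)\<^sup>2)"

class unital_cstar_algebra = complex_normed_vector + real_normed_algebra + complete_space + monoid_mult +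
  fixes star :: "'a \<Rightarrow> 'a"
  assumes mult_scaleC_left: "(a *\<^sub>C x) * y = a *\<^sub>C (x * y)"
    and mult_scaleC_right: "x * (a *\<^sub>C y) = a *\<^sub>C (x * y)"
    and star_add: "star (x + y) = star x + star y"
    and star_scaleC: "star (a *\<^sub>C x) = cnj a *\<^sub>C star x"
    and star_mult: "star (x * y) = star y * star x"
    and star_star: "star (star x) = x"
    and cstar_identity: "norm (star x * x) = (norm x)\<^sup>2"

instantiation complex :: complex_normed_vector
begin

definition scaleC_complex :: "complex \<Rightarrow> complex \<Rightarrow> complex"
  where "scaleC_complex a x = a * x"

instance
  by standard (auto simp: scaleC_complex_def algebra_simps norm_mult scaleR_conv_of_real)

end

instance chilbert_space \<subseteq> banach ..
instance unital_cstar_algebra \<subseteq> banach ..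

lemma cinner_add_right: "cinner x (y + z) = cinner x y + cinner x (z::'a::chilbert_space)"
  by (metis cinner_add_left cinner_commute complex_cnj_add)

lemma cinner_scaleC_right: "cinner x (a *\<^sub>C y) = cnj a * cinner x (y::'a::chilbert_space)"
  by (metis cinner_commute cinner_scaleC_left complex_cnj_mult)

lemma cinner_zero_left [simp]: "cinner 0 (y::'a::chilbert_space) = 0"
  by (metis add_cancel_right_left cinner_add_left)

lemma cinner_zero_right [simp]: "cinner (x::'a::chilbert_space) 0 = 0"
  by (metis cinner_commute cinner_zero_left complex_cnj_zero)

lemma scaleC_minus_one: "(-1) *\<^sub>C x = - (x::'a::complex_vector)"
  by (metis cvec.scale_minus_left cvec.scale_one)

lemma cinner_minus_left: "cinner (- x) y = - cinner x (y::'a::chilbert_space)"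
  by (metis cinner_scaleC_left mult_minus1 scaleC_minus_one)

lemma cinner_minus_right: "cinner x (- y) = - cinner x (y::'a::chilbert_space)"
  by (metis add.right_inverse add_eq_0_iff cinner_add_right cinner_zero_right)

lemma cinner_diff_left: "cinner (x - z) y = cinner x y - cinner z (y::'a::chilbert_space)"
  by (metis cinner_add_left cinner_minus_left diff_conv_add_uminus)

lemma cinner_diff_right: "cinner y (x - z) = cinner y x - cinner y (z::'a::chilbert_space)"
  by (metis cinner_add_right cinner_minus_right diff_conv_add_uminus)

lemma cinner_sum_left: "cinner (\<Sum>i\<in>I. f i) (y::'a::chilbert_space) = (\<Sum>i\<in>I. cinner (f i) y)"
  by (induction I rule: infinite_finite_induct) (auto simp: cinner_add_left)

lemma cinner_sum_right: "cinner (y::'a::chilbert_space) (\<Sum>i\<in>I. f i) = (\<Sum>i\<in>I. cinner y (f i))"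
  by (induction I rule: infinite_finite_induct) (auto simp: cinner_add_right)

lemma norm_eq_cinner: "(norm (x::'a::chilbert_space))\<^sup>2 = Re (cinner x x)"
  by (simp add: cinner_self)

lemma cauchy_schwarz: "cmod (cinner x y) \<le> norm x * norm (y::'a::chilbert_space)"
proof (cases "y = 0")
  case True
  then show ?thesis by simp
next
  case False
  define c where "c = cinner x y / of_real ((norm y)\<^sup>2)"
  have yy: "(norm y)\<^sup>2 > 0" using False by simp
  have cy: "cinner x y = c * of_real ((norm y)\<^sup>2)"
    using yy False by (simp add: c_def)
  have yx: "cinner y x = cnj c * of_real ((norm y)\<^sup>2)"
    using cy by (subst cinner_commute) simp
  have "complex_of_real ((norm (x - c *\<^sub>C y))\<^sup>2) = cinner (x - c *\<^sub>C y) (x - c *\<^sub>C y)"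
    by (rule cinner_self[symmetric])
  also have "\<dots> = of_real ((norm x)\<^sup>2) - c * cnj c * of_real ((norm y)\<^sup>2)"
    unfolding cinner_diff_left cinner_diff_right cinner_scaleC_left cinner_scaleC_right cinner_self[of x] cinner_self[of y] cy yx
    by (simp only: complex_cnj_mult algebra_simps)
  also have "\<dots> = of_real ((norm x)\<^sup>2 - (cmod c)\<^sup>2 * (norm y)\<^sup>2)"
    by (metis complex_norm_square of_real_diff of_real_mult)
  finally have "(norm (x - c *\<^sub>C y))\<^sup>2 = (norm x)\<^sup>2 - (cmod c)\<^sup>2 * (norm y)\<^sup>2"
    using of_real_eq_iff by blast
  then have "(cmod c * norm y)\<^sup>2 \<le> (norm x)\<^sup>2"
    by (metis diff_ge_0_iff_ge power_mult_distrib zero_le_power2)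
  then have "cmod c * norm y \<le> norm x"
    by (rule power2_le_imp_le) simp
  then have "cmod c * norm y * norm y \<le> norm x * norm y"
    by (rule mult_right_mono) simp
  then show ?thesis
    by (simp add: cy norm_mult power2_eq_square algebra_simps)
qed

lemma bounded_linear_cinner_left: "bounded_linear (\<lambda>x::'a::chilbert_space. cinner x y)"
proof (rule bounded_linear_intro[where K="norm y"])
  show "cinner (r *\<^sub>R x) y = r *\<^sub>R cinner x y" for r and x :: 'a
    by (simp add: scaleR_scaleC cinner_scaleC_left scaleC_complex_def)
qed (auto simp: cinner_add_left cauchy_schwarz)

lemma bounded_linear_cinner_right: "bounded_linear (\<lambda>y::'a::chilbert_space. cinner x y)"
proof (rule bounded_linear_intro[where K="norm x"])
  show "cinner x (r *\<^sub>R y) = r *\<^sub>R cinner x y" for r and y :: 'a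
    by (simp add: scaleR_scaleC cinner_scaleC_right scaleC_complex_def)
  show "norm (cinner x y) \<le> norm y * norm x" for y
    using cauchy_schwarz[of x y] by (simp add: mult.commute)
qed (auto simp: cinner_add_right)

lemma bounded_linear_scaleC: "bounded_linear (\<lambda>x::'a::complex_normed_vector. c *\<^sub>C x)"
proof (rule bounded_linear_intro[where K="cmod c"])
  show "c *\<^sub>C r *\<^sub>R x = r *\<^sub>R c *\<^sub>C x" for r and x :: 'a
    by (simp add: scaleR_scaleC scaleC_scaleC mult.commute)
qed (auto simp: scaleC_add_right norm_scaleC)

definition orthonormal :: "'a::chilbert_space set \<Rightarrow> bool"
  where "orthonormal B \<longleftrightarrow> (\<forall>e\<in>B. norm e = 1) \<and> (\<forall>e\<in>B. \<forall>f\<in>B. e \<noteq> f \<longrightarrow> cinner e f = 0)"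

definition orthonormal_basis :: "'a::chilbert_space set \<Rightarrow> bool"
  where "orthonormal_basis B \<longleftrightarrow> orthonormal B \<and> (\<forall>x. (\<forall>e\<in>B. cinner x e = 0) \<longrightarrow> x = 0)"

lemma orthonormal_basis_exists: "\<exists>B::'a::chilbert_space set. orthonormal_basis B"
proof -
  let ?A = "{B::'a set. orthonormal B}"
  have "\<exists>M\<in>?A. \<forall>X\<in>?A. M \<subseteq> X \<longrightarrow> X = M"
  proof (rule subset_Zorn_nonempty)
    show "?A \<noteq> {}"
      by (auto simp: orthonormal_def intro: exI[of _ "{}"])
    fix C assume "C \<noteq> {}" and C: "subset.chain ?A C"
    have *: "\<exists>D\<in>C. e \<in> D \<and> f \<in> D" if "e \<in> \<Union>C" "f \<in> \<Union>C" for e f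
    proof -
      from that obtain D E where DE: "D \<in> C" "E \<in> C" "e \<in> D" "f \<in> E" by blast
      then have "D \<subseteq> E \<or> E \<subseteq> D"
        using C unfolding subset_chain_def by blast
      then show ?thesis using DE by blast
    qed
    have on: "orthonormal D" if "D \<in> C" for D
      using C that by (auto simp: subset.chain_def)
    show "\<Union>C \<in> ?A"
      unfolding mem_Collect_eq orthonormal_def
    proof (intro conjI ballI impI)
      fix e assume "e \<in> \<Union>C"
      then show "norm e = 1" using on by (auto simp: orthonormal_def)
    next
      fix e f assume "e \<in> \<Union>C" "f \<in> \<Union>C" "e \<noteq> f"
      then show "cinner e f = 0" using *[of e f] on by (auto simp: orthonormal_def)
    qed
  qed
  then obtain M :: "'a set" where M: "orthonormal M" and max: "\<And>X. orthonormal X \<Longrightarrow> M \<subseteq> X \<Longrightarrow> X = M"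
    by (elim bexE) blast
  have "x = 0" if x: "\<forall>e\<in>M. cinner x e = 0" for x
  proof (rule ccontr)
    assume "x \<noteq> 0"
    define f where "f = complex_of_real (1 / norm x) *\<^sub>C x"
    have nf: "norm f = 1"
      using \<open>x \<noteq> 0\<close> by (simp add: f_def norm_scaleC norm_divide)
    have fe: "cinner f e = 0" "cinner e f = 0" if "e \<in> M" for e
    proof -
      show "cinner f e = 0" using x that by (simp add: f_def cinner_scaleC_left)
      then show "cinner e f = 0" by (subst cinner_commute) simp
    qed
    have "orthonormal (insert f M)"
      using M nf fe by (auto simp: orthonormal_def)
    then have "f \<in> M" using max by blast
    then have "cinner f f = 0" using fe by blast
    then show False using nf by (simp add: cinner_self)
  qed
  with M show ?thesis by (auto simp: orthonormal_basis_def)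
qed

definition onb :: "'a::chilbert_space set"
  where "onb = (SOME B. orthonormal_basis B)"

lemma orthonormal_basis_onb: "orthonormal_basis (onb :: 'a::chilbert_space set)"
  unfolding onb_def by (rule someI_ex) (rule orthonormal_basis_exists)

lemma norm_onb: "e \<in> onb \<Longrightarrow> norm (e::'a::chilbert_space) = 1"
  using orthonormal_basis_onb by (auto simp: orthonormal_basis_def orthonormal_def)

lemma cinner_onb: "e \<in> onb \<Longrightarrow> f \<in> onb \<Longrightarrow> cinner e (f::'a::chilbert_space) = (if e = f then 1 else 0)"
  using orthonormal_basis_onb norm_onb[of e]
  by (auto simp: orthonormal_basis_def orthonormal_def cinner_self)

lemma onb_eq_0I: "(\<And>e. e \<in> onb \<Longrightarrow> cinner x e = 0) \<Longrightarrow> x = (0::'a::chilbert_space)"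
  using orthonormal_basis_onb by (auto simp: orthonormal_basis_def)

lemma norm_sum_onb:
  fixes c :: "'a::chilbert_space \<Rightarrow> complex"
  assumes "finite F" "F \<subseteq> onb"
  shows "(norm (\<Sum>e\<in>F. c e *\<^sub>C e))\<^sup>2 = (\<Sum>e\<in>F. (cmod (c e))\<^sup>2)"
proof -
  have "cinner (\<Sum>e\<in>F. c e *\<^sub>C e) (\<Sum>e\<in>F. c e *\<^sub>C e)
      = (\<Sum>e\<in>F. \<Sum>f\<in>F. c e * (cnj (c f) * cinner e f))"
    unfolding cinner_sum_left cinner_sum_right cinner_scaleC_left cinner_scaleC_right
    by (subst sum.swap) (simp only: sum_distrib_left mult.left_commute)
  also have "\<dots> = (\<Sum>e\<in>F. \<Sum>f\<in>F. if e = f then c e * cnj (c e) else 0)"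
    using assms by (intro sum.cong refl) (auto simp: cinner_onb subset_iff)
  also have "\<dots> = (\<Sum>e\<in>F. c e * cnj (c e))"
    using assms by simp
  also have "\<dots> = of_real (\<Sum>e\<in>F. (cmod (c e))\<^sup>2)"
    by (simp only: complex_norm_square[symmetric] of_real_sum)
  finally show ?thesis
    by (simp add: norm_eq_cinner)
qed

lemma bessel:
  fixes x :: "'a::chilbert_space"
  assumes "finite F" "F \<subseteq> onb"
  shows "(\<Sum>e\<in>F. (cmod (cinner x e))\<^sup>2) \<le> (norm x)\<^sup>2"
proof -
  define y where "y = (\<Sum>e\<in>F. cinner x e *\<^sub>C e)"
  have ny: "(norm y)\<^sup>2 = (\<Sum>e\<in>F. (cmod (cinner x e))\<^sup>2)"
    unfolding y_def using assms by (rule norm_sum_onb)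
  have "cinner x y = of_real (\<Sum>e\<in>F. (cmod (cinner x e))\<^sup>2)"
    unfolding y_def cinner_sum_right cinner_scaleC_right of_real_sum complex_norm_square
    by (simp only: mult.commute)
  then have "cmod (cinner x y) = (norm y)\<^sup>2"
    by (metis ny abs_of_nonneg norm_of_real zero_le_power2)
  with cauchy_schwarz[of x y] have "norm y * norm y \<le> norm x * norm y"
    by (simp add: power2_eq_square)
  then have "norm y \<le> norm x"
    by (metis mult_right_le_imp_le norm_ge_zero order_le_less zero_less_norm_iff)
  then show ?thesis
    using ny by (metis norm_ge_zero power_mono)
qed

lemma summable_onb_expansion:
  fixes c :: "'a::chilbert_space \<Rightarrow> complex"
  assumes "(\<lambda>e. (cmod (c e))\<^sup>2) summable_on onb"
  shows "(\<lambda>e. c e *\<^sub>C e) summable_on onb"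
proof -
  let ?q = "\<lambda>e. (cmod (c e))\<^sup>2" and ?f = "\<lambda>e. c e *\<^sub>C e"
  define s where "s = infsum ?q onb"
  have lim: "(sum ?q \<longlongrightarrow> s) (finite_subsets_at_top onb)"
    using assms by (simp add: s_def infsum_tendsto)
  have "\<exists>P. eventually P (finite_subsets_at_top onb) \<and>
              (\<forall>F F'. P F \<and> P F' \<longrightarrow> dist (sum ?f F) (sum ?f F') < d)" if "d > 0" for d
  proof -
    define P where "P F \<longleftrightarrow> finite F \<and> F \<subseteq> onb \<and> s - (d/2)\<^sup>2 < sum ?q F" for F
    have ev: "\<forall>\<^sub>F F in finite_subsets_at_top onb. s - (d/2)\<^sup>2 < sum ?q F"
      using that by (intro order_tendstoD(1)[OF lim]) simp
    have "eventually P (finite_subsets_at_top onb)"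
      unfolding P_def by (intro eventually_conj ev)
        (auto intro: eventually_finite_subsets_at_top_weakI)
    moreover have half: "norm (sum ?f (F \<union> G) - sum ?f F) < d/2" if "P F" "P G" for F G
    proof -
      have FG: "finite (F \<union> G)" "F \<union> G \<subseteq> onb" "finite F"
        using that by (auto simp: P_def)
      have "sum ?f (F \<union> G) - sum ?f F = sum ?f (F \<union> G - F)"
        using FG by (subst sum_diff) auto
      then have "(norm (sum ?f (F \<union> G) - sum ?f F))\<^sup>2 = sum ?q (F \<union> G - F)"
        using FG norm_sum_onb[of "F \<union> G - F" c] by auto
      also have "\<dots> = sum ?q (F \<union> G) - sum ?q F"
        using FG by (subst sum_diff) auto
      also have "\<dots> < (d/2)\<^sup>2"
      proof -
        have "sum ?q (F \<union> G) \<le> s"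
          unfolding s_def using FG assms by (intro finite_sum_le_infsum) auto
        then show ?thesis using \<open>P F\<close> by (auto simp: P_def)
      qed
      finally show ?thesis
        by (rule power2_less_imp_less) (use \<open>d > 0\<close> in simp)
    qed
    moreover have "dist (sum ?f F) (sum ?f G) < d" if "P F" "P G" for F G
    proof -
      have "norm (sum ?f F - sum ?f G) \<le> norm (sum ?f (F \<union> G) - sum ?f F) + norm (sum ?f (F \<union> G) - sum ?f G)"
        by norm
      then show ?thesis
        using half[OF that] half[OF that(2,1)] by (simp add: dist_norm Un_commute)
    qed
    ultimately show ?thesis by blast
  qed
  then have "cauchy_filter (filtermap (sum ?f) (finite_subsets_at_top onb))"
    by (simp add: cauchy_filter_metric_filtermap)
  moreover have "complete (UNIV::'a set)"
    by (meson Cauchy_convergent UNIV_I complete_def convergent_def)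
  ultimately obtain L where "(sum ?f \<longlongrightarrow> L) (finite_subsets_at_top onb)"
    using complete_uniform[where S=UNIV] by (force simp add: filterlim_def)
  then show ?thesis
    using summable_on_def has_sum_def by blast
qed

lemma cinner_infsum_onb:
  fixes c :: "'a::chilbert_space \<Rightarrow> complex"
  assumes "(\<lambda>e. (cmod (c e))\<^sup>2) summable_on onb" "f \<in> onb"
  shows "cinner (\<Sum>\<^sub>\<infinity>e\<in>onb. c e *\<^sub>C e) f = c f"
proof -
  have "((\<lambda>e. cinner (c e *\<^sub>C e) f) has_sum cinner (\<Sum>\<^sub>\<infinity>e\<in>onb. c e *\<^sub>C e) f) onb"
    using has_sum_bounded_linear[OF bounded_linear_cinner_left[of f]
        has_sum_infsum[OF summable_onb_expansion[OF assms(1)]]] .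
  moreover have "((\<lambda>e. cinner (c e *\<^sub>C e) f) has_sum c f) onb"
  proof (rule has_sum_finite_neutralI[where B="{f}"])
    show "cinner (c e *\<^sub>C e) f = 0" if "e \<in> onb - {f}" for e
      using that assms by (auto simp: cinner_scaleC_left cinner_onb)
  qed (use assms in \<open>auto simp: cinner_scaleC_left cinner_onb\<close>)
  ultimately show ?thesis by (rule has_sum_unique)
qed

lemma summable_cinner_onb: "(\<lambda>e. (cmod (cinner x e))\<^sup>2) summable_on (onb::'a::chilbert_space set)"
  by (rule nonneg_bdd_above_summable_on) (auto intro!: bdd_aboveI[of _ "(norm x)\<^sup>2"] bessel)

lemma onb_expansion: "((\<lambda>e. cinner x e *\<^sub>C e) has_sum x) (onb::'a::chilbert_space set)"
proof -
  let ?y = "\<Sum>\<^sub>\<infinity>e\<in>onb. cinner x e *\<^sub>C e"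
  have "?y - x = 0"
    by (rule onb_eq_0I) (simp add: cinner_diff_left cinner_infsum_onb[OF summable_cinner_onb])
  then show ?thesis
    using has_sum_infsum[OF summable_onb_expansion[OF summable_cinner_onb[of x]]] by simp
qed

lemma parseval: "((\<lambda>e. cinner x e * cnj (cinner y e)) has_sum cinner x y) (onb::'a::chilbert_space set)"
proof -
  have "((\<lambda>e. cinner (cinner x e *\<^sub>C e) y) has_sum cinner x y) onb"
    by (rule has_sum_bounded_linear[OF bounded_linear_cinner_left onb_expansion])
  then show ?thesis
    unfolding cinner_scaleC_left by (simp only: cinner_commute[of _ y])
qed

lemma parseval_norm: "((\<lambda>e. (cmod (cinner x e))\<^sup>2) has_sum (norm x)\<^sup>2) (onb::'a::chilbert_space set)"
proof -
  have "((\<lambda>e. Re (cinner x e * cnj (cinner x e))) has_sum Re (cinner x x)) onb"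
    using has_sum_Re[OF parseval] .
  moreover have "Re (z * cnj z) = (cmod z)\<^sup>2" for z
    by (simp add: complex_mult_cnj cmod_power2)
  ultimately show ?thesis
    by (simp only: norm_eq_cinner)
qed

definition square_summable :: "('i \<Rightarrow> complex) \<Rightarrow> bool"
  where "square_summable F \<longleftrightarrow> (\<lambda>i. (cmod (F i))\<^sup>2) summable_on UNIV"

definition ell2_norm :: "('i \<Rightarrow> complex) \<Rightarrow> real"
  where "ell2_norm F = sqrt (\<Sum>\<^sub>\<infinity>i. (cmod (F i))\<^sup>2)"

definition ell2_inner :: "('i \<Rightarrow> complex) \<Rightarrow> ('i \<Rightarrow> complex) \<Rightarrow> complex"
  where "ell2_inner F G = (\<Sum>\<^sub>\<infinity>i. F i * cnj (G i))"

lemma ell2_norm_nonneg: "ell2_norm F \<ge> 0"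
  by (simp add: ell2_norm_def infsum_nonneg)

lemma ell2_norm_power2: "(ell2_norm F)\<^sup>2 = (\<Sum>\<^sub>\<infinity>i. (cmod (F i))\<^sup>2)"
  by (simp add: ell2_norm_def infsum_nonneg)

lemma L2_set_le_ell2_norm:
  assumes "square_summable F" "finite S"
  shows "L2_set (\<lambda>i. cmod (F i)) S \<le> ell2_norm F"
  unfolding L2_set_def ell2_norm_def
  using assms by (intro real_sqrt_le_mono finite_sum_le_infsum) (auto simp: square_summable_def)

lemma ell2_boundI:
  assumes "\<And>S. finite S \<Longrightarrow> L2_set (\<lambda>i. cmod (F i)) S \<le> b"
  shows "square_summable F" "ell2_norm F \<le> b"
proof -
  have b: "b \<ge> 0" using assms[of "{}"] by simp
  have *: "(\<Sum>i\<in>S. (cmod (F i))\<^sup>2) \<le> b\<^sup>2" if "finite S" for S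
    using assms[OF that] unfolding L2_set_def by (rule sqrt_le_D)
  show sq: "square_summable F"
    unfolding square_summable_def
    by (rule nonneg_bdd_above_summable_on) (auto intro!: bdd_aboveI[of _ "b\<^sup>2"] *)
  have "(ell2_norm F)\<^sup>2 \<le> b\<^sup>2"
    unfolding ell2_norm_power2
    by (rule infsum_le_finite_sums) (use sq * in \<open>auto simp: square_summable_def\<close>)
  then show "ell2_norm F \<le> b"
    using b by (rule power2_le_imp_le)
qed

lemma ell2_add:
  assumes "square_summable F" "square_summable G"
  shows "square_summable (\<lambda>i. F i + G i)" "ell2_norm (\<lambda>i. F i + G i) \<le> ell2_norm F + ell2_norm G"
proof -
  have "L2_set (\<lambda>i. cmod (F i + G i)) S \<le> ell2_norm F + ell2_norm G" if "finite S" for S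
  proof -
    have "L2_set (\<lambda>i. cmod (F i + G i)) S \<le> L2_set (\<lambda>i. cmod (F i) + cmod (G i)) S"
      by (rule L2_set_mono) (auto intro: norm_triangle_ineq)
    also have "\<dots> \<le> L2_set (\<lambda>i. cmod (F i)) S + L2_set (\<lambda>i. cmod (G i)) S"
      by (rule L2_set_triangle_ineq)
    also have "\<dots> \<le> ell2_norm F + ell2_norm G"
      using assms that by (intro add_mono L2_set_le_ell2_norm)
    finally show ?thesis .
  qed
  from ell2_boundI[of "\<lambda>i. F i + G i", OF this]
  show "square_summable (\<lambda>i. F i + G i)" "ell2_norm (\<lambda>i. F i + G i) \<le> ell2_norm F + ell2_norm G"
    by auto
qed

lemma ell2_scale:
  shows "square_summable F \<Longrightarrow> square_summable (\<lambda>i. c * F i)" "ell2_norm (\<lambda>i. c * F i) = cmod c * ell2_norm F"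
  by (auto simp: square_summable_def ell2_norm_def norm_mult power_mult_distrib infsum_cmult_right'
      real_sqrt_mult intro: summable_on_cmult_right)

lemma ell2_product_summable:
  assumes "square_summable F" "square_summable G"
  shows "(\<lambda>i. F i * cnj (G i)) summable_on UNIV"
proof -
  have "(\<lambda>i. norm (F i * cnj (G i))) summable_on UNIV"
    by (rule Infinite_Sum.abs_summable_product)
      (use assms in \<open>simp_all add: square_summable_def norm_mult power2_eq_square\<close>)
  then show ?thesis by (rule abs_summable_summable)
qed

lemma ell2_norm_eq_0D:
  assumes "square_summable F" "ell2_norm F = 0"
  shows "F i = 0"
  using L2_set_le_ell2_norm[OF assms(1), of "{i}"] assms(2) by simp

lemma ell2_inner_self: "square_summable F \<Longrightarrow> ell2_inner F F = complex_of_real ((ell2_norm F)\<^sup>2)"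
  unfolding ell2_inner_def ell2_norm_power2 square_summable_def
  by (simp only: complex_norm_square[symmetric])
    (rule infsumI, rule has_sum_of_real, erule has_sum_infsum)

text \<open>The tensor product of two Hilbert spaces, realised in coordinates: an element is its family of
  coefficients with respect to the orthonormal basis of tensors e, f with e, f from the fixed
  orthonormal bases \<^const>\<open>onb\<close> of the two factors. The elementary tensors \<open>tensor_vec x y\<close>
  introduced below satisfy the defining properties of the tensor product, see
  \<open>cinner_tensor_vec\<close> and \<open>dense_tensor_vec\<close>.\<close>

typedef (overloaded) ('h::chilbert_space, 'k::chilbert_space) htensor  (infixr \<open>\<otimes>\<^sub>H\<close> 70)
  = "{F :: 'h \<times> 'k \<Rightarrow> complex. (\<forall>p. p \<notin> onb \<times> onb \<longrightarrow> F p = 0) \<and> square_summable F}"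
  by (rule exI[of _ "\<lambda>_. 0"]) (simp add: square_summable_def)

setup_lifting type_definition_htensor

lemma square_summable_Rep_htensor: "square_summable (Rep_htensor F)"
  using Rep_htensor[of F] by simp

instantiation htensor :: (chilbert_space, chilbert_space) complex_normed_vector
begin

lift_definition zero_htensor :: "'a \<otimes>\<^sub>H 'b" is "\<lambda>_. 0"
  by (simp add: square_summable_def)

lift_definition plus_htensor :: "'a \<otimes>\<^sub>H 'b \<Rightarrow> 'a \<otimes>\<^sub>H 'b \<Rightarrow> 'a \<otimes>\<^sub>H 'b" is "\<lambda>F G p. F p + G p"
  by (simp add: ell2_add)

lift_definition scaleC_htensor :: "complex \<Rightarrow> 'a \<otimes>\<^sub>H 'b \<Rightarrow> 'a \<otimes>\<^sub>H 'b" is "\<lambda>c F p. c * F p"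
  by (simp add: ell2_scale)

lift_definition uminus_htensor :: "'a \<otimes>\<^sub>H 'b \<Rightarrow> 'a \<otimes>\<^sub>H 'b" is "\<lambda>F p. - F p"
  by (simp add: square_summable_def)

lift_definition minus_htensor :: "'a \<otimes>\<^sub>H 'b \<Rightarrow> 'a \<otimes>\<^sub>H 'b \<Rightarrow> 'a \<otimes>\<^sub>H 'b" is "\<lambda>F G p. F p - G p"
proof -
  fix F G :: "'a \<times> 'b \<Rightarrow> complex"
  assume "(\<forall>p. p \<notin> onb \<times> onb \<longrightarrow> F p = 0) \<and> square_summable F"
    and "(\<forall>p. p \<notin> onb \<times> onb \<longrightarrow> G p = 0) \<and> square_summable G"
  then show "(\<forall>p. p \<notin> onb \<times> onb \<longrightarrow> F p - G p = 0) \<and> square_summable (\<lambda>p. F p - G p)"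
    using ell2_add(1)[of F "\<lambda>p. (-1) * G p"] ell2_scale(1)[of G "-1"] by simp
qed

definition scaleR_htensor :: "real \<Rightarrow> 'a \<otimes>\<^sub>H 'b \<Rightarrow> 'a \<otimes>\<^sub>H 'b"
  where "scaleR_htensor r F = complex_of_real r *\<^sub>C F"

lift_definition norm_htensor :: "'a \<otimes>\<^sub>H 'b \<Rightarrow> real" is ell2_norm .

definition dist_htensor :: "'a \<otimes>\<^sub>H 'b \<Rightarrow> 'a \<otimes>\<^sub>H 'b \<Rightarrow> real"
  where "dist_htensor F G = norm (F - G)"

definition sgn_htensor :: "'a \<otimes>\<^sub>H 'b \<Rightarrow> 'a \<otimes>\<^sub>H 'b"
  where "sgn_htensor F = inverse (norm F) *\<^sub>R F"

definition uniformity_htensor :: "(('a \<otimes>\<^sub>H 'b) \<times> ('a \<otimes>\<^sub>H 'b)) filter"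
  where "uniformity_htensor = (INF e\<in>{0<..}. principal {(x, y). dist x y < e})"

definition open_htensor :: "('a \<otimes>\<^sub>H 'b) set \<Rightarrow> bool"
  where "open_htensor S = (\<forall>x\<in>S. \<forall>\<^sub>F (x', y) in uniformity. x' = x \<longrightarrow> y \<in> S)"

instance
proof intro_classes
  fix F G H :: "'a \<otimes>\<^sub>H 'b" and a b :: complex and r s :: real
  show "F + G + H = F + (G + H)" by transfer (simp add: add.assoc)
  show "F + G = G + F" by transfer (simp add: add.commute)
  show "0 + F = F" by transfer simp
  show "- F + F = 0" by transfer simp
  show "F - G = F + - G" by transfer simp
  show C1: "a *\<^sub>C (F + G) = a *\<^sub>C F + a *\<^sub>C G" by transfer (simp add: algebra_simps)
  show C2: "(a + b) *\<^sub>C F = a *\<^sub>C F + b *\<^sub>C F" by transfer (simp add: algebra_simps)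
  show C3: "a *\<^sub>C b *\<^sub>C F = (a * b) *\<^sub>C F" by transfer (simp add: algebra_simps)
  show R: "r *\<^sub>R F = complex_of_real r *\<^sub>C F" by (rule scaleR_htensor_def)
  show "r *\<^sub>R (F + G) = r *\<^sub>R F + r *\<^sub>R G"
    unfolding scaleR_htensor_def by transfer (simp add: algebra_simps)
  show "(r + s) *\<^sub>R F = r *\<^sub>R F + s *\<^sub>R F"
    unfolding scaleR_htensor_def by transfer (simp add: algebra_simps)
  show "r *\<^sub>R s *\<^sub>R F = (r * s) *\<^sub>R F"
    unfolding scaleR_htensor_def by transfer (simp add: algebra_simps)
  show "1 *\<^sub>R F = F"
    unfolding scaleR_htensor_def by transfer simp
  show "dist F G = norm (F - G)" by (rule dist_htensor_def)
  show "sgn F = inverse (norm F) *\<^sub>R F" by (rule sgn_htensor_def)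
  show "uniformity = (INF e\<in>{0<..}. principal {(x, y :: 'a \<otimes>\<^sub>H 'b). dist x y < e})"
    by (rule uniformity_htensor_def)
  show "open U = (\<forall>x\<in>U. \<forall>\<^sub>F (x', y) in uniformity. x' = x \<longrightarrow> y \<in> U)" for U :: "('a \<otimes>\<^sub>H 'b) set"
    by (rule open_htensor_def)
  show "norm F = 0 \<longleftrightarrow> F = 0"
  proof
    assume "norm F = 0"
    then show "F = 0" by transfer (auto dest: ell2_norm_eq_0D)
  next
    assume "F = 0"
    then show "norm F = 0" by transfer (simp add: ell2_norm_def)
  qed
  show "norm (F + G) \<le> norm F + norm G" by transfer (simp add: ell2_add)
  show "norm (r *\<^sub>R F) = \<bar>r\<bar> * norm F"
    unfolding scaleR_htensor_def by transfer (simp add: ell2_scale)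
  show "norm (a *\<^sub>C F) = cmod a * norm F" by transfer (simp add: ell2_scale)
qed

end

instantiation htensor :: (chilbert_space, chilbert_space) chilbert_space
begin

lift_definition cinner_htensor :: "'a \<otimes>\<^sub>H 'b \<Rightarrow> 'a \<otimes>\<^sub>H 'b \<Rightarrow> complex" is ell2_inner .

instance
proof
  fix F G H :: "'a \<otimes>\<^sub>H 'b" and a :: complex
  show "cinner (F + G) H = cinner F H + cinner G H"
    by transfer (simp add: ell2_inner_def algebra_simps infsum_add ell2_product_summable)
  show "cinner (a *\<^sub>C F) G = a * cinner F G"
    by transfer (simp add: ell2_inner_def mult.assoc infsum_cmult_right')
  show "cinner F G = cnj (cinner G F)"
    by transfer (simp only: ell2_inner_def infsum_cnj[symmetric] complex_cnj_mult complex_cnj_cnj mult.commute)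
  show "cinner F F = complex_of_real ((norm F)\<^sup>2)"
    by transfer (simp only: ell2_inner_self)
next
  fix X :: "nat \<Rightarrow> 'a \<otimes>\<^sub>H 'b"
  assume X: "Cauchy X"
  have coord: "cmod (Rep_htensor (X m - X n) p) \<le> norm (X m - X n)" for m n p
    using L2_set_le_ell2_norm[OF square_summable_Rep_htensor, of "{p}" "X m - X n"]
    by (simp add: norm_htensor.rep_eq)
  have cauchyN: "\<exists>N. \<forall>m\<ge>N. \<forall>n\<ge>N. norm (X m - X n) < e" if "e > 0" for e
    using X that unfolding Cauchy_def dist_norm by blast
  have "Cauchy (\<lambda>n. Rep_htensor (X n) p)" for p
  proof (rule metric_CauchyI)
    fix e :: real assume "e > 0"
    from cauchyN[OF this] obtain N where "\<forall>m\<ge>N. \<forall>n\<ge>N. norm (X m - X n) < e" ..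
    then have "\<forall>m\<ge>N. \<forall>n\<ge>N. dist (Rep_htensor (X m) p) (Rep_htensor (X n) p) < e"
      using coord by (metis dist_norm minus_htensor.rep_eq order_le_less_trans)
    then show "\<exists>N. \<forall>m\<ge>N. \<forall>n\<ge>N. dist (Rep_htensor (X m) p) (Rep_htensor (X n) p) < e" ..
  qed
  then have "\<forall>p. \<exists>l. (\<lambda>n. Rep_htensor (X n) p) \<longlonglongrightarrow> l"
    by (simp add: Cauchy_convergent_iff convergent_def)
  then obtain L where L: "\<And>p. (\<lambda>n. Rep_htensor (X n) p) \<longlonglongrightarrow> L p"
    by metis
  have L0: "L p = 0" if "p \<notin> onb \<times> onb" for p
  proof -
    have "Rep_htensor (X n) p = 0" for n
      using Rep_htensor[of "X n"] that by blast
    then show ?thesis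
      using L[of p] by (simp add: LIMSEQ_const_iff)
  qed
  have bound: "L2_set (\<lambda>p. cmod (Rep_htensor (X n) p - L p)) S \<le> e"
    if N: "\<forall>m\<ge>N. \<forall>n\<ge>N. norm (X m - X n) < e" and "n \<ge> N" "finite S" for N n S e
  proof (rule tendsto_upperbound)
    show "(\<lambda>m. L2_set (\<lambda>p. cmod (Rep_htensor (X n) p - Rep_htensor (X m) p)) S)
        \<longlonglongrightarrow> L2_set (\<lambda>p. cmod (Rep_htensor (X n) p - L p)) S"
      unfolding L2_set_def by (intro tendsto_intros L)
    have "L2_set (\<lambda>p. cmod (Rep_htensor (X n) p - Rep_htensor (X m) p)) S \<le> e" if "m \<ge> N" for m
    proof -
      have "L2_set (\<lambda>p. cmod (Rep_htensor (X n - X m) p)) S \<le> norm (X n - X m)"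
        unfolding norm_htensor.rep_eq
        using \<open>finite S\<close> by (intro L2_set_le_ell2_norm square_summable_Rep_htensor)
      also have "\<dots> \<le> e" using N \<open>n \<ge> N\<close> that by (simp add: less_imp_le)
      finally show ?thesis by (simp add: minus_htensor.rep_eq)
    qed
    then show "\<forall>\<^sub>F m in sequentially. L2_set (\<lambda>p. cmod (Rep_htensor (X n) p - Rep_htensor (X m) p)) S \<le> e"
      by (auto simp: eventually_sequentially)
  qed simp
  obtain N1 where N1: "\<forall>m\<ge>N1. \<forall>n\<ge>N1. norm (X m - X n) < 1"
    using cauchyN[of 1] by auto
  have "square_summable (\<lambda>p. Rep_htensor (X N1) p - L p)"
    using bound[OF N1, of N1] by (intro ell2_boundI(1)) auto
  then have "square_summable (\<lambda>p. Rep_htensor (X N1) p + (-1) * (Rep_htensor (X N1) p - L p))"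
    by (intro ell2_add ell2_scale square_summable_Rep_htensor)
  then have "square_summable L" by simp
  with L0 have RL: "Rep_htensor (Abs_htensor L) = L"
    by (intro Abs_htensor_inverse) blast
  have "X \<longlonglongrightarrow> Abs_htensor L"
  proof (rule metric_LIMSEQ_I)
    fix e :: real assume "e > 0"
    then obtain N where N: "\<forall>m\<ge>N. \<forall>n\<ge>N. norm (X m - X n) < e/2"
      using cauchyN[of "e/2"] by auto
    have "dist (X n) (Abs_htensor L) < e" if "n \<ge> N" for n
    proof -
      have "ell2_norm (\<lambda>p. Rep_htensor (X n) p - L p) \<le> e/2"
        using bound[OF N that] by (rule ell2_boundI(2))
      then show ?thesis
        using \<open>e > 0\<close> by (simp add: dist_htensor_def norm_htensor.rep_eq minus_htensor.rep_eq RL)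
    qed
    then show "\<exists>N. \<forall>n\<ge>N. dist (X n) (Abs_htensor L) < e" by blast
  qed
  then show "convergent X" by (auto simp: convergent_def)
qed

end

lemma has_sum_tensor_aux:
  fixes x x' :: "'h::chilbert_space" and y y' :: "'k::chilbert_space"
  shows "((\<lambda>(e, f). (cinner x e * cnj (cinner x' e)) * (cinner y f * cnj (cinner y' f)))
    has_sum (cinner x x' * cinner y y')) (onb \<times> onb)"
proof -
  let ?p = "\<lambda>e. cinner x e * cnj (cinner x' e)" and ?q = "\<lambda>f. cinner y f * cnj (cinner y' f)"
  have ps: "(\<lambda>e. norm (?p e)) summable_on onb" and qs: "(\<lambda>f. norm (?q f)) summable_on onb"
    by (rule summable_on_iff_abs_summable_on_complex[THEN iffD1], rule has_sum_imp_summable, rule parseval)+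
  have "(\<lambda>z. norm (case z of (e, f) \<Rightarrow> ?p e * ?q f)) summable_on onb \<times> onb"
    unfolding Infinite_Sum.abs_summable_on_Sigma_iff
  proof (intro conjI ballI)
    show "(\<lambda>f. norm (case (e, f) of (e, f) \<Rightarrow> ?p e * ?q f)) summable_on onb" for e
      using summable_on_cmult_right[OF qs, of "cmod (?p e)"] by (simp add: norm_mult)
    have "(\<lambda>e. cmod (?p e) * (\<Sum>\<^sub>\<infinity>f\<in>onb. cmod (?q f))) summable_on onb"
      using ps by (rule summable_on_cmult_left)
    then show "(\<lambda>e. norm (\<Sum>\<^sub>\<infinity>f\<in>onb. norm (case (e, f) of (e, f) \<Rightarrow> ?p e * ?q f))) summable_on onb"
      by (simp add: norm_mult infsum_cmult_right' infsum_nonneg abs_mult)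
  qed
  then have "(\<lambda>(e, f). ?p e * ?q f) summable_on onb \<times> onb"
    by (rule abs_summable_summable)
  then obtain s where s: "((\<lambda>(e, f). ?p e * ?q f) has_sum s) (onb \<times> onb)"
    by (auto simp: summable_on_def)
  have "((\<lambda>e. ?p e * cinner y y') has_sum s) onb"
    by (rule has_sum_SigmaD[OF s]) (auto intro!: has_sum_cmult_right parseval)
  moreover have "((\<lambda>e. ?p e * cinner y y') has_sum (cinner x x' * cinner y y')) onb"
    by (intro has_sum_cmult_left parseval)
  ultimately have "s = cinner x x' * cinner y y'"
    by (rule has_sum_unique)
  with s show ?thesis by simp
qed

lift_definition tensor_vec :: "'h::chilbert_space \<Rightarrow> 'k::chilbert_space \<Rightarrow> 'h \<otimes>\<^sub>H 'k"  (infixr \<open>\<otimes>\<^sub>v\<close> 70)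
  is "\<lambda>x y (e, f). if e \<in> onb \<and> f \<in> onb then cinner x e * cinner y f else 0"
proof -
  fix x :: 'h and y :: 'k
  let ?F = "\<lambda>(e, f). if e \<in> onb \<and> f \<in> onb then cinner x e * cinner y f else 0"
  have "((\<lambda>p. Re (case p of (e, f) \<Rightarrow> (cinner x e * cnj (cinner x e)) * (cinner y f * cnj (cinner y f))))
      has_sum Re (cinner x x * cinner y y)) (onb \<times> onb)"
    by (rule has_sum_Re[OF has_sum_tensor_aux])
  moreover have "Re ((a * cnj a) * (b * cnj b)) = (cmod (a * b))\<^sup>2" for a b
  proof -
    have "(a * cnj a) * (b * cnj b) = of_real ((cmod (a * b))\<^sup>2)"
      by (simp only: complex_norm_square complex_cnj_mult ac_simps)
    then show ?thesis by (metis Re_complex_of_real)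
  qed
  ultimately have hs: "((\<lambda>(e, f). (cmod (cinner x e * cinner y f))\<^sup>2) has_sum Re (cinner x x * cinner y y)) (onb \<times> onb)"
    unfolding case_prod_beta by (simp only:)
  then have "(\<lambda>p. (cmod (?F p))\<^sup>2) summable_on (onb \<times> onb)"
  proof -
    have "(\<lambda>p. (cmod (?F p))\<^sup>2) summable_on (onb \<times> onb) \<longleftrightarrow>
        (\<lambda>(e, f). (cmod (cinner x e * cinner y f))\<^sup>2) summable_on (onb \<times> onb)"
      by (rule summable_on_cong) auto
    then show ?thesis
      using has_sum_imp_summable[OF hs] by simp
  qed
  then have "(\<lambda>p. (cmod (?F p))\<^sup>2) summable_on UNIV"
    by (rule summable_on_cong_neutral[THEN iffD1, rotated -1]) (auto split: if_splits)
  then show "(\<forall>p. p \<notin> onb \<times> onb \<longrightarrow> ?F p = 0) \<and> square_summable ?F"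
    by (auto simp: square_summable_def split: if_splits)
qed

lemma tensor_vec_add_left: "(x + x') \<otimes>\<^sub>v y = x \<otimes>\<^sub>v y + x' \<otimes>\<^sub>v y"
  by transfer (auto simp: cinner_add_left algebra_simps)

lemma tensor_vec_add_right: "x \<otimes>\<^sub>v (y + y') = x \<otimes>\<^sub>v y + x \<otimes>\<^sub>v y'"
  by transfer (auto simp: cinner_add_left algebra_simps)

lemma tensor_vec_scaleC_left: "(c *\<^sub>C x) \<otimes>\<^sub>v y = c *\<^sub>C (x \<otimes>\<^sub>v y)"
  by transfer (auto simp: cinner_scaleC_left algebra_simps)

lemma tensor_vec_scaleC_right: "x \<otimes>\<^sub>v (c *\<^sub>C y) = c *\<^sub>C (x \<otimes>\<^sub>v y)"
  by transfer (auto simp: cinner_scaleC_left algebra_simps)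

lemma cinner_tensor_vec: "cinner (x \<otimes>\<^sub>v y) (x' \<otimes>\<^sub>v y') = cinner x x' * cinner y y'"
proof -
  have "cinner (x \<otimes>\<^sub>v y) (x' \<otimes>\<^sub>v y')
      = (\<Sum>\<^sub>\<infinity>p\<in>onb \<times> onb. case p of (e, f) \<Rightarrow> (cinner x e * cnj (cinner x' e)) * (cinner y f * cnj (cinner y' f)))"
    unfolding cinner_htensor.rep_eq ell2_inner_def tensor_vec.rep_eq
    by (rule infsum_cong_neutral) (auto split: if_splits)
  also have "\<dots> = cinner x x' * cinner y y'"
    by (rule infsumI) (rule has_sum_tensor_aux)
  finally show ?thesis .
qed

lemma dense_tensor_vec: "closure (cspan {x \<otimes>\<^sub>v y | x y. True}) = (UNIV :: ('h::chilbert_space \<otimes>\<^sub>H 'k::chilbert_space) set)"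
proof -
  have "F \<in> closure (cspan {x \<otimes>\<^sub>v y | x y. True})" for F :: "'h \<otimes>\<^sub>H 'k"
    unfolding closure_approachable
  proof (intro allI impI)
    fix e :: real assume "e > 0"
    let ?R = "Rep_htensor F" and ?q = "\<lambda>p. (cmod (Rep_htensor F p))\<^sup>2"
    have R0: "?R p = 0" if "p \<notin> onb \<times> onb" for p
      using Rep_htensor[of F] that by blast
    have qs: "?q summable_on UNIV"
      using square_summable_Rep_htensor[of F] by (simp add: square_summable_def)
    have "e\<^sup>2/4 > 0" using \<open>e > 0\<close> by simp
    from infsum_finite_approximation[OF qs this] obtain S where S: "finite S"
      and dS: "dist (sum ?q S) (infsum ?q UNIV) \<le> e\<^sup>2/4" by blast
    define S' where "S' = S \<inter> onb \<times> onb"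
    have "finite S'" and sub: "S' \<subseteq> onb \<times> onb" using S by (auto simp: S'_def)
    define G :: "'h \<otimes>\<^sub>H 'k" where "G = (\<Sum>p\<in>S'. ?R p *\<^sub>C (fst p \<otimes>\<^sub>v snd p))"
    have G: "G \<in> cspan {x \<otimes>\<^sub>v y | x y. True}"
      unfolding G_def by (intro cvec.span_sum cvec.span_scale cvec.span_base) auto
    have unit: "Rep_htensor (fst p \<otimes>\<^sub>v snd p :: 'h \<otimes>\<^sub>H 'k) r = (if r = p then 1 else 0)" if "p \<in> onb \<times> onb" for p r
      using that by (auto simp: tensor_vec.rep_eq cinner_onb split: prod.splits)
    have RG: "Rep_htensor G r = (if r \<in> S' then ?R r else 0)" for r
    proof -
      have "Rep_htensor (\<Sum>p\<in>T. ?R p *\<^sub>C (fst p \<otimes>\<^sub>v snd p) :: 'h \<otimes>\<^sub>H 'k) r = (\<Sum>p\<in>T. ?R p * (if r = p then 1 else 0))"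
        if "finite T" "T \<subseteq> onb \<times> onb" for T
        using that
      proof (induction T rule: finite_induct)
        case (insert p T)
        then show ?case
          using unit[of p r] by (simp add: plus_htensor.rep_eq scaleC_htensor.rep_eq)
      qed (simp add: zero_htensor.rep_eq)
      from this[OF \<open>finite S'\<close> sub] show ?thesis
        using \<open>finite S'\<close> by (simp add: G_def if_distrib cong: if_cong)
    qed
    have "(norm (F - G))\<^sup>2 = (\<Sum>\<^sub>\<infinity>p. (cmod (Rep_htensor (F - G) p))\<^sup>2)"
      by (simp add: norm_htensor.rep_eq ell2_norm_power2)
    also have "\<dots> = (\<Sum>\<^sub>\<infinity>p\<in>-S. ?q p)"
      by (rule infsum_cong_neutral) (auto simp: minus_htensor.rep_eq RG S'_def R0)
    also have "\<dots> = infsum ?q UNIV - sum ?q S"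
      using infsum_Diff[OF qs summable_on_finite[OF S]] S by (simp add: Compl_eq_Diff_UNIV)
    also have "\<dots> \<le> e\<^sup>2/4"
      using dS unfolding dist_real_def by linarith
    also have "\<dots> < e\<^sup>2" using \<open>e > 0\<close> by simp
    finally have "norm (F - G) < e"
      by (rule power2_less_imp_less) (use \<open>e > 0\<close> in simp)
    then have "dist G F < e" by (simp add: dist_norm norm_minus_commute)
    with G show "\<exists>G\<in>cspan {x \<otimes>\<^sub>v y | x y. True}. dist G F < e" by blast
  qed
  then show ?thesis by auto
qed

typedef (overloaded) ('h::chilbert_space) bop
  = "{T :: 'h \<Rightarrow>\<^sub>L 'h. \<forall>c x. blinfun_apply T (c *\<^sub>C x) = c *\<^sub>C blinfun_apply T x}"
  by (rule exI[of _ 0]) simp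

setup_lifting type_definition_bop

lift_definition bop_apply :: "'h::chilbert_space bop \<Rightarrow> 'h \<Rightarrow> 'h"  (infixr \<open>\<cdot>\<close> 75) is blinfun_apply .

instantiation bop :: (chilbert_space) complex_normed_vector
begin

lift_definition zero_bop :: "'a bop" is 0 by simp

lift_definition plus_bop :: "'a bop \<Rightarrow> 'a bop \<Rightarrow> 'a bop" is "(+)"
  by (simp add: blinfun.add_left scaleC_add_right)

lift_definition uminus_bop :: "'a bop \<Rightarrow> 'a bop" is uminus
  by (simp add: blinfun.minus_left)

lift_definition minus_bop :: "'a bop \<Rightarrow> 'a bop \<Rightarrow> 'a bop" is "(-)"
  by (simp add: blinfun.diff_left cvec.scale_right_diff_distrib)

lift_definition scaleR_bop :: "real \<Rightarrow> 'a bop \<Rightarrow> 'a bop" is "(*\<^sub>R)"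
  by (simp add: blinfun.scaleR_left scaleR_scaleC scaleC_scaleC mult.commute)

lift_definition scaleC_bop :: "complex \<Rightarrow> 'a bop \<Rightarrow> 'a bop" is "\<lambda>c T. Blinfun (\<lambda>x. c *\<^sub>C blinfun_apply T x)"
  by (subst (1 2) bounded_linear_Blinfun_apply)
    (auto intro: bounded_linear_compose[OF bounded_linear_scaleC blinfun.bounded_linear_right]
      simp: scaleC_scaleC mult.commute)

lift_definition norm_bop :: "'a bop \<Rightarrow> real" is norm .

lift_definition dist_bop :: "'a bop \<Rightarrow> 'a bop \<Rightarrow> real" is dist .

definition sgn_bop :: "'a bop \<Rightarrow> 'a bop"
  where "sgn_bop T = inverse (norm T) *\<^sub>R T"

definition uniformity_bop :: "('a bop \<times> 'a bop) filter"
  where "uniformity_bop = (INF e\<in>{0<..}. principal {(x, y). dist x y < e})"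

definition open_bop :: "'a bop set \<Rightarrow> bool"
  where "open_bop S = (\<forall>x\<in>S. \<forall>\<^sub>F (x', y) in uniformity. x' = x \<longrightarrow> y \<in> S)"

lemma scaleC_bop_blinfun:
  "blinfun_apply (Blinfun (\<lambda>x. c *\<^sub>C blinfun_apply (T::'a::chilbert_space \<Rightarrow>\<^sub>L 'a) x)) x = c *\<^sub>C blinfun_apply T x"
  by (subst bounded_linear_Blinfun_apply)
    (auto intro: bounded_linear_compose[OF bounded_linear_scaleC blinfun.bounded_linear_right])

instance
proof
  fix S T R :: "'a bop" and a b :: complex and r s :: real
  show "S + T + R = S + (T + R)" by transfer (simp add: add.assoc)
  show "S + T = T + S" by transfer (simp add: add.commute)
  show "0 + T = T" by transfer simp
  show "- T + T = 0" by transfer simp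
  show "S - T = S + - T" by transfer simp
  show "r *\<^sub>R (S + T) = r *\<^sub>R S + r *\<^sub>R T" by transfer (simp add: scaleR_add_right)
  show "(r + s) *\<^sub>R T = r *\<^sub>R T + s *\<^sub>R T" by transfer (simp add: scaleR_add_left)
  show "r *\<^sub>R s *\<^sub>R T = (r * s) *\<^sub>R T" by transfer simp
  show "1 *\<^sub>R T = T" by transfer simp
  show "a *\<^sub>C (S + T) = a *\<^sub>C S + a *\<^sub>C T"
    by (transfer, rule blinfun_eqI, simp only: scaleC_bop_blinfun)
      (simp add: scaleC_bop_blinfun blinfun.add_left scaleC_add_right)
  show "(a + b) *\<^sub>C T = a *\<^sub>C T + b *\<^sub>C T"
    by (transfer, rule blinfun_eqI, simp only: scaleC_bop_blinfun)
      (simp add: scaleC_bop_blinfun blinfun.add_left scaleC_add_left)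
  show "a *\<^sub>C b *\<^sub>C T = (a * b) *\<^sub>C T"
    by transfer (auto intro!: blinfun_eqI simp: scaleC_bop_blinfun scaleC_scaleC)
  show "r *\<^sub>R T = complex_of_real r *\<^sub>C T"
    by transfer (auto intro!: blinfun_eqI simp: scaleC_bop_blinfun blinfun.scaleR_left scaleR_scaleC)
  show "dist S T = norm (S - T)" by transfer (simp add: dist_norm)
  show "sgn T = inverse (norm T) *\<^sub>R T" by (rule sgn_bop_def)
  show "uniformity = (INF e\<in>{0<..}. principal {(x, y :: 'a bop). dist x y < e})"
    by (rule uniformity_bop_def)
  show "open U = (\<forall>x\<in>U. \<forall>\<^sub>F (x', y) in uniformity. x' = x \<longrightarrow> y \<in> U)" for U :: "'a bop set"
    by (rule open_bop_def)
  show "norm T = 0 \<longleftrightarrow> T = 0" by transfer simp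
  show "norm (S + T) \<le> norm S + norm T" by transfer (rule norm_triangle_ineq)
  show "norm (r *\<^sub>R T) = \<bar>r\<bar> * norm T" by transfer simp
  show "norm (a *\<^sub>C T) = cmod a * norm T"
  proof (transfer fixing: a)
    fix T :: "'a \<Rightarrow>\<^sub>L 'a"
    show "norm (Blinfun (\<lambda>x. a *\<^sub>C blinfun_apply T x)) = cmod a * norm T"
    proof -
      let ?aT = "Blinfun (\<lambda>x. a *\<^sub>C blinfun_apply T x)"
      have n: "norm (blinfun_apply ?aT x) = norm (blinfun_apply (cmod a *\<^sub>R T) x)" for x
        by (simp add: scaleC_bop_blinfun norm_scaleC blinfun.scaleR_left)
      have "norm ?aT = norm (cmod a *\<^sub>R T)"
        by (rule antisym; rule norm_blinfun_bound)
          (use n norm_blinfun[of ?aT] norm_blinfun[of "cmod a *\<^sub>R T"] in auto)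
      then show ?thesis by simp
    qed
  qed
qed

end

lemma bop_eqI: "(\<And>x. S \<cdot> x = T \<cdot> x) \<Longrightarrow> S = T"
  by transfer (rule blinfun_eqI)

lemma bounded_linear_bop_apply: "bounded_linear (bop_apply T)"
  by transfer (rule blinfun.bounded_linear_right)

lemma bop_apply_add: "T \<cdot> (x + y) = T \<cdot> x + T \<cdot> y"
  by transfer (rule blinfun.add_right)

lemma bop_apply_diff: "T \<cdot> (x - y) = T \<cdot> x - T \<cdot> y"
  by transfer (rule blinfun.diff_right)

lemma bop_apply_scaleC: "T \<cdot> (c *\<^sub>C x) = c *\<^sub>C T \<cdot> x"
  by transfer simp

lemma bop_add_apply: "(S + T) \<cdot> x = S \<cdot> x + T \<cdot> x"
  by transfer (rule blinfun.add_left)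

lemma bop_diff_apply: "(S - T) \<cdot> x = S \<cdot> x - T \<cdot> x"
  by transfer (rule blinfun.diff_left)

lemma bop_scaleC_apply: "(c *\<^sub>C T) \<cdot> x = c *\<^sub>C T \<cdot> x"
  by transfer (rule scaleC_bop_blinfun)

lemma bop_scaleR_apply: "(r *\<^sub>R T) \<cdot> x = r *\<^sub>R T \<cdot> x"
  by transfer (rule blinfun.scaleR_left)

lemma norm_bop_apply: "norm (T \<cdot> x) \<le> norm T * norm x"
  by transfer (rule norm_blinfun)

lemma norm_bop_bound: "0 \<le> b \<Longrightarrow> (\<And>x. norm (T \<cdot> x) \<le> b * norm x) \<Longrightarrow> norm T \<le> b"
  by transfer (rule norm_blinfun_bound)

lemma bop_exists:
  assumes "\<And>x y. f (x + y) = f x + f y" "\<And>c x. f (c *\<^sub>C x) = c *\<^sub>C f x" "\<And>x. norm (f x) \<le> norm x * K"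
  obtains T :: "'h::chilbert_space bop" where "bop_apply T = f"
proof -
  have bl: "bounded_linear f"
    using assms by (intro bounded_linear_intro) (auto simp: scaleR_scaleC)
  have "bop_apply (Abs_bop (Blinfun f)) = f"
    by (simp add: bop_apply.rep_eq Abs_bop_inverse bounded_linear_Blinfun_apply[OF bl] assms)
  then show thesis by (rule that)
qed

lemma cinner_ext: "(\<And>z. cinner z x = cinner z y) \<Longrightarrow> x = (y::'h::chilbert_space)"
proof -
  assume "\<And>z. cinner z x = cinner z y"
  then have "cinner (x - y) (x - y) = 0" by (simp add: cinner_diff_right)
  then show "x = y" by (simp add: cinner_self)
qed

lemma riesz_bop: "\<exists>z. \<forall>x. cinner (T \<cdot> x) y = cinner x (z::'h::chilbert_space)"
proof -
  define c where "c e = cinner y (T \<cdot> e)" for e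
  have cs: "(\<lambda>e. (cmod (c e))\<^sup>2) summable_on onb"
  proof (rule nonneg_bdd_above_summable_on)
    show "bdd_above (sum (\<lambda>e. (cmod (c e))\<^sup>2) ` {F. F \<subseteq> onb \<and> finite F})"
    proof (rule bdd_aboveI2)
      fix F :: "'h set" assume "F \<in> {F. F \<subseteq> onb \<and> finite F}"
      then have F: "finite F" "F \<subseteq> onb" by auto
      define w where "w = (\<Sum>e\<in>F. c e *\<^sub>C e)"
      have nw: "(norm w)\<^sup>2 = (\<Sum>e\<in>F. (cmod (c e))\<^sup>2)"
        unfolding w_def using F by (rule norm_sum_onb)
      have "T \<cdot> w = (\<Sum>e\<in>F. c e *\<^sub>C T \<cdot> e)"
        unfolding w_def
        by (subst linear_sum[OF bounded_linear.linear[OF bounded_linear_bop_apply]]) (simp add: bop_apply_scaleC)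
      then have "cinner (T \<cdot> w) y = (\<Sum>e\<in>F. c e * cnj (c e))"
        unfolding c_def by (simp only: cinner_sum_left cinner_scaleC_left cinner_commute[of "T \<cdot> _" y])
      also have "\<dots> = of_real ((norm w)\<^sup>2)"
        by (simp only: complex_norm_square[symmetric] of_real_sum[symmetric] nw)
      finally have "(norm w)\<^sup>2 = cmod (cinner (T \<cdot> w) y)"
        by (metis abs_of_nonneg norm_of_real zero_le_power2)
      also have "\<dots> \<le> norm (T \<cdot> w) * norm y" by (rule cauchy_schwarz)
      also have "\<dots> \<le> norm T * norm w * norm y" by (intro mult_right_mono norm_bop_apply) simp
      finally have "norm w * norm w \<le> norm w * (norm T * norm y)"
        by (simp add: power2_eq_square algebra_simps)
      then have "norm w \<le> norm T * norm y"
        by (metis mult_left_le_imp_le mult_nonneg_nonneg norm_ge_zero order_le_less zero_less_norm_iff)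
      then show "(\<Sum>e\<in>F. (cmod (c e))\<^sup>2) \<le> (norm T * norm y)\<^sup>2"
        unfolding nw[symmetric] by (intro power_mono) auto
    qed
  qed simp
  define z where "z = (\<Sum>\<^sub>\<infinity>e\<in>onb. c e *\<^sub>C e)"
  have "cinner (T \<cdot> x) y = cinner x z" for x
  proof (rule has_sum_unique)
    have "((\<lambda>e. cinner (T \<cdot> (cinner x e *\<^sub>C e)) y) has_sum cinner (T \<cdot> x) y) onb"
      by (rule has_sum_bounded_linear[OF bounded_linear_compose[OF bounded_linear_cinner_left bounded_linear_bop_apply]])
        (rule onb_expansion)
    then show "((\<lambda>e. cinner x e * cnj (c e)) has_sum cinner (T \<cdot> x) y) onb"
      unfolding c_def by (simp only: bop_apply_scaleC cinner_scaleC_left cinner_commute[of "T \<cdot> _" y])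
    have "((\<lambda>e. cinner x e * cnj (cinner z e)) has_sum cinner x z) onb"
      by (rule parseval)
    moreover have "cinner z e = c e" if "e \<in> onb" for e
      unfolding z_def using cs that by (rule cinner_infsum_onb)
    ultimately show "((\<lambda>e. cinner x e * cnj (c e)) has_sum cinner x z) onb"
      by (subst has_sum_cong[where g="\<lambda>e. cinner x e * cnj (cinner z e)"]) auto
  qed
  then show ?thesis by blast
qed

lemma adjoint_exists: "\<exists>S::'h::chilbert_space bop. \<forall>x y. cinner (T \<cdot> x) y = cinner x (S \<cdot> y)"
proof -
  from riesz_bop[of T] obtain f where f: "\<And>x y. cinner (T \<cdot> x) y = cinner x (f y)"
    by metis
  have "f (x + y) = f x + f y" for x y
    by (rule cinner_ext) (simp add: f[symmetric] cinner_add_right)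
  moreover have "f (c *\<^sub>C x) = c *\<^sub>C f x" for c x
    by (rule cinner_ext) (simp add: f[symmetric] cinner_scaleC_right)
  moreover have "norm (f x) \<le> norm x * norm T" for x
  proof -
    have "(norm (f x))\<^sup>2 = cmod (cinner (T \<cdot> f x) x)"
      by (simp add: f cinner_self del: of_real_power)
    also have "\<dots> \<le> norm (T \<cdot> f x) * norm x" by (rule cauchy_schwarz)
    also have "\<dots> \<le> norm T * norm (f x) * norm x" by (intro mult_right_mono norm_bop_apply) simp
    finally have "norm (f x) * norm (f x) \<le> norm (f x) * (norm x * norm T)"
      by (simp add: power2_eq_square algebra_simps)
    then show ?thesis
      by (metis mult_left_le_imp_le mult_nonneg_nonneg norm_ge_zero order_le_less zero_less_norm_iff)
  qed
  ultimately obtain S where "bop_apply S = f" by (rule bop_exists)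
  with f show ?thesis by metis
qed

instantiation bop :: (chilbert_space) unital_cstar_algebra
begin

lift_definition one_bop :: "'a bop" is id_blinfun by simp

lift_definition times_bop :: "'a bop \<Rightarrow> 'a bop \<Rightarrow> 'a bop" is blinfun_compose by simp

definition star_bop :: "'a bop \<Rightarrow> 'a bop"
  where "star_bop T = (THE S. \<forall>x y. cinner (T \<cdot> x) y = cinner x (S \<cdot> y))"

lemma bop_times_apply: "(S * T) \<cdot> x = S \<cdot> T \<cdot> (x::'a)"
  by transfer simp

lemma bop_one_apply: "1 \<cdot> (x::'a) = x"
  by transfer simp

lemma adjoint_unique:
  assumes "\<And>x y. cinner (T \<cdot> x) y = cinner x (S \<cdot> (y::'a))"
  shows "star T = S"
  unfolding star_bop_def
proof (rule the_equality)
  fix R assume "\<forall>x y. cinner (T \<cdot> x) y = cinner x (R \<cdot> y)"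
  then show "R = S" using assms by (intro bop_eqI cinner_ext) metis
qed (use assms in blast)

lemma cinner_star_right: "cinner x (star T \<cdot> y) = cinner (T \<cdot> x) (y::'a)"
proof -
  obtain S where S: "\<And>x y. cinner (T \<cdot> x) y = cinner x (S \<cdot> y)"
    using adjoint_exists by metis
  then have "star T = S" by (rule adjoint_unique)
  then show ?thesis using S by simp
qed

lemma cinner_star_left: "cinner (star T \<cdot> x) y = cinner x (T \<cdot> (y::'a))"
  by (metis cinner_commute cinner_star_right)

instance
proof
  fix S T R :: "'a bop" and a b :: complex and r :: real
  show "S * T * R = S * (T * R)" by transfer (auto intro: blinfun_eqI)
  show "(S + T) * R = S * R + T * R" by (rule bop_eqI) (simp add: bop_times_apply bop_add_apply)
  show "R * (S + T) = R * S + R * T" by (rule bop_eqI) (simp add: bop_times_apply bop_add_apply bop_apply_add)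
  show "r *\<^sub>R S * T = r *\<^sub>R (S * T)" by (rule bop_eqI) (simp add: bop_times_apply bop_scaleR_apply)
  show "S * r *\<^sub>R T = r *\<^sub>R (S * T)"
    by (rule bop_eqI) (simp add: bop_times_apply scaleR_scaleC bop_scaleC_apply bop_apply_scaleC)
  have submult: "norm (V * W) \<le> norm V * norm W" for V W :: "'a bop"
    by transfer (rule norm_blinfun_compose)
  then show "norm (S * T) \<le> norm S * norm T" .
  show "1 * T = T" "T * 1 = T" by (rule bop_eqI; simp add: bop_times_apply bop_one_apply)+
  show "a *\<^sub>C S * T = a *\<^sub>C (S * T)" by (rule bop_eqI) (simp add: bop_times_apply bop_scaleC_apply)
  show "S * a *\<^sub>C T = a *\<^sub>C (S * T)"
    by (rule bop_eqI) (simp add: bop_times_apply bop_scaleC_apply bop_apply_scaleC)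
  show "star (S + T) = star S + star T"
    by (rule adjoint_unique) (simp add: bop_add_apply cinner_add_left cinner_add_right cinner_star_right)
  show "star (a *\<^sub>C T) = cnj a *\<^sub>C star T"
    by (rule adjoint_unique) (simp add: bop_scaleC_apply cinner_scaleC_left cinner_scaleC_right cinner_star_right)
  show "star (S * T) = star T * star S"
    by (rule adjoint_unique) (simp add: bop_times_apply cinner_star_right)
  show "star (star T) = T"
    by (rule adjoint_unique) (simp add: cinner_star_left)
  have le: "(norm V)\<^sup>2 \<le> norm (star V * V)" for V :: "'a bop"
  proof -
    have "norm (V \<cdot> x) \<le> sqrt (norm (star V * V)) * norm x" for x
    proof (rule power2_le_imp_le)
      have "(norm (V \<cdot> x))\<^sup>2 = cmod (cinner x ((star V * V) \<cdot> x))"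
        by (simp add: bop_times_apply cinner_star_right cinner_self del: of_real_power)
      also have "\<dots> \<le> norm x * norm ((star V * V) \<cdot> x)" by (rule cauchy_schwarz)
      also have "\<dots> \<le> norm x * (norm (star V * V) * norm x)"
        by (intro mult_left_mono norm_bop_apply) simp
      finally show "(norm (V \<cdot> x))\<^sup>2 \<le> (sqrt (norm (star V * V)) * norm x)\<^sup>2"
        by (simp add: power2_eq_square algebra_simps)
    qed simp
    then have "norm V \<le> sqrt (norm (star V * V))"
      by (intro norm_bop_bound) auto
    then have "(norm V)\<^sup>2 \<le> (sqrt (norm (star V * V)))\<^sup>2"
      by (intro power_mono) auto
    then show ?thesis by simp
  qed
  have mult: "norm (star V * V) \<le> norm (star V) * norm V" for V :: "'a bop"
    by (rule submult)
  have star_le: "norm V \<le> norm (star V)" for V :: "'a bop"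
  proof -
    have "norm V * norm V \<le> norm (star V) * norm V"
      using le[of V] mult[of V] by (simp add: power2_eq_square)
    then show ?thesis
      by (metis mult_right_le_imp_le norm_ge_zero order_le_less zero_less_norm_iff)
  qed
  have "star (star T) = T"
    by (rule adjoint_unique) (simp add: cinner_star_left)
  then have "norm (star T) = norm T"
    using star_le[of T] star_le[of "star T"] by simp
  then show "norm (star T * T) = (norm T)\<^sup>2"
    using le[of T] mult[of T] by (simp add: power2_eq_square)
next
  fix X :: "nat \<Rightarrow> 'a bop"
  assume X: "Cauchy X"
  then have "Cauchy (\<lambda>n. Rep_bop (X n))"
    unfolding Cauchy_def by (simp add: dist_bop.rep_eq)
  then obtain L where L: "(\<lambda>n. Rep_bop (X n)) \<longlonglongrightarrow> L"
    using Cauchy_convergent_iff convergent_def by blast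
  have lim: "(\<lambda>n. blinfun_apply (Rep_bop (X n)) x) \<longlonglongrightarrow> blinfun_apply L x" for x
    using L by (intro blinfun.tendsto tendsto_const)
  have "blinfun_apply L (c *\<^sub>C x) = c *\<^sub>C blinfun_apply L x" for c x
  proof (rule LIMSEQ_unique)
    show "(\<lambda>n. blinfun_apply (Rep_bop (X n)) (c *\<^sub>C x)) \<longlonglongrightarrow> blinfun_apply L (c *\<^sub>C x)"
      by (rule lim)
    have "(\<lambda>n. c *\<^sub>C blinfun_apply (Rep_bop (X n)) x) \<longlonglongrightarrow> c *\<^sub>C blinfun_apply L x"
      by (rule bounded_linear.tendsto[OF bounded_linear_scaleC lim])
    then show "(\<lambda>n. blinfun_apply (Rep_bop (X n)) (c *\<^sub>C x)) \<longlonglongrightarrow> c *\<^sub>C blinfun_apply L x"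
      using bop_apply_scaleC[of "X _"] by (simp add: bop_apply.rep_eq)
  qed
  then have RL: "Rep_bop (Abs_bop L) = L"
    by (intro Abs_bop_inverse) blast
  have "X \<longlonglongrightarrow> Abs_bop L"
    using L unfolding tendsto_iff by (simp add: dist_bop.rep_eq RL)
  then show "convergent X" by (auto simp: convergent_def)
qed

end

definition clinear_on :: "'p::complex_vector set \<Rightarrow> ('p \<Rightarrow> 'q::complex_vector) \<Rightarrow> bool"
  where "clinear_on V W \<longleftrightarrow> (\<forall>x\<in>V. \<forall>y\<in>V. W (x + y) = W x + W y) \<and> (\<forall>c. \<forall>x\<in>V. W (c *\<^sub>C x) = c *\<^sub>C W x)"

text \<open>\<open>cont_ext I g g'\<close> is the continuous linear map on the closed linear span of the family \<open>g\<close> that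
  sends \<open>g i\<close> to \<open>g' i\<close>. It is uniquely determined on that closed span (\<open>cont_ext_eqI\<close>), and
  meaningful only there.\<close>

definition cont_ext :: "'i set \<Rightarrow> ('i \<Rightarrow> 'p::complex_normed_vector) \<Rightarrow> ('i \<Rightarrow> 'q::complex_normed_vector) \<Rightarrow> 'p \<Rightarrow> 'q"
  where "cont_ext I g g' = (SOME W. clinear_on (closure (cspan (g ` I))) W \<and>
    continuous_on (closure (cspan (g ` I))) W \<and> (\<forall>i\<in>I. W (g i) = g' i))"

lemma cont_ext_eqI:
  fixes g :: "'i \<Rightarrow> 'p::complex_normed_vector" and g' :: "'i \<Rightarrow> 'q::complex_normed_vector"
  assumes W: "clinear_on (closure (cspan (g ` I))) W" "continuous_on (closure (cspan (g ` I))) W"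
    "\<And>i. i \<in> I \<Longrightarrow> W (g i) = g' i"
    and t: "t \<in> closure (cspan (g ` I))"
  shows "cont_ext I g g' t = W t"
proof -
  let ?V = "closure (cspan (g ` I))" and ?E = "cont_ext I g g'"
  have E: "clinear_on ?V ?E \<and> continuous_on ?V ?E \<and> (\<forall>i\<in>I. ?E (g i) = g' i)"
    unfolding cont_ext_def by (rule someI[of _ W]) (use W in auto)
  have sub: "cspan (g ` I) \<subseteq> ?V" by (rule closure_subset)
  have "x \<in> cspan (g ` I) \<and> ?E x = W x" if "x \<in> cspan (g ` I)" for x
    using that
  proof (induction rule: cvec.span_induct_alt)
    case base
    have "?E (0 *\<^sub>C 0) = 0 *\<^sub>C ?E 0" "W (0 *\<^sub>C 0) = 0 *\<^sub>C W 0"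
      using E W(1) cvec.span_zero[of "g ` I"] sub unfolding clinear_on_def by blast+
    then show ?case by (simp add: cvec.span_zero)
  next
    case (step c x y)
    then have s: "x \<in> cspan (g ` I)" "c *\<^sub>C x \<in> cspan (g ` I)" "y \<in> cspan (g ` I)"
      by (auto intro: cvec.span_base cvec.span_scale)
    then have v: "x \<in> ?V" "c *\<^sub>C x \<in> ?V" "y \<in> ?V" using sub by blast+
    have "?E x = W x" using step E W(3) by auto
    then have "?E (c *\<^sub>C x + y) = W (c *\<^sub>C x + y)"
      using step v E W(1) unfolding clinear_on_def by simp
    then show ?case using s by (auto intro: cvec.span_add)
  qed
  moreover have "closed {x \<in> ?V. ?E x = W x}"
    using E W(2) continuous_closed_preimage_constant[of ?V "\<lambda>x. ?E x - W x" 0]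
    by (auto intro: continuous_on_diff)
  ultimately have "?V \<subseteq> {x \<in> ?V. ?E x = W x}"
    using sub by (intro closure_minimal) blast+
  with t show ?thesis by auto
qed

definition op_tensor :: "'h::chilbert_space bop \<Rightarrow> 'k::chilbert_space bop \<Rightarrow> ('h \<otimes>\<^sub>H 'k) bop"  (infixr \<open>\<otimes>\<^sub>o\<close> 70)
  where "S \<otimes>\<^sub>o T = (THE R. \<forall>x y. R \<cdot> (x \<otimes>\<^sub>v y) = (S \<cdot> x) \<otimes>\<^sub>v (T \<cdot> y))"

lemma op_tensor_eqI:
  assumes R: "\<And>x y. R \<cdot> (x \<otimes>\<^sub>v y) = (S \<cdot> x) \<otimes>\<^sub>v (T \<cdot> y)"
  shows "S \<otimes>\<^sub>o T = R"
  unfolding op_tensor_def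
proof (rule the_equality)
  fix R' assume R': "\<forall>x y. R' \<cdot> (x \<otimes>\<^sub>v y) = (S \<cdot> x) \<otimes>\<^sub>v (T \<cdot> y)"
  let ?g = "\<lambda>(x, y). x \<otimes>\<^sub>v y :: 'a \<otimes>\<^sub>H 'b" and ?g' = "\<lambda>(x, y). (S \<cdot> x) \<otimes>\<^sub>v (T \<cdot> y)"
  have "range ?g = {x \<otimes>\<^sub>v y | x y. True}" by auto
  then have UN: "closure (cspan (range ?g)) = UNIV" using dense_tensor_vec by metis
  have lin: "clinear_on UNIV (bop_apply Q)" "continuous_on UNIV (bop_apply Q)" for Q :: "('a \<otimes>\<^sub>H 'b) bop"
    by (auto simp: clinear_on_def bop_apply_add bop_apply_scaleC
        intro: linear_continuous_on bounded_linear_bop_apply)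
  have "R' \<cdot> z = cont_ext UNIV ?g ?g' z" "R \<cdot> z = cont_ext UNIV ?g ?g' z" for z
    by (rule cont_ext_eqI[symmetric]; use R R' UN lin in auto)+
  then show "R' = R" by (intro bop_eqI) simp
qed (use R in blast)

definition tensor_assoc :: "('h::chilbert_space \<otimes>\<^sub>H 'k::chilbert_space) \<otimes>\<^sub>H 'l::chilbert_space \<Rightarrow> 'h \<otimes>\<^sub>H ('k \<otimes>\<^sub>H 'l)"
  where "tensor_assoc = cont_ext UNIV (\<lambda>(x, y, z). (x \<otimes>\<^sub>v y) \<otimes>\<^sub>v z) (\<lambda>(x, y, z). x \<otimes>\<^sub>v (y \<otimes>\<^sub>v z))"

text \<open>The minimal (spatial) tensor product of concretely represented C*-algebras \<open>X\<close> and \<open>Y\<close>.\<close>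

definition min_tensor :: "'h::chilbert_space bop set \<Rightarrow> 'k::chilbert_space bop set \<Rightarrow> ('h \<otimes>\<^sub>H 'k) bop set"
  where "min_tensor X Y = closure (cspan {S \<otimes>\<^sub>o T | S T. S \<in> X \<and> T \<in> Y})"

definition compact_ops :: "'h::chilbert_space bop set"
  where "compact_ops = {T. compact (closure ((\<lambda>x. T \<cdot> x) ` cball 0 1))}"

text \<open>The multiplier algebra of an algebra \<open>C\<close> of operators acting non-degenerately.\<close>

definition multipliers :: "'h::chilbert_space bop set \<Rightarrow> 'h bop set"
  where "multipliers C = {m. \<forall>c\<in>C. m * c \<in> C \<and> c * m \<in> C}"

text \<open>The extension to \<^term>\<open>multipliers C\<close> of a *-homomorphism \<open>\<theta>\<close> on \<open>C\<close> for which \<open>\<theta> ` C\<close> acts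
  non-degenerately.\<close>

definition multiplier_ext :: "'h::chilbert_space bop set \<Rightarrow> ('h bop \<Rightarrow> 'l::chilbert_space bop) \<Rightarrow> 'h bop \<Rightarrow> 'l bop"
  where "multiplier_ext C \<theta> m = (THE T. \<forall>c\<in>C. T * \<theta> c = \<theta> (m * c))"

definition unital_star_hom :: "('a::unital_cstar_algebra \<Rightarrow> 'b::unital_cstar_algebra) \<Rightarrow> bool"
  where "unital_star_hom f \<longleftrightarrow> f 1 = 1 \<and> clinear_on UNIV f \<and>
    (\<forall>x y. f (x * y) = f x * f y) \<and> (\<forall>x. f (star x) = star (f x))"

definition star_rep :: "('a::unital_cstar_algebra \<Rightarrow> 'h::chilbert_space bop) \<Rightarrow> bool"
  where "star_rep \<pi> \<longleftrightarrow> clinear_on UNIV \<pi> \<and>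
    (\<forall>x y. \<pi> (x * y) = \<pi> x * \<pi> y) \<and> (\<forall>x. \<pi> (star x) = star (\<pi> x))"

definition faithful_nondegenerate_rep :: "('a::unital_cstar_algebra \<Rightarrow> 'k::chilbert_space bop) \<Rightarrow> bool"
  where "faithful_nondegenerate_rep \<pi> \<longleftrightarrow> star_rep \<pi> \<and> inj \<pi> \<and> closure (cspan {\<pi> a \<cdot> \<eta> | a \<eta>. True}) = UNIV"

text \<open>In the following, the abstract C*-algebra A comes with a faithful non-degenerate representation
  \<open>\<pi>\<close> on K. The minimal tensor product does not depend on the choice of faithful representations of
  its factors, so A \<open>\<otimes>\<close> A is \<^term>\<open>min_tensor (range \<pi>) (range \<pi>)\<close>, acting on K \<open>\<otimes>\<close> K, and a
  homomorphism from A to A \<open>\<otimes>\<close> A is a map \<open>\<Phi>\<close> from A to this algebra of operators.\<close>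

definition comult_tensor_id :: "('a::unital_cstar_algebra \<Rightarrow> 'k::chilbert_space bop) \<Rightarrow> ('a \<Rightarrow> ('k \<otimes>\<^sub>H 'k) bop)
    \<Rightarrow> ('k \<otimes>\<^sub>H 'k) bop \<Rightarrow> (('k \<otimes>\<^sub>H 'k) \<otimes>\<^sub>H 'k) bop"
  where "comult_tensor_id \<pi> \<Phi> = cont_ext UNIV (\<lambda>(a, b). \<pi> a \<otimes>\<^sub>o \<pi> b) (\<lambda>(a, b). \<Phi> a \<otimes>\<^sub>o \<pi> b)"

definition id_tensor_comult :: "('a::unital_cstar_algebra \<Rightarrow> 'k::chilbert_space bop) \<Rightarrow> ('a \<Rightarrow> ('k \<otimes>\<^sub>H 'k) bop)
    \<Rightarrow> ('k \<otimes>\<^sub>H 'k) bop \<Rightarrow> ('k \<otimes>\<^sub>H ('k \<otimes>\<^sub>H 'k)) bop"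
  where "id_tensor_comult \<pi> \<Phi> = cont_ext UNIV (\<lambda>(a, b). \<pi> a \<otimes>\<^sub>o \<pi> b) (\<lambda>(a, b). \<pi> a \<otimes>\<^sub>o \<Phi> b)"

definition comultiplication :: "('a::unital_cstar_algebra \<Rightarrow> 'k::chilbert_space bop) \<Rightarrow> ('a \<Rightarrow> ('k \<otimes>\<^sub>H 'k) bop) \<Rightarrow> bool"
  where "comultiplication \<pi> \<Phi> \<longleftrightarrow> unital_star_hom \<Phi> \<and> range \<Phi> \<subseteq> min_tensor (range \<pi>) (range \<pi>) \<and>
    (\<forall>a \<zeta>. tensor_assoc (comult_tensor_id \<pi> \<Phi> (\<Phi> a) \<cdot> \<zeta>) = id_tensor_comult \<pi> \<Phi> (\<Phi> a) \<cdot> tensor_assoc \<zeta>)"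

definition compact_quantum_group :: "('a::unital_cstar_algebra \<Rightarrow> 'k::chilbert_space bop) \<Rightarrow> ('a \<Rightarrow> ('k \<otimes>\<^sub>H 'k) bop) \<Rightarrow> bool"
  where "compact_quantum_group \<pi> \<Phi> \<longleftrightarrow> comultiplication \<pi> \<Phi> \<and>
    closure (cspan {\<Phi> a * (\<pi> 1 \<otimes>\<^sub>o \<pi> b) | a b. True}) = min_tensor (range \<pi>) (range \<pi>) \<and>
    closure (cspan {\<Phi> a * (\<pi> b \<otimes>\<^sub>o \<pi> 1) | a b. True}) = min_tensor (range \<pi>) (range \<pi>)"

definition state :: "('a::unital_cstar_algebra \<Rightarrow> complex) \<Rightarrow> bool"
  where "state h \<longleftrightarrow> clinear_on UNIV h \<and> (\<forall>a. h (star a * a) \<in> \<real>\<^sub>\<ge>\<^sub>0) \<and> h 1 = 1"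

definition id_tensor_functional :: "('a::unital_cstar_algebra \<Rightarrow> 'k::chilbert_space bop) \<Rightarrow> ('a \<Rightarrow> complex)
    \<Rightarrow> ('k \<otimes>\<^sub>H 'k) bop \<Rightarrow> 'a"
  where "id_tensor_functional \<pi> h = cont_ext UNIV (\<lambda>(a, b). \<pi> a \<otimes>\<^sub>o \<pi> b) (\<lambda>(a, b). h b *\<^sub>C a)"

definition functional_tensor_id :: "('a::unital_cstar_algebra \<Rightarrow> 'k::chilbert_space bop) \<Rightarrow> ('a \<Rightarrow> complex)
    \<Rightarrow> ('k \<otimes>\<^sub>H 'k) bop \<Rightarrow> 'a"
  where "functional_tensor_id \<pi> h = cont_ext UNIV (\<lambda>(a, b). \<pi> a \<otimes>\<^sub>o \<pi> b) (\<lambda>(a, b). h a *\<^sub>C b)"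

definition haar_measure :: "('a::unital_cstar_algebra \<Rightarrow> 'k::chilbert_space bop) \<Rightarrow> ('a \<Rightarrow> ('k \<otimes>\<^sub>H 'k) bop)
    \<Rightarrow> ('a \<Rightarrow> complex) \<Rightarrow> bool"
  where "haar_measure \<pi> \<Phi> h \<longleftrightarrow> state h \<and>
    (\<forall>a. id_tensor_functional \<pi> h (\<Phi> a) = h a *\<^sub>C 1 \<and> functional_tensor_id \<pi> h (\<Phi> a) = h a *\<^sub>C 1)"

text \<open>The GNS triple of a state, which is unique up to unitary equivalence.\<close>

definition gns_triple :: "('a::unital_cstar_algebra \<Rightarrow> complex) \<Rightarrow> ('a \<Rightarrow> 'h::chilbert_space bop) \<Rightarrow> 'h \<Rightarrow> bool"
  where "gns_triple h \<pi>\<^sub>h \<xi>\<^sub>0 \<longleftrightarrow> star_rep \<pi>\<^sub>h \<and> closure (range (\<lambda>a. \<pi>\<^sub>h a \<cdot> \<xi>\<^sub>0)) = UNIV \<and>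
    (\<forall>a. h a = cinner (\<pi>\<^sub>h a \<cdot> \<xi>\<^sub>0) \<xi>\<^sub>0)"

text \<open>The action of A \<open>\<otimes>\<close> A on H \<open>\<otimes>\<close> K by the tensor product of the representations \<open>\<rho>\<close> on H and \<open>\<pi>\<close> on K.\<close>

definition rep_tensor :: "('a::unital_cstar_algebra \<Rightarrow> 'k::chilbert_space bop) \<Rightarrow> ('a \<Rightarrow> 'h::chilbert_space bop)
    \<Rightarrow> ('k \<otimes>\<^sub>H 'k) bop \<Rightarrow> ('h \<otimes>\<^sub>H 'k) bop"
  where "rep_tensor \<pi> \<rho> = cont_ext UNIV (\<lambda>(a, b). \<pi> a \<otimes>\<^sub>o \<pi> b) (\<lambda>(a, b). \<rho> a \<otimes>\<^sub>o \<pi> b)"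

definition compact_tensor :: "('a::unital_cstar_algebra \<Rightarrow> 'k::chilbert_space bop) \<Rightarrow> ('h::chilbert_space \<otimes>\<^sub>H 'k) bop set"
  where "compact_tensor \<pi> = min_tensor compact_ops (range \<pi>)"

text \<open>For a homomorphism \<open>\<psi>\<close> from A to A \<open>\<otimes>\<close> A, the extension to multipliers of
  \<open>\<iota> \<otimes> \<psi> : B\<^sub>0(H) \<otimes> A \<rightarrow> B\<^sub>0(H) \<otimes> A \<otimes> A\<close>, where the last algebra acts on H \<open>\<otimes>\<close> (K \<open>\<otimes>\<close> K).\<close>

definition id_tensor_ext :: "('a::unital_cstar_algebra \<Rightarrow> 'k::chilbert_space bop) \<Rightarrow> ('a \<Rightarrow> ('k \<otimes>\<^sub>H 'k) bop)
    \<Rightarrow> ('h::chilbert_space \<otimes>\<^sub>H 'k) bop \<Rightarrow> ('h \<otimes>\<^sub>H ('k \<otimes>\<^sub>H 'k)) bop"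
  where "id_tensor_ext \<pi> \<psi> = multiplier_ext (compact_tensor \<pi>)
    (cont_ext (compact_ops \<times> UNIV) (\<lambda>(x, a). x \<otimes>\<^sub>o \<pi> a) (\<lambda>(x, a). x \<otimes>\<^sub>o \<psi> a))"

definition leg12 :: "('a::unital_cstar_algebra \<Rightarrow> 'k::chilbert_space bop)
    \<Rightarrow> ('h::chilbert_space \<otimes>\<^sub>H 'k) bop \<Rightarrow> ('h \<otimes>\<^sub>H ('k \<otimes>\<^sub>H 'k)) bop"
  where "leg12 \<pi> = id_tensor_ext \<pi> (\<lambda>a. \<pi> a \<otimes>\<^sub>o \<pi> 1)"

definition leg13 :: "('a::unital_cstar_algebra \<Rightarrow> 'k::chilbert_space bop)
    \<Rightarrow> ('h::chilbert_space \<otimes>\<^sub>H 'k) bop \<Rightarrow> ('h \<otimes>\<^sub>H ('k \<otimes>\<^sub>H 'k)) bop"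
  where "leg13 \<pi> = id_tensor_ext \<pi> (\<lambda>a. \<pi> 1 \<otimes>\<^sub>o \<pi> a)"

definition unitary :: "'a::unital_cstar_algebra \<Rightarrow> bool"
  where "unitary v \<longleftrightarrow> star v * v = 1 \<and> v * star v = 1"

definition cqg_representation :: "('a::unital_cstar_algebra \<Rightarrow> 'k::chilbert_space bop) \<Rightarrow> ('a \<Rightarrow> ('k \<otimes>\<^sub>H 'k) bop)
    \<Rightarrow> ('h::chilbert_space \<otimes>\<^sub>H 'k) bop \<Rightarrow> bool"
  where "cqg_representation \<pi> \<Phi> v \<longleftrightarrow> v \<in> multipliers (compact_tensor \<pi>) \<and>
    id_tensor_ext \<pi> \<Phi> v = leg12 \<pi> v * leg13 \<pi> v"

definition unitary_cqg_representation :: "('a::unital_cstar_algebra \<Rightarrow> 'k::chilbert_space bop) \<Rightarrow> ('a \<Rightarrow> ('k \<otimes>\<^sub>H 'k) bop)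
    \<Rightarrow> ('h::chilbert_space \<otimes>\<^sub>H 'k) bop \<Rightarrow> bool"
  where "unitary_cqg_representation \<pi> \<Phi> v \<longleftrightarrow> cqg_representation \<pi> \<Phi> v \<and> unitary v"

end

theory Submission
  imports Defs
begin

text \<open>For a unital representation \<open>\<psi>\<close> of A on K \<open>\<otimes>\<close> K, the operator \<open>(\<iota> \<otimes> \<psi>)(u)\<close> sends \<open>a \<xi>\<^sub>0 \<otimes> \<zeta>\<close> to
  \<open>(\<pi>\<^sub>h \<otimes> \<psi>)(\<Phi> a) (\<xi>\<^sub>0 \<otimes> \<zeta>)\<close>: multiply \<open>u\<close> by the compact operator \<open>|a \<xi>\<^sub>0\<rangle>\<langle>\<xi>\<^sub>0| \<otimes> 1\<close>. Taking for \<open>\<psi>\<close> the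
  maps \<open>\<Phi>\<close>, \<open>a \<mapsto> a \<otimes> 1\<close> and \<open>a \<mapsto> 1 \<otimes> a\<close>, the identity \<open>(\<iota> \<otimes> \<Phi>)(u) = u\<^sub>1\<^sub>2 u\<^sub>1\<^sub>3\<close> on these vectors is
  coassociativity of \<open>\<Phi>\<close>, with \<open>\<pi>\<^sub>h\<close> applied to the first leg.

  All the maps involved are extensions by continuity, so their existence rests on the estimate
  \<open>\<parallel>\<Sum> x\<^sub>i \<otimes> \<theta> a\<^sub>i\<parallel> \<le> \<parallel>\<Sum> x\<^sub>i \<otimes> \<pi> a\<^sub>i\<parallel>\<close> for \<open>\<pi>\<close> faithful. Compressing by finite-rank projections reduces it
  to matrices over A, hence to contractivity of *-homomorphisms and isometry of the injective ones. Both
  of these follow from the square root series \<open>sqrt (1 - m)\<close>, which converges absolutely for \<open>\<parallel>m\<parallel> \<le> 1\<close>.\<close>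

section \<open>Square roots in C*-algebras\<close>

text \<open>A contractive linear map can lose its bound after tensoring with another algebra, as the
  transpose of matrices does. A *-homomorphism keeps it, because its amplification to matrices over
  A is again a *-homomorphism. Isometry of the injective \<open>\<pi>\<close> enters besides
  contractivity because matrices over A are handled as operators: their entries must be recoverable
  from the operator, both for the amplified map to be well defined and for its domain to be closed.
  In the abstract algebra no spectrum and no order is used; identities between sums of squares take
  their place. An extension \<open>cont_ext\<close> has a meaning only on the closed span of its
  generators. Hence each identity is checked on elementary tensors and carried over to the closed
  span, and each composition needs a proof that the inner map lands in the domain of the outer one.
  To keep these domains simple, the leg that is not transformed may carry arbitrary bounded
  operators.\<close>

lemma norm_star: "norm (star x) = norm (x::'a::unital_cstar_algebra)"
proof -
  have le: "norm y \<le> norm (star y)" for y :: 'a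
  proof -
    have "norm y * norm y \<le> norm (star y) * norm y"
      using cstar_identity[of y] norm_mult_ineq[of "star y" y] by (simp add: power2_eq_square)
    then show ?thesis
      by (metis mult_right_le_imp_le norm_ge_zero order_le_less zero_less_norm_iff)
  qed
  show ?thesis using le[of x] le[of "star x"] by (simp add: star_star)
qed

lemma star_one [simp]: "star (1::'a::unital_cstar_algebra) = 1"
  by (metis mult.left_neutral mult.right_neutral star_mult star_star)

text \<open>Only an inequality: the class contains the zero algebra, where 1 = 0.\<close>

lemma norm_one_le: "norm (1::'a::unital_cstar_algebra) \<le> 1"
proof -
  have "norm (1::'a) * norm (1::'a) = norm (1::'a)"
    using cstar_identity[of "1::'a"] by (simp add: power2_eq_square)
  then show ?thesis by (metis mult_cancel_right1 order_refl zero_le_one)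
qed

lemma star_zero [simp]: "star (0::'a::unital_cstar_algebra) = 0"
  by (metis add_cancel_right_right star_add)

lemma star_minus: "star (- x) = - star (x::'a::unital_cstar_algebra)"
  by (metis add.right_inverse add_eq_0_iff star_add star_zero)

lemma star_diff: "star (x - y) = star x - star (y::'a::unital_cstar_algebra)"
  by (simp add: diff_conv_add_uminus star_add star_minus del: add_uminus_conv_diff)

lemma star_scaleR: "star (r *\<^sub>R x) = r *\<^sub>R star (x::'a::unital_cstar_algebra)"
  by (simp add: scaleR_scaleC star_scaleC)

lemma star_sum: "star (\<Sum>i\<in>I. f i) = (\<Sum>i\<in>I. star (f i :: 'a::unital_cstar_algebra))"
  by (induction I rule: infinite_finite_induct) (auto simp: star_add)

lemma star_power: "star (x ^ n) = star (x::'a::unital_cstar_algebra) ^ n"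
  by (induction n) (auto simp: star_mult power_commutes)

lemma bounded_linear_star: "bounded_linear (star :: 'a::unital_cstar_algebra \<Rightarrow> 'a)"
  by (rule bounded_linear_intro[where K=1]) (auto simp: star_add star_scaleR norm_star)

section \<open>The power series of the square root\<close>

text \<open>The recursion is \<open>g\<^sup>2 = 2 g - x\<close>, read off coefficientwise, for \<open>g = 1 - sqrt (1 - x)\<close>.\<close>

fun sqrt_coeff :: "nat \<Rightarrow> real" where
  "sqrt_coeff n = (if n = 0 then 0 else if n = 1 then 1/2
     else (\<Sum>i\<in>{1..<n}. sqrt_coeff i * sqrt_coeff (n - i)) / 2)"

declare sqrt_coeff.simps [simp del]

lemma sqrt_coeff_0 [simp]: "sqrt_coeff 0 = 0"
  by (simp add: sqrt_coeff.simps)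

lemma sqrt_coeff_1: "sqrt_coeff (Suc 0) = 1/2"
  by (simp add: sqrt_coeff.simps)

lemma sqrt_coeff_nonneg: "sqrt_coeff n \<ge> 0"
proof (induction n rule: less_induct)
  case (less n)
  then show ?case
    by (subst sqrt_coeff.simps) (auto intro!: sum_nonneg mult_nonneg_nonneg)
qed

text \<open>The end terms i = 0 and i = n drop out because \<open>sqrt_coeff 0\<close> is 0, so the
  recursion over the inner indices already gives the whole Cauchy product. The correction at n = 1
  is the term x of the functional equation.\<close>

lemma sqrt_coeff_convolution:
  "(\<Sum>i\<le>n. sqrt_coeff i * sqrt_coeff (n - i)) = 2 * sqrt_coeff n - (if n = 1 then 1 else 0)"
proof -
  consider "n = 0" | "n = 1" | "n \<ge> 2" by linarith
  then show ?thesis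
  proof cases
    case 3
    have "(\<Sum>i\<le>n. sqrt_coeff i * sqrt_coeff (n - i)) = (\<Sum>i\<in>{1..<n}. sqrt_coeff i * sqrt_coeff (n - i))"
      proof (rule sum.mono_neutral_right)
      have "i = 0 \<or> i = n" if "i \<in> {..n} - {1..<n}" for i
        using that by auto
      then show "\<forall>i\<in>{..n} - {1..<n}. sqrt_coeff i * sqrt_coeff (n - i) = 0"
        by fastforce
    qed auto
    also have "\<dots> = 2 * sqrt_coeff n"
      using 3 by (subst (3) sqrt_coeff.simps) simp
    finally show ?thesis using 3 by simp
  qed (auto simp: sqrt_coeff_1)
qed

text \<open>Induction on the partial sums s_n. Adding up the convolution identity gives 2 s_(n+1) -
  1 as a sum over the triangle i + j \<le> n + 1. There the index n + 1 meets only the index 0,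
  whose coefficient vanishes, so the sum is at most s_n^2 \<le> 1.\<close>

lemma sum_sqrt_coeff_le: "(\<Sum>i\<le>n. sqrt_coeff i) \<le> 1"
proof (induction n)
  case (Suc n)
  let ?s = "\<lambda>n. \<Sum>i\<le>n. sqrt_coeff i"
  have "(\<Sum>k\<le>Suc n. \<Sum>i\<le>k. sqrt_coeff i * sqrt_coeff (k - i)) = 2 * ?s (Suc n) - 1"
    by (simp only: sqrt_coeff_convolution sum_subtractf sum_distrib_left[symmetric]) simp
  moreover have "(\<Sum>k\<le>Suc n. \<Sum>i\<le>k. sqrt_coeff i * sqrt_coeff (k - i)) \<le> ?s n * ?s n"
  proof -
    have "(\<Sum>k\<le>Suc n. \<Sum>i\<le>k. sqrt_coeff i * sqrt_coeff (k - i))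
        = (\<Sum>(i, j)\<in>{(i, j). i + j \<le> Suc n}. sqrt_coeff i * sqrt_coeff j)"
      using sum.triangle_reindex_eq[of "\<lambda>i j. sqrt_coeff i * sqrt_coeff j" "Suc n"] by simp
    also have "\<dots> = (\<Sum>(i, j)\<in>{(i, j). i + j \<le> Suc n} \<inter> {..n} \<times> {..n}. sqrt_coeff i * sqrt_coeff j)"
    proof (rule sum.mono_neutral_right)
      have "{(i, j). i + j \<le> Suc n} \<subseteq> {..Suc n} \<times> {..Suc n}" by auto
      then show "finite {(i, j). i + j \<le> Suc n}" by (rule finite_subset) simp
      have "i = 0 \<or> j = 0" if "i + j \<le> Suc n" "\<not> (i \<le> n \<and> j \<le> n)" for i j
        using that by linarith
      then show "\<forall>p\<in>{(i, j). i + j \<le> Suc n} - {(i, j). i + j \<le> Suc n} \<inter> {..n} \<times> {..n}.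
          (case p of (i, j) \<Rightarrow> sqrt_coeff i * sqrt_coeff j) = 0"
        by (clarsimp, metis mult_eq_0_iff sqrt_coeff_0)
    qed auto
    also have "\<dots> \<le> (\<Sum>(i, j)\<in>{..n} \<times> {..n}. sqrt_coeff i * sqrt_coeff j)"
      by (rule sum_mono2) (auto simp: sqrt_coeff_nonneg)
    also have "\<dots> = ?s n * ?s n"
      by (simp add: sum_product sum.cartesian_product)
    finally show ?thesis .
  qed
  moreover have "?s n * ?s n \<le> 1"
    using Suc by (intro mult_le_one sum_nonneg sqrt_coeff_nonneg)
  ultimately show ?case by linarith
qed simp

lemma summable_sqrt_coeff: "summable sqrt_coeff" and suminf_sqrt_coeff_le: "suminf sqrt_coeff \<le> 1"
proof -
  have le: "sum sqrt_coeff {..<n} \<le> 1" for n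
    using sum_sqrt_coeff_le[of n] sqrt_coeff_nonneg[of n] by (simp add: lessThan_Suc_atMost[symmetric])
  show s: "summable sqrt_coeff"
    by (rule summableI_nonneg_bounded[where x=1]) (use le sqrt_coeff_nonneg in auto)
  show "suminf sqrt_coeff \<le> 1"
    by (rule suminf_le_const[OF s le])
qed

text \<open>The power series of \<open>1 - sqrt (1 - x)\<close>; it converges absolutely on the closed unit ball and has no
  constant term, so it makes sense in non-unital closed subalgebras.\<close>

definition sqrt_series :: "'a::unital_cstar_algebra \<Rightarrow> 'a"
  where "sqrt_series m = (\<Sum>n. sqrt_coeff n *\<^sub>R m ^ n)"

context
  fixes m :: "'a::unital_cstar_algebra"
  assumes m: "norm m \<le> 1"
begin

lemma norm_sqrt_series_term: "norm (sqrt_coeff n *\<^sub>R m ^ n) \<le> sqrt_coeff n"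
proof (cases n)
  case (Suc k)
  have "norm (m ^ Suc k) \<le> 1"
  proof (induction k)
    case (Suc k)
    have "norm (m ^ Suc (Suc k)) \<le> norm m * norm (m ^ Suc k)"
      using norm_mult_ineq[of m "m ^ Suc k"] by simp
    also have "\<dots> \<le> 1" using m Suc by (intro mult_le_one) auto
    finally show ?case .
  qed (use m in simp)
  then show ?thesis
    using sqrt_coeff_nonneg[of n] Suc by (simp add: mult_left_le)
qed simp

lemma summable_norm_sqrt_series: "summable (\<lambda>n. norm (sqrt_coeff n *\<^sub>R m ^ n))"
  by (rule summable_comparison_test[OF _ summable_sqrt_coeff]) (use norm_sqrt_series_term in auto)

lemma sqrt_series_sums: "(\<lambda>n. sqrt_coeff n *\<^sub>R m ^ n) sums sqrt_series m"
  unfolding sqrt_series_def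
  by (rule summable_sums[OF summable_norm_cancel[OF summable_norm_sqrt_series]])

text \<open>The value lies in the unit ball again, so the series can be iterated; this later
  provides fourth roots.\<close>

lemma norm_sqrt_series: "norm (sqrt_series m) \<le> 1"
proof -
  have "norm (sqrt_series m) \<le> (\<Sum>n. norm (sqrt_coeff n *\<^sub>R m ^ n))"
    unfolding sqrt_series_def by (rule summable_norm[OF summable_norm_sqrt_series])
  also have "\<dots> \<le> suminf sqrt_coeff"
    by (rule suminf_le[OF norm_sqrt_series_term summable_norm_sqrt_series summable_sqrt_coeff])
  finally show ?thesis using suminf_sqrt_coeff_le by simp
qed

lemma sqrt_series_square: "sqrt_series m * sqrt_series m = 2 *\<^sub>R sqrt_series m - m"
proof (rule sums_unique2)
  have "(\<lambda>k. \<Sum>i\<le>k. (sqrt_coeff i *\<^sub>R m ^ i) * (sqrt_coeff (k - i) *\<^sub>R m ^ (k - i))) sums (sqrt_series m * sqrt_series m)"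
    unfolding sqrt_series_def by (intro Cauchy_product_sums summable_norm_sqrt_series)
  moreover have "(\<Sum>i\<le>k. (sqrt_coeff i *\<^sub>R m ^ i) * (sqrt_coeff (k - i) *\<^sub>R m ^ (k - i)))
      = 2 *\<^sub>R (sqrt_coeff k *\<^sub>R m ^ k) - (if k = 1 then m else 0)" for k
  proof -
    have "(\<Sum>i\<le>k. (sqrt_coeff i *\<^sub>R m ^ i) * (sqrt_coeff (k - i) *\<^sub>R m ^ (k - i)))
        = (\<Sum>i\<le>k. (sqrt_coeff i * sqrt_coeff (k - i)) *\<^sub>R m ^ k)"
      by (intro sum.cong refl) (auto simp: power_add[symmetric] mult.commute)
    then show ?thesis
      by (auto simp: scaleR_sum_left[symmetric] sqrt_coeff_convolution scaleR_diff_left)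
  qed
  ultimately show "(\<lambda>k. 2 *\<^sub>R (sqrt_coeff k *\<^sub>R m ^ k) - (if k = 1 then m else 0)) sums (sqrt_series m * sqrt_series m)"
    by simp
  show "(\<lambda>k. 2 *\<^sub>R (sqrt_coeff k *\<^sub>R m ^ k) - (if k = 1 then m else 0)) sums (2 *\<^sub>R sqrt_series m - m)"
    by (intro sums_diff sums_scaleR_right sqrt_series_sums) (use sums_single[of 1 "\<lambda>_. m"] in simp)
qed

lemma one_minus_sqrt_series_square: "(1 - sqrt_series m) * (1 - sqrt_series m) = 1 - m"
  by (simp add: algebra_simps sqrt_series_square scaleR_2)

lemma sqrt_series_in_closed:
  assumes "closed S" "0 \<in> S" "m \<in> S" "\<And>x y. x \<in> S \<Longrightarrow> y \<in> S \<Longrightarrow> x + y \<in> S"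
    "\<And>x y. x \<in> S \<Longrightarrow> y \<in> S \<Longrightarrow> x * y \<in> S" "\<And>c x. x \<in> S \<Longrightarrow> c *\<^sub>C x \<in> S"
  shows "sqrt_series m \<in> S"
proof -
  \<comment> \<open>Only positive powers, since 1 need not lie in \<open>S\<close>; the term of
    order 0 has coefficient 0.\<close>
  have pow: "m ^ Suc n \<in> S" for n
    by (induction n) (use assms in auto)
  have "sqrt_coeff n *\<^sub>R m ^ n \<in> S" for n
    by (cases n) (use pow assms in \<open>auto simp: scaleR_scaleC simp del: power_Suc\<close>)
  then have "(\<Sum>i<n. sqrt_coeff i *\<^sub>R m ^ i) \<in> S" for n
    by (induction n) (use assms in auto)
  then show ?thesis
    using sqrt_series_sums \<open>closed S\<close> unfolding sums_def by (metis closed_sequentially)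
qed

text \<open>The commutant of \<open>x\<close> is closed under limits, sums, products and multiples,
  so it can serve as the set \<open>S\<close> of \<open>sqrt_series_in_closed\<close>.\<close>

lemma sqrt_series_commute:
  assumes "m * x = x * m"
  shows "sqrt_series m * x = x * sqrt_series m"
proof -
  have "closed {y. y * x = x * y}"
    by (intro closed_Collect_eq continuous_intros)
  then have "sqrt_series m \<in> {y. y * x = x * y}"
    by (rule sqrt_series_in_closed)
      (use assms in \<open>auto simp: algebra_simps mult_scaleC_left mult_scaleC_right, metis mult.assoc\<close>)
  then show ?thesis by simp
qed

lemma star_sqrt_series:
  assumes "star m = m"
  shows "star (sqrt_series m) = sqrt_series m"
proof (rule sums_unique2)
  show "(\<lambda>n. star (sqrt_coeff n *\<^sub>R m ^ n)) sums star (sqrt_series m)"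
    by (rule bounded_linear.sums[OF bounded_linear_star sqrt_series_sums])
  show "(\<lambda>n. star (sqrt_coeff n *\<^sub>R m ^ n)) sums sqrt_series m"
    using sqrt_series_sums assms by (simp add: star_scaleR star_power)
qed

end

text \<open>If \<open>a\<close> and \<open>q\<close> are commuting and selfadjoint with \<open>a\<^sup>2 + q\<^sup>2 = r\<^sup>2\<close>, then \<open>a + i q\<close> is \<open>r\<close> times a unitary.\<close>

lemma norm_le_of_square_sum:
  fixes a q :: "'a::unital_cstar_algebra"
  assumes "star a = a" "star q = q" "a * q = q * a" "a * a + q * q = (r\<^sup>2) *\<^sub>R 1" "r \<ge> 0"
  shows "norm a \<le> r"
proof -
  define U where "U = a + \<i> *\<^sub>C q"
  have sU: "star U = a - \<i> *\<^sub>C q"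
    using assms by (simp add: U_def star_add star_scaleC)
  have "star U * U = a * a + q * q + (\<i> *\<^sub>C (a * q) - \<i> *\<^sub>C (q * a))"
    unfolding sU unfolding U_def
    by (simp add: algebra_simps mult_scaleC_left mult_scaleC_right scaleC_scaleC)
  then have "star U * U = (r\<^sup>2) *\<^sub>R 1" using assms by simp
  then have "(norm U)\<^sup>2 = norm ((r\<^sup>2) *\<^sub>R (1::'a))" by (metis cstar_identity)
  also have "\<dots> \<le> r\<^sup>2" using norm_one_le[where 'a='a] by (simp add: mult_left_le)
  finally have "norm U \<le> r" using \<open>r \<ge> 0\<close> by (rule power2_le_imp_le)
  moreover have "a = (1/2) *\<^sub>R (U + star U)"
    unfolding sU unfolding U_def by (simp add: scaleR_add_left[symmetric] scaleR_2[symmetric])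
  then have "norm a = norm (U + star U) / 2"
    by (metis norm_scaleR abs_of_pos half_gt_zero_iff zero_less_one mult.commute times_divide_eq_right mult.right_neutral)
  then have "norm a \<le> (norm U + norm (star U)) / 2"
    using norm_triangle_ineq[of U "star U"] by simp
  ultimately show ?thesis by (simp add: norm_star)
qed

text \<open>With c the square root of 1 - y^2, the commuting elements satisfy c^2 + y^2 = 1, so norm
  c \<le> 1 and 1 - y^2 = c^2 is in the unit ball. This brings 1 - y^2 into the domain of the
  series, so that a square root of y^2, the absolute value of y, can be formed.\<close>

lemma norm_one_minus_square:
  fixes y :: "'a::unital_cstar_algebra"
  assumes "star y = y" "norm y \<le> 1"
  shows "norm (1 - y * y) \<le> 1"
proof -
  have yy: "norm (y * y) \<le> 1"
    using norm_mult_ineq[of y y] assms(2) by (smt (verit) mult_le_one norm_ge_zero)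
  define c where "c = 1 - sqrt_series (y * y)"
  have cc: "c * c = 1 - y * y"
    unfolding c_def by (rule one_minus_sqrt_series_square[OF yy])
  have sc: "star c = c"
    unfolding c_def using star_sqrt_series[OF yy] assms by (simp add: star_diff star_mult)
  have "sqrt_series (y * y) * y = y * sqrt_series (y * y)"
    by (rule sqrt_series_commute[OF yy]) (simp add: mult.assoc)
  then have "c * y = y * c" by (simp add: c_def algebra_simps)
  then have "norm c \<le> 1"
    by (intro norm_le_of_square_sum[of c y 1]) (use assms sc cc in auto)
  then show ?thesis
    using norm_mult_ineq[of c c] cc by (smt (verit) mult_le_one norm_ge_zero)
qed

section \<open>Extensions by continuity and *-homomorphisms\<close>

lemma clinear_onI:
  assumes "\<And>x y. x \<in> V \<Longrightarrow> y \<in> V \<Longrightarrow> f (x + y) = f x + f y"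
    and "\<And>c x. x \<in> V \<Longrightarrow> f (c *\<^sub>C x) = c *\<^sub>C f x"
  shows "clinear_on V f"
  using assms by (auto simp: clinear_on_def)

lemma clinear_on_add: "clinear_on V f \<Longrightarrow> x \<in> V \<Longrightarrow> y \<in> V \<Longrightarrow> f (x + y) = f x + f y"
  and clinear_on_scaleC: "clinear_on V f \<Longrightarrow> x \<in> V \<Longrightarrow> f (c *\<^sub>C x) = c *\<^sub>C f x"
  by (auto simp: clinear_on_def)

lemma clinear_on_subset: "clinear_on V f \<Longrightarrow> U \<subseteq> V \<Longrightarrow> clinear_on U f"
  unfolding clinear_on_def by blast

lemma clinear_on_compose:
  "clinear_on V f \<Longrightarrow> clinear_on U f' \<Longrightarrow> f ` V \<subseteq> U \<Longrightarrow> clinear_on V (\<lambda>x. f' (f x))"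
  by (simp add: clinear_on_def image_subset_iff)

lemma clinear_on_diff:
  assumes "clinear_on V f" "cvec.subspace V" "x \<in> V" "y \<in> V"
  shows "f (x - y) = f x - f y"
proof -
  have "f (x + (-1) *\<^sub>C y) = f x + (-1) *\<^sub>C f y"
    using assms by (simp only: clinear_on_add clinear_on_scaleC cvec.subspace_scale)
  then show ?thesis by simp
qed

lemma clinear_on_zero:
  assumes "clinear_on V f" "cvec.subspace V"
  shows "f 0 = 0"
  using clinear_on_diff[OF assms, of 0 0] cvec.subspace_0[OF assms(2)] by simp

lemma clinear_on_sum:
  assumes "clinear_on V f" "cvec.subspace V" "\<And>i. i \<in> I \<Longrightarrow> x i \<in> V"
  shows "f (\<Sum>i\<in>I. x i) = (\<Sum>i\<in>I. f (x i))"
  using assms(3)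
proof (induction I rule: infinite_finite_induct)
  case (insert i I)
  then show ?case
    using assms by (simp add: clinear_on_add cvec.subspace_sum)
qed (use assms in \<open>auto simp: clinear_on_zero\<close>)

lemma subspace_closure_cspan: "cvec.subspace (closure (cspan G :: 'a::complex_normed_vector set))"
proof (rule cvec.subspaceI)
  show "0 \<in> closure (cspan G)"
    using closure_subset cvec.span_zero by blast
next
  fix x y assume "x \<in> closure (cspan G)" "y \<in> closure (cspan G)"
  then obtain f g where "\<forall>n. f n \<in> cspan G" "f \<longlonglongrightarrow> x" "\<forall>n. g n \<in> cspan G" "g \<longlonglongrightarrow> y"
    unfolding closure_sequential by blast
  then have "\<forall>n. f n + g n \<in> cspan G" "(\<lambda>n. f n + g n) \<longlonglongrightarrow> x + y"
    by (auto intro: cvec.span_add tendsto_add)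
  then show "x + y \<in> closure (cspan G)"
    unfolding closure_sequential by (intro exI[of _ "\<lambda>n. f n + g n"]) blast
next
  fix c x assume "x \<in> closure (cspan G)"
  then obtain f where "\<forall>n. f n \<in> cspan G" "f \<longlonglongrightarrow> x"
    unfolding closure_sequential by blast
  then have "\<forall>n. c *\<^sub>C f n \<in> cspan G" "(\<lambda>n. c *\<^sub>C f n) \<longlonglongrightarrow> c *\<^sub>C x"
    by (auto intro: cvec.span_scale bounded_linear.tendsto[OF bounded_linear_scaleC])
  then show "c *\<^sub>C x \<in> closure (cspan G)"
    unfolding closure_sequential by (intro exI[of _ "\<lambda>n. c *\<^sub>C f n"]) blast
qed

lemma closure_cspan_base: "x \<in> G \<Longrightarrow> x \<in> closure (cspan G :: 'a::complex_normed_vector set)"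
  using closure_subset cvec.span_base by blast

lemma closure_cspan_mono: "F \<subseteq> G \<Longrightarrow> closure (cspan F) \<subseteq> closure (cspan G :: 'a::complex_normed_vector set)"
  by (intro closure_mono cvec.span_mono)

lemma closure_cspan_minimal:
  fixes G :: "'a::complex_normed_vector set"
  assumes "G \<subseteq> V" "cvec.subspace V" "closed V"
  shows "closure (cspan G) \<subseteq> V"
  using assms by (intro closure_minimal cvec.span_minimal)

lemma clinear_on_closure_image:
  fixes f :: "'a::complex_normed_vector \<Rightarrow> 'b::complex_normed_vector"
  assumes "clinear_on (closure (cspan G)) f" "continuous_on (closure (cspan G)) f"
    and "f ` G \<subseteq> W" "cvec.subspace W" "closed W"
  shows "f ` closure (cspan G) \<subseteq> W"
proof -
  let ?V = "closure (cspan G)" and ?U = "closure (cspan G) \<inter> f -` W"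
  have "?V \<subseteq> ?U"
  proof (rule closure_cspan_minimal)
    show "closed ?U"
      using assms by (intro continuous_closed_preimage) auto
    show "G \<subseteq> ?U" using assms closure_cspan_base by auto
    show "cvec.subspace ?U"
      using assms subspace_closure_cspan[of G] clinear_on_zero[OF assms(1)]
      unfolding cvec.subspace_def by (auto simp: clinear_on_add clinear_on_scaleC)
  qed
  then show ?thesis by auto
qed

text \<open>Both maps are the continuous extension of the family \<open>f\<close> indexed by
  \<open>G\<close> itself, so the uniqueness of \<open>cont_ext\<close> identifies them.\<close>

lemma clinear_on_closure_eq:
  fixes f f' :: "'a::complex_normed_vector \<Rightarrow> 'b::complex_normed_vector"
  assumes f: "clinear_on (closure (cspan G)) f" "continuous_on (closure (cspan G)) f"
    and f': "clinear_on (closure (cspan G)) f'" "continuous_on (closure (cspan G)) f'"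
    and eq: "\<And>x. x \<in> G \<Longrightarrow> f x = f' x" and t: "t \<in> closure (cspan G)"
  shows "f t = f' t"
  using cont_ext_eqI[of id G f f t] cont_ext_eqI[of id G f' f t] assms by simp

lemma continuous_on_bop_apply [continuous_intros]:
  "continuous_on V f \<Longrightarrow> continuous_on V (\<lambda>x. T \<cdot> f x)"
  using bounded_linear_bop_apply bounded_linear.continuous_on by blast

lemma bounded_linear_bop_eval: "bounded_linear (\<lambda>T. T \<cdot> x)"
  by (rule bounded_linear_intro[where K="norm x"]) (auto simp: bop_add_apply bop_scaleR_apply norm_bop_apply)

lemma clinear_on_bop_apply: "clinear_on V (bop_apply T)"
  by (intro clinear_onI bop_apply_add bop_apply_scaleC)

lemma bop_zero_right [simp]: "T \<cdot> 0 = 0"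
  using bop_apply_diff[of T 0 0] by simp

lemma bop_zero_left [simp]: "0 \<cdot> x = 0"
  using bop_diff_apply[of 0 0 x] by simp

lemma bop_apply_sum: "T \<cdot> (\<Sum>i\<in>I. f i) = (\<Sum>i\<in>I. T \<cdot> f i)"
  by (induction I rule: infinite_finite_induct) (auto simp: bop_apply_add)

lemma bop_sum_apply: "(\<Sum>i\<in>I. f i) \<cdot> x = (\<Sum>i\<in>I. f i \<cdot> x)"
  by (induction I rule: infinite_finite_induct) (auto simp: bop_add_apply)

lemma bop_eq_on_dense:
  assumes "closure (cspan G) = UNIV" "\<And>x. x \<in> G \<Longrightarrow> S \<cdot> x = T \<cdot> x"
  shows "S = T"
proof (rule bop_eqI)
  fix x
  show "S \<cdot> x = T \<cdot> x"
    by (rule clinear_on_closure_eq[where G=G])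
      (use assms in \<open>auto intro: clinear_on_bop_apply continuous_on_bop_apply continuous_on_id\<close>)
qed

text \<open>The existence statement that complements \<open>cont_ext_eqI\<close>. The bound forces
  every linear relation among the \<open>g i\<close> to hold among the \<open>g' i\<close>, which
  gives a linear map on the span; the same bound makes it Lipschitz, so it extends to the
  closure.\<close>

lemma cont_ext_bounded:
  fixes g :: "'i \<Rightarrow> 'p::complex_normed_vector" and g' :: "'i \<Rightarrow> 'q::{complex_normed_vector, complete_space}"
  assumes bound: "\<And>J k. finite J \<Longrightarrow> J \<subseteq> I \<Longrightarrow> norm (\<Sum>i\<in>J. k i *\<^sub>C g' i) \<le> C * norm (\<Sum>i\<in>J. k i *\<^sub>C g i)"
  shows clinear_on_cont_ext: "clinear_on (closure (cspan (g ` I))) (cont_ext I g g')"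
    and continuous_on_cont_ext: "continuous_on (closure (cspan (g ` I))) (cont_ext I g g')"
    and cont_ext_apply: "\<And>i. i \<in> I \<Longrightarrow> cont_ext I g g' (g i) = g' i"
    and norm_cont_ext: "\<And>t. t \<in> closure (cspan (g ` I)) \<Longrightarrow> norm (cont_ext I g g' t) \<le> C * norm t"
proof -
  let ?V = "cspan (g ` I)"
  interpret vector_space_pair "scaleC :: complex \<Rightarrow> 'p \<Rightarrow> 'p" "scaleC :: complex \<Rightarrow> 'q \<Rightarrow> 'q" ..
  obtain B where B: "B \<subseteq> g ` I" "cvec.independent B" "g ` I \<subseteq> cspan B"
    using cvec.maximal_independent_subset .
  define s where "s b = (SOME i. i \<in> I \<and> g i = b)" for b
  have s: "s b \<in> I" "g (s b) = b" if "b \<in> g ` I" for b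
  proof -
    have "\<exists>i. i \<in> I \<and> g i = b" using that by blast
    from someI_ex[OF this] show "s b \<in> I" "g (s b) = b" by (auto simp: s_def)
  qed
  have reindex: "(\<Sum>i\<in>s ` t. f i) = (\<Sum>b\<in>t. f (s b))" if "t \<subseteq> g ` I" for t and f :: "'i \<Rightarrow> 'z::comm_monoid_add"
  proof -
    have "inj_on s t" using s that by (metis inj_onI subsetD)
    then show ?thesis by (simp add: sum.reindex)
  qed
  define L where "L = construct B (\<lambda>b. g' (s b))"
  have L: "L (x + y) = L x + L y" "L (c *\<^sub>C x) = c *\<^sub>C L x" for c x y
    using linear_construct[OF B(2)] unfolding L_def by (auto simp: linear_add linear_scale)
  have Lsum: "L (sum f t) = (\<Sum>b\<in>t. L (f b))" for f and t :: "'p set"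
    using linear_construct[OF B(2)] unfolding L_def by (rule linear_sum)
  have LB: "L b = g' (s b)" if "b \<in> B" for b
    unfolding L_def using B(2) that by (rule construct_basis)
  have Lg: "L (g i) = g' i" if "i \<in> I" for i
  proof -
    have "g i \<in> cspan B" using that B by blast
    then obtain t r where t: "finite t" "t \<subseteq> B" "g i = (\<Sum>b\<in>t. r b *\<^sub>C b)"
      unfolding cvec.span_explicit by blast
    have tI: "t \<subseteq> g ` I" using t B by blast
    define J where "J = insert i (s ` t)"
    have J: "finite J" "J \<subseteq> I" using t tI s \<open>i \<in> I\<close> by (auto simp: J_def)
    \<comment> \<open>Coefficients of the relation that expresses \<open>g i\<close> through basis
      vectors. The two parts are subtracted rather than separated by cases because \<open>i\<close>
      may itself be one of the chosen indices \<open>s b\<close>.\<close>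
    define k where "k j = (if j \<in> s ` t then r (g j) else 0) - (if j = i then 1 else 0 :: complex)" for j
    have sumk: "(\<Sum>j\<in>J. k j *\<^sub>C f j) = (\<Sum>b\<in>t. r b *\<^sub>C f (s b)) - f i" for f :: "'i \<Rightarrow> 'z::complex_vector"
    proof -
      have "(\<Sum>j\<in>J. k j *\<^sub>C f j) = (\<Sum>j\<in>J. (if j \<in> s ` t then r (g j) *\<^sub>C f j else 0)) - (\<Sum>j\<in>J. if j = i then f j else 0)"
        unfolding sum_subtractf[symmetric]
        by (rule sum.cong) (auto simp: k_def cvec.scale_left_diff_distrib scaleC_minus_one)
      also have "(\<Sum>j\<in>J. (if j \<in> s ` t then r (g j) *\<^sub>C f j else 0)) = (\<Sum>j\<in>s ` t. r (g j) *\<^sub>C f j)"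
        using J by (subst sum.inter_restrict[symmetric]) (auto simp: J_def intro!: sum.cong)
      also have "\<dots> = (\<Sum>b\<in>t. r b *\<^sub>C f (s b))"
        unfolding reindex[OF tI] using tI s by (intro sum.cong) auto
      also have "(\<Sum>j\<in>J. if j = i then f j else 0) = f i"
        using J by (simp add: J_def)
      finally show ?thesis .
    qed
    have "(\<Sum>j\<in>J. k j *\<^sub>C g j) = (\<Sum>b\<in>t. r b *\<^sub>C b) - g i"
      unfolding sumk using tI s by (intro arg_cong2[where f=minus] sum.cong) auto
    then have "(\<Sum>j\<in>J. k j *\<^sub>C g' j) = 0"
      using bound[OF J, of k] t(3) by simp
    then have "g' i = (\<Sum>b\<in>t. r b *\<^sub>C g' (s b))"
      unfolding sumk by simp
    also have "\<dots> = L (g i)"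
      unfolding t(3) Lsum using t(2) LB by (intro sum.cong) (auto simp: L)
    finally show ?thesis by simp
  qed
  have Lbound: "norm (L v) \<le> C * norm v" if "v \<in> ?V" for v
  proof -
    have "\<exists>t r. v = (\<Sum>b\<in>t. r b *\<^sub>C b) \<and> finite t \<and> t \<subseteq> g ` I"
      using that unfolding cvec.span_explicit by (rule CollectD)
    then obtain t r where t: "finite t" "t \<subseteq> g ` I" "v = (\<Sum>b\<in>t. r b *\<^sub>C b)"
      by (elim exE conjE)
    have v: "v = (\<Sum>j\<in>s ` t. r (g j) *\<^sub>C g j)"
      unfolding reindex[OF t(2)] t(3) using t(2) s by (intro sum.cong) auto
    have "L v = (\<Sum>b\<in>t. L (r b *\<^sub>C b))"
      unfolding t(3) by (rule Lsum)
    also have "\<dots> = (\<Sum>b\<in>t. r b *\<^sub>C g' (s b))"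
    proof (rule sum.cong[OF refl])
      fix b assume "b \<in> t"
      then show "L (r b *\<^sub>C b) = r b *\<^sub>C g' (s b)"
        using t(2) s[of b] Lg[of "s b"] by (auto simp: L)
    qed
    also have "\<dots> = (\<Sum>j\<in>s ` t. r (g j) *\<^sub>C g' j)"
      unfolding reindex[OF t(2)] using t(2) s by (intro sum.cong) auto
    finally show ?thesis
      unfolding v using bound[of "s ` t" "\<lambda>j. r (g j)"] t s by auto
  qed
  \<comment> \<open>A Lipschitz constant has to be nonnegative, hence the absolute value of
    \<open>C\<close>.\<close>
  have "dist (L x) (L y) \<le> \<bar>C\<bar> * dist x y" if "x \<in> ?V" "y \<in> ?V" for x y
  proof -
    have "norm (L (x - y)) \<le> C * norm (x - y)"
      using that by (intro Lbound cvec.span_diff)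
    moreover have "L (x - y) = L x - L y"
      using L(1)[of "x - y" y] by simp
    ultimately show ?thesis
      by (metis abs_ge_self dist_norm mult_right_mono norm_ge_zero order_trans)
  qed
  then have "\<bar>C\<bar>-lipschitz_on ?V L" by (intro lipschitz_onI) auto
  then have "uniformly_continuous_on ?V L"
    by (rule lipschitz_on_uniformly_continuous)
  then obtain W where "uniformly_continuous_on (closure ?V) W" and WL: "\<And>x. x \<in> ?V \<Longrightarrow> L x = W x"
    by (rule uniformly_continuous_on_extension_on_closure) blast
  then have cW: "continuous_on (closure ?V) W" by (intro uniformly_continuous_imp_continuous)
  have lim: "(\<lambda>n. L (f n)) \<longlonglongrightarrow> W x" if "\<forall>n. f n \<in> ?V" "f \<longlonglongrightarrow> x" for f x
  proof -
    have "x \<in> closure ?V" using that closure_sequential by blast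
    moreover have "f n \<in> closure ?V" for n using that closure_subset by blast
    ultimately have "(\<lambda>n. W (f n)) \<longlonglongrightarrow> W x"
      by (intro continuous_on_tendsto_compose[OF cW that(2)]) auto
    then show ?thesis using that WL by simp
  qed
  have lW: "clinear_on (closure ?V) W"
  proof (rule clinear_onI)
    fix x y assume "x \<in> closure ?V" "y \<in> closure ?V"
    then obtain f f' where f: "\<forall>n. f n \<in> ?V" "f \<longlonglongrightarrow> x" and f': "\<forall>n. f' n \<in> ?V" "f' \<longlonglongrightarrow> y"
      unfolding closure_sequential by blast
    have "(\<lambda>n. L (f n + f' n)) \<longlonglongrightarrow> W (x + y)"
      using f f' by (intro lim tendsto_add) (auto intro: cvec.span_add)
    moreover have "(\<lambda>n. L (f n + f' n)) \<longlonglongrightarrow> W x + W y"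
      unfolding L by (intro tendsto_add lim f f')
    ultimately show "W (x + y) = W x + W y" by (rule LIMSEQ_unique)
  next
    fix c x assume "x \<in> closure ?V"
    then obtain f where f: "\<forall>n. f n \<in> ?V" "f \<longlonglongrightarrow> x"
      unfolding closure_sequential by blast
    have "(\<lambda>n. L (c *\<^sub>C f n)) \<longlonglongrightarrow> W (c *\<^sub>C x)"
      using f by (intro lim bounded_linear.tendsto[OF bounded_linear_scaleC]) (auto intro: cvec.span_scale)
    moreover have "(\<lambda>n. L (c *\<^sub>C f n)) \<longlonglongrightarrow> c *\<^sub>C W x"
      unfolding L by (intro bounded_linear.tendsto[OF bounded_linear_scaleC] lim f)
    ultimately show "W (c *\<^sub>C x) = c *\<^sub>C W x" by (rule LIMSEQ_unique)
  qed
  have Wg: "\<forall>i\<in>I. W (g i) = g' i"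
    using Lg WL by (metis cvec.span_base image_eqI)
  have ex: "clinear_on (closure ?V) (cont_ext I g g') \<and> continuous_on (closure ?V) (cont_ext I g g')
      \<and> (\<forall>i\<in>I. cont_ext I g g' (g i) = g' i)"
    unfolding cont_ext_def by (rule someI[of _ W]) (use lW cW Wg in auto)
  then show "clinear_on (closure ?V) (cont_ext I g g')" "continuous_on (closure ?V) (cont_ext I g g')"
    "\<And>i. i \<in> I \<Longrightarrow> cont_ext I g g' (g i) = g' i" by auto
  fix t assume t: "t \<in> closure ?V"
  then obtain f where f: "\<forall>n. f n \<in> ?V" "f \<longlonglongrightarrow> t"
    unfolding closure_sequential by blast
  have "norm (W t) \<le> C * norm t"
  proof (rule LIMSEQ_le)
    show "(\<lambda>n. norm (L (f n))) \<longlonglongrightarrow> norm (W t)" by (intro tendsto_norm lim f)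
    show "(\<lambda>n. C * norm (f n)) \<longlonglongrightarrow> C * norm t" by (intro tendsto_intros f)
    show "\<exists>N. \<forall>n\<ge>N. norm (L (f n)) \<le> C * norm (f n)" using Lbound f by blast
  qed
  moreover have "cont_ext I g g' t = W t"
    by (rule cont_ext_eqI) (use lW cW Wg t in auto)
  ultimately show "norm (cont_ext I g g' t) \<le> C * norm t" by simp
qed

section \<open>Contractivity and isometry of *-homomorphisms\<close>

lemma cinner_star_mult_self: "cinner z ((star V * V) \<cdot> z) = complex_of_real ((norm (V \<cdot> z))\<^sup>2)"
  by (simp add: bop_times_apply cinner_star_right cinner_self)

text \<open>If \<open>m = y\<^sup>* y\<close> has norm at most 1, then \<open>1 - \<Theta> m\<close> is the square of \<open>1 - \<Theta> (sqrt_series m)\<close>.\<close>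

lemma star_hom_contractive:
  fixes S :: "'c::unital_cstar_algebra set" and \<Theta> :: "'c \<Rightarrow> 'l::chilbert_space bop"
  assumes S: "closed S" "cvec.subspace S" "\<And>x y. x \<in> S \<Longrightarrow> y \<in> S \<Longrightarrow> x * y \<in> S" "\<And>x. x \<in> S \<Longrightarrow> star x \<in> S"
    and \<Theta>: "clinear_on S \<Theta>" "\<And>x y. x \<in> S \<Longrightarrow> y \<in> S \<Longrightarrow> \<Theta> (x * y) = \<Theta> x * \<Theta> y"
      "\<And>x. x \<in> S \<Longrightarrow> \<Theta> (star x) = star (\<Theta> x)"
    and x: "x \<in> S"
  shows "norm (\<Theta> x) \<le> norm x"
proof -
  have unit: "norm (\<Theta> y) \<le> 1" if y: "y \<in> S" "norm y \<le> 1" for y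
  proof -
    define m where "m = star y * y"
    define g where "g = sqrt_series m"
    have m: "m \<in> S" "star m = m" using S y by (auto simp: m_def star_mult star_star)
    have nm: "norm m \<le> 1" using y by (simp add: m_def cstar_identity power_le_one)
    have g: "g \<in> S" unfolding g_def
      by (rule sqrt_series_in_closed[OF nm])
        (use S m in \<open>auto intro: cvec.subspace_0 cvec.subspace_add cvec.subspace_scale\<close>)
    have sg: "star g = g" unfolding g_def using nm m by (intro star_sqrt_series)
    \<comment> \<open>Only this algebraic relation is carried over by \<open>\<Theta>\<close>; no
      continuity of \<open>\<Theta>\<close> enters.\<close>
    have "m = 2 *\<^sub>C g - g * g"
      using sqrt_series_square[OF nm] by (simp add: g_def scaleR_scaleC)
    then have "\<Theta> m = 2 *\<^sub>C \<Theta> g - \<Theta> g * \<Theta> g"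
      using g S \<Theta> by (simp add: clinear_on_diff[OF \<Theta>(1)] clinear_on_scaleC[OF \<Theta>(1)] cvec.subspace_scale)
    \<comment> \<open>The unit appears on the operator side only: \<open>S\<close> may have
      none.\<close>
    then have "\<Theta> m = 1 - (1 - \<Theta> g) * (1 - \<Theta> g)"
      by (simp add: algebra_simps scaleR_2[symmetric] scaleR_scaleC)
    moreover have "\<Theta> m = star (\<Theta> y) * \<Theta> y" using S \<Theta> y by (simp add: m_def)
    moreover have "star (1 - \<Theta> g) = 1 - \<Theta> g"
      using \<Theta>(3)[OF g] sg by (simp add: star_diff)
    ultimately have eq: "star (\<Theta> y) * \<Theta> y = 1 - star (1 - \<Theta> g) * (1 - \<Theta> g)" by simp
    have "norm (\<Theta> y \<cdot> z) \<le> 1 * norm z" for z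
    proof -
      have "complex_of_real ((norm (\<Theta> y \<cdot> z))\<^sup>2) = cinner z ((star (\<Theta> y) * \<Theta> y) \<cdot> z)"
        by (rule cinner_star_mult_self[symmetric])
      also have "\<dots> = of_real ((norm z)\<^sup>2 - (norm ((1 - \<Theta> g) \<cdot> z))\<^sup>2)"
        unfolding eq bop_diff_apply[of 1] bop_one_apply cinner_diff_right cinner_star_mult_self
        by (simp add: cinner_self)
      finally have "(norm (\<Theta> y \<cdot> z))\<^sup>2 = (norm z)\<^sup>2 - (norm ((1 - \<Theta> g) \<cdot> z))\<^sup>2"
        using of_real_eq_iff by blast
      then show ?thesis by (auto intro!: power2_le_imp_le[of "norm (\<Theta> y \<cdot> z)"])
    qed
    then show ?thesis by (intro norm_bop_bound) auto
  qed
  show ?thesis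
  proof (cases "x = 0")
    case True
    then show ?thesis using clinear_on_zero[OF \<Theta>(1) S(2)] by simp
  next
    case False
    let ?c = "complex_of_real (1 / norm x)"
    have "norm (\<Theta> (?c *\<^sub>C x)) \<le> 1"
      using False x S by (intro unit) (auto simp: norm_scaleC norm_divide cvec.subspace_scale)
    then show ?thesis
      using False x by (simp add: clinear_on_scaleC[OF \<Theta>(1)] norm_scaleC norm_divide field_simps)
  qed
qed

lemma star_rep_add: "star_rep \<pi> \<Longrightarrow> \<pi> (a + b) = \<pi> a + \<pi> b"
  and star_rep_scaleC: "star_rep \<pi> \<Longrightarrow> \<pi> (c *\<^sub>C a) = c *\<^sub>C \<pi> a"
  and star_rep_mult: "star_rep \<pi> \<Longrightarrow> \<pi> (a * b) = \<pi> a * \<pi> b"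
  and star_rep_star: "star_rep \<pi> \<Longrightarrow> \<pi> (star a) = star (\<pi> a)"
  by (auto simp: star_rep_def clinear_on_def)

lemma star_rep_diff: "star_rep \<pi> \<Longrightarrow> \<pi> (a - b) = \<pi> a - \<pi> b"
  by (rule clinear_on_diff[where V=UNIV]) (auto simp: star_rep_def)

lemma star_rep_zero: "star_rep \<pi> \<Longrightarrow> \<pi> 0 = 0"
  using star_rep_diff[of \<pi> 0 0] by simp

lemma star_rep_sum: "star_rep \<pi> \<Longrightarrow> \<pi> (\<Sum>i\<in>I. f i) = (\<Sum>i\<in>I. \<pi> (f i))"
  by (rule clinear_on_sum[where V=UNIV]) (auto simp: star_rep_def)

lemma star_rep_contractive:
  assumes "star_rep \<pi>"
  shows "norm (\<pi> a) \<le> norm a"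
proof (rule star_hom_contractive[where S=UNIV and \<Theta>=\<pi>])
  show "clinear_on UNIV \<pi>" using assms by (simp only: star_rep_def)
qed (simp_all only: closed_UNIV UNIV_I cvec.subspace_UNIV star_rep_mult[OF assms] star_rep_star[OF assms])

text \<open>For selfadjoint \<open>a\<close> and \<open>r = norm (\<pi> a)\<close>, the element \<open>y = a\<^sup>2 - r\<^sup>2\<close> satisfies \<open>\<pi> \<bar>y\<bar> = - \<pi> y\<close>, so
  by injectivity \<open>r\<^sup>2 - a\<^sup>2 = \<bar>y\<bar>\<close> is a square.\<close>

lemma star_rep_isometric_selfadjoint:
  fixes \<pi> :: "'a::unital_cstar_algebra \<Rightarrow> 'k::chilbert_space bop"
  assumes \<pi>: "star_rep \<pi>" "inj \<pi>" "\<pi> 1 = 1" and a: "star a = a" "norm a \<le> 1/2"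
  shows "norm a \<le> norm (\<pi> a)"
proof -
  define r where "r = norm (\<pi> a)"
  have "r \<le> norm a" unfolding r_def using \<pi>(1) by (rule star_rep_contractive)
  then have r: "0 \<le> r" "r \<le> 1/2" using a by (auto simp: r_def)
  define y where "y = a * a - (r\<^sup>2) *\<^sub>R 1"
  have sy: "star y = y" using a by (simp add: y_def star_diff star_mult star_scaleR)
  \<comment> \<open>The normalisation norm a \<le> 1/2 is made for this bound: both squares are at
    most 1/4.\<close>
  have ny: "norm y \<le> 1"
  proof -
    have "norm y \<le> norm (a * a) + norm ((r\<^sup>2) *\<^sub>R (1::'a))" unfolding y_def by (rule norm_triangle_ineq4)
    also have "\<dots> \<le> (1/2) * (1/2) + r\<^sup>2"
    proof (rule add_mono)
      show "norm (a * a) \<le> (1/2) * (1/2)"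
        by (rule order_trans[OF norm_mult_ineq mult_mono]) (use a in auto)
      show "norm ((r\<^sup>2) *\<^sub>R (1::'a)) \<le> r\<^sup>2"
        using norm_one_le[where 'a='a] by (simp add: mult_left_le)
    qed
    also have "\<dots> \<le> (1/2) * (1/2) + (1/2) * (1/2)"
      unfolding power2_eq_square using r by (intro add_mono mult_mono) auto
    finally show ?thesis by simp
  qed
  define m where "m = 1 - y * y"
  have sm: "star m = m" and nm: "norm m \<le> 1"
    unfolding m_def using sy ny by (auto simp: star_diff star_mult intro: norm_one_minus_square)
  have am: "m * a = a * m"
    unfolding m_def y_def by (simp add: algebra_simps)
  \<comment> \<open>A square root of 1 - m = y^2, that is, the absolute value of
    \<open>y\<close>.\<close>
  define p where "p = 1 - sqrt_series m"
  have pp: "p * p = y * y"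
    using one_minus_sqrt_series_square[OF nm] by (simp add: p_def m_def)
  have sp: "star p = p" unfolding p_def using star_sqrt_series[OF nm sm] by (simp add: star_diff)
  have ng: "norm (sqrt_series m) \<le> 1" using nm by (rule norm_sqrt_series)
  \<comment> \<open>The further root serves twice: it shows that \<open>\<pi> p\<close> is positive,
    being \<open>star (\<pi> q) * \<pi> q\<close>, and in the end its square completes a^2 to
    r^2.\<close>
  define q where "q = 1 - sqrt_series (sqrt_series m)"
  have qq: "q * q = p"
    unfolding q_def p_def by (rule one_minus_sqrt_series_square[OF ng])
  have sq: "star q = q"
    unfolding q_def using star_sqrt_series[OF ng star_sqrt_series[OF nm sm]] by (simp add: star_diff)
  have ga: "sqrt_series m * a = a * sqrt_series m" by (rule sqrt_series_commute[OF nm am])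
  then have gga: "sqrt_series (sqrt_series m) * a = a * sqrt_series (sqrt_series m)"
    by (rule sqrt_series_commute[OF ng])
  have aq: "a * q = q * a" unfolding q_def using gga by (simp add: algebra_simps)
  have pa: "p * a = a * p" unfolding p_def using ga by (simp add: algebra_simps)
  have "p * (a * a) = (a * a) * p" by (metis pa mult.assoc)
  then have py: "p * y = y * p" unfolding y_def by (simp add: algebra_simps)
  define P w where "P = \<pi> p" and "w = - \<pi> y"
  have "\<pi> p * \<pi> y = \<pi> y * \<pi> p" "\<pi> p * \<pi> p = \<pi> y * \<pi> y"
    using py pp \<pi>(1) by (simp_all add: star_rep_mult[symmetric])
  \<comment> \<open>\<open>P\<close> and \<open>w\<close> commute and have equal squares. Moreover
    \<open>w\<close> is positive because r is the norm of \<open>\<pi> a\<close>, so they ought to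
    coincide.\<close>
  then have Pw: "(P + w) * (P - w) = 0" by (simp add: P_def w_def algebra_simps)
  have sPw: "star (P - w) = P - w"
    unfolding P_def w_def using \<pi>(1) sp sy
    by (simp add: star_diff star_add star_minus star_rep_star[symmetric])
  have w_eq: "w = (r\<^sup>2) *\<^sub>R 1 - star (\<pi> a) * \<pi> a"
    unfolding w_def y_def using \<pi> a(1) by (simp add: star_rep_diff star_rep_mult scaleR_scaleC star_rep_scaleC star_rep_star[symmetric])
  have P_eq: "P = star (\<pi> q) * \<pi> q"
    unfolding P_def using \<pi> sq by (simp add: star_rep_star[symmetric] star_rep_mult[symmetric] qq)
  have "P - w = 0"
  proof (rule bop_eqI)
    fix \<zeta>
    \<comment> \<open>On the range of \<open>P - w\<close> the nonnegative forms of \<open>P\<close>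
      and \<open>w\<close> add up to 0. Hence the form of \<open>P\<close> vanishes at
      \<open>z\<close>, which gives \<open>P \<cdot> z = 0\<close> and then
      \<open>(P - w) \<cdot> z = 0\<close>; selfadjointness of \<open>P - w\<close> turns this into
      z = 0.\<close>
    define z where "z = (P - w) \<cdot> \<zeta>"
    have Pwz: "P \<cdot> z + w \<cdot> z = 0"
      using arg_cong[OF Pw, of "\<lambda>T. T \<cdot> \<zeta>"] by (simp add: z_def bop_times_apply bop_add_apply)
    have "Re (cinner z (w \<cdot> z)) = r\<^sup>2 * (norm z)\<^sup>2 - (norm (\<pi> a \<cdot> z))\<^sup>2"
      unfolding w_eq bop_diff_apply bop_scaleR_apply bop_one_apply cinner_diff_right cinner_star_mult_self
      by (simp add: scaleR_scaleC cinner_scaleC_right cinner_self)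
    moreover have "(norm (\<pi> a \<cdot> z))\<^sup>2 \<le> r\<^sup>2 * (norm z)\<^sup>2"
      using norm_bop_apply[of "\<pi> a" z] unfolding r_def power_mult_distrib[symmetric] by (intro power_mono) auto
    ultimately have wz: "Re (cinner z (w \<cdot> z)) \<ge> 0" by simp
    have "Re (cinner z (P \<cdot> z)) = (norm (\<pi> q \<cdot> z))\<^sup>2"
      unfolding P_eq cinner_star_mult_self by simp
    moreover have "Re (cinner z (P \<cdot> z)) + Re (cinner z (w \<cdot> z)) = 0"
      unfolding plus_complex.simps[symmetric] cinner_add_right[symmetric] Pwz by simp
    ultimately have "\<pi> q \<cdot> z = 0" using wz by (smt (verit) norm_eq_zero zero_less_power2)
    then have "P \<cdot> z = 0" by (simp add: P_eq bop_times_apply)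
    then have "(P - w) \<cdot> z = 0" using Pwz by (simp add: bop_diff_apply)
    then have "cinner ((P - w) \<cdot> z) \<zeta> = 0" by simp
    then have "cinner z z = 0"
      unfolding z_def using sPw by (metis cinner_star_left)
    then show "(P - w) \<cdot> \<zeta> = 0 \<cdot> \<zeta>" by (simp add: z_def cinner_self)
  qed
  then have "\<pi> p = \<pi> (- y)"
    using star_rep_diff[OF \<pi>(1), of 0 y] star_rep_zero[OF \<pi>(1)]
    by (simp add: P_def w_def) (metis add.commute add_diff_cancel_left' diff_0)
  then have "p = - y" using \<pi>(2) by (simp add: inj_eq)
  then have "a * a + q * q = (r\<^sup>2) *\<^sub>R 1" by (simp add: qq y_def)
  then show ?thesis
    unfolding r_def[symmetric] using a sq aq r by (intro norm_le_of_square_sum)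
qed

text \<open>Selfadjoint elements are scaled to norm 1/2; the general case follows from the
  C*-identity for \<open>star a * a\<close>.\<close>

lemma star_rep_isometric:
  fixes \<pi> :: "'a::unital_cstar_algebra \<Rightarrow> 'k::chilbert_space bop"
  assumes \<pi>: "star_rep \<pi>" "inj \<pi>" "\<pi> 1 = 1"
  shows "norm (\<pi> a) = norm a"
proof -
  have sa: "norm b \<le> norm (\<pi> b)" if b: "star b = b" for b
  proof (cases "b = 0")
    case False
    let ?c = "1 / (2 * norm b)"
    have "norm (?c *\<^sub>R b) \<le> norm (\<pi> (?c *\<^sub>R b))"
      using False by (intro star_rep_isometric_selfadjoint \<pi>) (auto simp: star_scaleR b)
    then show ?thesis
      using False by (simp add: scaleR_scaleC star_rep_scaleC[OF \<pi>(1)] norm_scaleC norm_divide field_simps)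
  qed simp
  have "norm (star a * a) \<le> norm (\<pi> (star a * a))"
    by (rule sa) (simp add: star_mult star_star)
  then have "(norm a)\<^sup>2 \<le> (norm (\<pi> a))\<^sup>2"
    by (simp add: star_rep_mult[OF \<pi>(1)] star_rep_star[OF \<pi>(1)] cstar_identity)
  then have "norm a \<le> norm (\<pi> a)" by (rule power2_le_imp_le) simp
  then show ?thesis using star_rep_contractive[OF \<pi>(1), of a] by simp
qed

section \<open>Operators on tensor products\<close>

lemma tensor_vec_zero_left [simp]: "0 \<otimes>\<^sub>v y = 0"
  using tensor_vec_scaleC_left[of 0 0 y] by simp

lemma tensor_vec_zero_right [simp]: "x \<otimes>\<^sub>v 0 = 0"
  using tensor_vec_scaleC_right[of x 0 0] by simp

lemma norm_tensor_vec: "norm (x \<otimes>\<^sub>v y) = norm x * norm y"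
proof -
  have "complex_of_real ((norm (x \<otimes>\<^sub>v y))\<^sup>2) = complex_of_real ((norm x * norm y)\<^sup>2)"
    unfolding cinner_self[symmetric] cinner_tensor_vec by (simp add: cinner_self power_mult_distrib)
  then have "(norm (x \<otimes>\<^sub>v y))\<^sup>2 = (norm x * norm y)\<^sup>2" using of_real_eq_iff by blast
  then show ?thesis by (rule power2_eq_imp_eq) auto
qed

lemma bounded_linear_tensor_vec_left: "bounded_linear (\<lambda>x. x \<otimes>\<^sub>v y)"
  by (rule bounded_linear_intro[where K="norm y"])
    (auto simp: tensor_vec_add_left scaleR_scaleC tensor_vec_scaleC_left norm_tensor_vec)

lemma bounded_linear_tensor_vec_right: "bounded_linear (\<lambda>y. x \<otimes>\<^sub>v y)"
  by (rule bounded_linear_intro[where K="norm x"])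
    (auto simp: tensor_vec_add_right scaleR_scaleC tensor_vec_scaleC_right norm_tensor_vec)

lemma dense_range_tensor_vec: "closure (cspan (range (\<lambda>(x, y). x \<otimes>\<^sub>v y))) = UNIV"
proof -
  have "range (\<lambda>(x, y). x \<otimes>\<^sub>v y) = {x \<otimes>\<^sub>v y | x y. True}" by auto
  then show ?thesis using dense_tensor_vec by metis
qed

lemma bop_tensor_eqI:
  assumes "\<And>x y. R \<cdot> (x \<otimes>\<^sub>v y) = R' \<cdot> (x \<otimes>\<^sub>v y)"
  shows "R = R'"
  by (rule bop_eq_on_dense[OF dense_range_tensor_vec]) (use assms in auto)

lemma dense_tensor_span:
  assumes "closure (cspan G) = UNIV" "closure (cspan G') = UNIV"
  shows "closure (cspan ((\<lambda>(x, y). x \<otimes>\<^sub>v y) ` (G \<times> G'))) = UNIV"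
proof -
  let ?S = "closure (cspan ((\<lambda>(x, y). x \<otimes>\<^sub>v y) ` (G \<times> G')))"
  have 1: "x \<otimes>\<^sub>v y \<in> ?S" if "x \<in> G" for x y
  proof -
    have "(\<lambda>y. x \<otimes>\<^sub>v y) ` closure (cspan G') \<subseteq> ?S"
      by (rule clinear_on_closure_image)
        (use that in \<open>auto intro!: clinear_onI linear_continuous_on bounded_linear_tensor_vec_right
          subspace_closure_cspan closure_cspan_base simp: tensor_vec_add_right tensor_vec_scaleC_right\<close>)
    then show ?thesis using assms by auto
  qed
  have 2: "x \<otimes>\<^sub>v y \<in> ?S" for x y
  proof -
    have "(\<lambda>x. x \<otimes>\<^sub>v y) ` closure (cspan G) \<subseteq> ?S"
      by (rule clinear_on_closure_image)
        (use 1 in \<open>auto intro!: clinear_onI linear_continuous_on bounded_linear_tensor_vec_left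
          subspace_closure_cspan simp: tensor_vec_add_left tensor_vec_scaleC_left\<close>)
    then show ?thesis using assms by auto
  qed
  have "closure (cspan (range (\<lambda>(x, y). x \<otimes>\<^sub>v y))) \<subseteq> ?S"
    by (rule closure_cspan_minimal) (use 2 in \<open>auto intro: subspace_closure_cspan\<close>)
  then show ?thesis using dense_range_tensor_vec by blast
qed

lemma cspan_UNIV: "closure (cspan UNIV) = (UNIV :: 'a::complex_normed_vector set)"
  using closure_cspan_base by blast

lemma dense_tensor_vec_left:
  "closure (cspan (range (\<lambda>(x, y, z). (x \<otimes>\<^sub>v y) \<otimes>\<^sub>v z))) = UNIV" (is "closure (cspan ?R) = _")
proof -
  have "(x \<otimes>\<^sub>v y) \<otimes>\<^sub>v z \<in> ?R" for x y z
    by (rule range_eqI[of _ _ "(x, y, z)"]) simp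
  then have "(\<lambda>(x, y). x \<otimes>\<^sub>v y) ` (range (\<lambda>(x, y). x \<otimes>\<^sub>v y) \<times> UNIV) \<subseteq> ?R"
    by auto
  from closure_cspan_mono[OF this] show ?thesis
    unfolding dense_tensor_span[OF dense_range_tensor_vec cspan_UNIV] by auto
qed

lemma dense_tensor_vec_right:
  "closure (cspan (range (\<lambda>(x, y, z). x \<otimes>\<^sub>v (y \<otimes>\<^sub>v z)))) = UNIV" (is "closure (cspan ?R) = _")
proof -
  have "x \<otimes>\<^sub>v (y \<otimes>\<^sub>v z) \<in> ?R" for x y z
    by (rule range_eqI[of _ _ "(x, y, z)"]) simp
  then have "(\<lambda>(x, y). x \<otimes>\<^sub>v y) ` (UNIV \<times> range (\<lambda>(x, y). x \<otimes>\<^sub>v y)) \<subseteq> ?R"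
    by auto
  from closure_cspan_mono[OF this] show ?thesis
    unfolding dense_tensor_span[OF cspan_UNIV dense_range_tensor_vec] by auto
qed

section \<open>Isometries given by families with equal Gram matrices\<close>

lemma norm_sum_eq_of_cinner_eq:
  fixes g :: "'i \<Rightarrow> 'h::chilbert_space" and g' :: "'i \<Rightarrow> 'k::chilbert_space"
  assumes "\<And>i j. i \<in> J \<Longrightarrow> j \<in> J \<Longrightarrow> cinner (g' i) (g' j) = cinner (g i) (g j)"
  shows "norm (\<Sum>i\<in>J. k i *\<^sub>C g' i) = norm (\<Sum>i\<in>J. k i *\<^sub>C g i)"
proof -
  have "cinner (\<Sum>i\<in>J. k i *\<^sub>C g' i) (\<Sum>i\<in>J. k i *\<^sub>C g' i) = cinner (\<Sum>i\<in>J. k i *\<^sub>C g i) (\<Sum>i\<in>J. k i *\<^sub>C g i)"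
    unfolding cinner_sum_left cinner_sum_right cinner_scaleC_left cinner_scaleC_right
    using assms by (intro sum.cong refl) simp
  then have "(norm (\<Sum>i\<in>J. k i *\<^sub>C g' i))\<^sup>2 = (norm (\<Sum>i\<in>J. k i *\<^sub>C g i))\<^sup>2"
    unfolding norm_eq_cinner by simp
  then show ?thesis by (rule power2_eq_imp_eq) auto
qed

text \<open>Equal Gram matrices give linear combinations with equal coefficients the same norm, so
  \<open>cont_ext_bounded\<close> applies with constant 1. The instances are the flip and the
  reassociation of tensor factors.\<close>

lemma isometry_exists:
  fixes g :: "'i \<Rightarrow> 'h::chilbert_space" and g' :: "'i \<Rightarrow> 'k::chilbert_space"
  assumes dense: "closure (cspan (range g)) = UNIV"
    and eq: "\<And>i j. cinner (g' i) (g' j) = cinner (g i) (g j)"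
  shows isometry_linear: "clinear_on UNIV (cont_ext UNIV g g')"
    and isometry_continuous: "continuous_on UNIV (cont_ext UNIV g g')"
    and isometry_apply: "cont_ext UNIV g g' (g i) = g' i"
    and isometry_norm_le: "norm (cont_ext UNIV g g' t) \<le> norm t"
proof -
  have "norm (\<Sum>i\<in>J. k i *\<^sub>C g' i) \<le> 1 * norm (\<Sum>i\<in>J. k i *\<^sub>C g i)" for J k
    using norm_sum_eq_of_cinner_eq[of J g' g k] eq by simp
  note * = cont_ext_bounded[of UNIV g' 1 g, OF this, unfolded dense]
  show "clinear_on UNIV (cont_ext UNIV g g')" "continuous_on UNIV (cont_ext UNIV g g')"
    "cont_ext UNIV g g' (g i) = g' i" "norm (cont_ext UNIV g g' t) \<le> norm t"
    using *(1,2) *(3)[of i] *(4)[of t] by auto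
qed

lemma isometry_inverse:
  fixes g :: "'i \<Rightarrow> 'h::chilbert_space" and g' :: "'i \<Rightarrow> 'k::chilbert_space"
  assumes dense: "closure (cspan (range g)) = UNIV" "closure (cspan (range g')) = UNIV"
    and eq: "\<And>i j. cinner (g' i) (g' j) = cinner (g i) (g j)"
  shows "cont_ext UNIV g' g (cont_ext UNIV g g' t) = t"
proof -
  note 1 = isometry_exists[OF dense(1) eq] and 2 = isometry_exists[OF dense(2) eq[symmetric]]
  show ?thesis
  proof (rule clinear_on_closure_eq[where G="range g" and f'="\<lambda>t. t"], unfold dense)
    show "clinear_on UNIV (\<lambda>t. cont_ext UNIV g' g (cont_ext UNIV g g' t))"
      by (rule clinear_on_compose[OF 1(1) 2(1)]) auto
    show "continuous_on UNIV (\<lambda>t. cont_ext UNIV g' g (cont_ext UNIV g g' t))"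
      by (rule continuous_on_compose2[OF 2(2) 1(2)]) auto
  qed (use 1(3) 2(3) in \<open>auto intro: clinear_onI continuous_on_id\<close>)
qed

text \<open>\<open>R'\<close> is V R V^(-1) for the unitary V sending \<open>g i\<close> to
  \<open>g' i\<close>. V remains a plain function because \<open>bop\<close> contains only operators
  from a space to itself.\<close>

lemma isometry_conj_exists:
  fixes g :: "'i \<Rightarrow> 'h::chilbert_space" and g' :: "'i \<Rightarrow> 'k::chilbert_space"
  assumes dense: "closure (cspan (range g)) = UNIV" "closure (cspan (range g')) = UNIV"
    and eq: "\<And>i j. cinner (g' i) (g' j) = cinner (g i) (g j)"
  shows "\<exists>R'. (\<forall>t. R' \<cdot> cont_ext UNIV g g' t = cont_ext UNIV g g' (R \<cdot> t)) \<and> norm R' \<le> norm R"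
proof -
  let ?V = "cont_ext UNIV g g'" and ?V' = "cont_ext UNIV g' g"
  note 1 = isometry_exists[OF dense(1) eq] and 2 = isometry_exists[OF dense(2) eq[symmetric]]
  have norm: "norm (?V (R \<cdot> ?V' x)) \<le> norm R * norm x" for x
    using order_trans[OF 1(4) norm_bop_apply[of R "?V' x"]] mult_left_mono[OF 2(4)[of x] norm_ge_zero[of R]]
    by linarith
  obtain R' where R': "bop_apply R' = (\<lambda>x. ?V (R \<cdot> ?V' x))"
    by (rule bop_exists[of "\<lambda>x. ?V (R \<cdot> ?V' x)" "norm R"])
      (use 1(1) 2(1) norm in \<open>auto simp: clinear_on_def bop_apply_add bop_apply_scaleC mult.commute\<close>)
  have "R' \<cdot> ?V t = ?V (R \<cdot> t)" for t
    unfolding R' by (simp add: isometry_inverse[OF dense eq])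
  moreover have "norm R' \<le> norm R"
    by (rule norm_bop_bound) (use norm R' in auto)
  ultimately show ?thesis by blast
qed

section \<open>Existence and norms of tensor products of operators\<close>

lemma has_sum_sum:
  assumes "\<And>i. i \<in> I \<Longrightarrow> (f i has_sum s i) A"
  shows "((\<lambda>x. \<Sum>i\<in>I. f i x) has_sum (\<Sum>i\<in>I. s i :: 'b::{topological_comm_monoid_add})) A"
  using assms by (induction I rule: infinite_finite_induct) (auto intro: has_sum_add has_sum_0)

text \<open>The tensor product is a Hilbert sum of copies of the first factor, one for each basis
  vector f of the second; the summands are the squared norms of the slices at f.\<close>

lemma has_sum_norm_tensor_sum:
  fixes x :: "'i \<Rightarrow> 'h::chilbert_space" and y :: "'i \<Rightarrow> 'k::chilbert_space"
  shows "((\<lambda>f. (norm (\<Sum>i\<in>J. cinner (y i) f *\<^sub>C x i))\<^sup>2) has_sum (norm (\<Sum>i\<in>J. x i \<otimes>\<^sub>v y i))\<^sup>2) onb"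
proof -
  have "((\<lambda>f. \<Sum>i\<in>J. \<Sum>j\<in>J. cinner (x i) (x j) * (cinner (y i) f * cnj (cinner (y j) f)))
      has_sum (\<Sum>i\<in>J. \<Sum>j\<in>J. cinner (x i) (x j) * cinner (y i) (y j))) onb"
    by (intro has_sum_sum has_sum_cmult_right parseval)
  also have "(\<lambda>f. \<Sum>i\<in>J. \<Sum>j\<in>J. cinner (x i) (x j) * (cinner (y i) f * cnj (cinner (y j) f)))
      = (\<lambda>f. cinner (\<Sum>i\<in>J. cinner (y i) f *\<^sub>C x i) (\<Sum>i\<in>J. cinner (y i) f *\<^sub>C x i))"
    unfolding cinner_sum_left cinner_sum_right cinner_scaleC_left cinner_scaleC_right
    by (intro ext, subst sum.swap) (simp add: sum_distrib_left ac_simps)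
  also have "(\<Sum>i\<in>J. \<Sum>j\<in>J. cinner (x i) (x j) * cinner (y i) (y j))
      = cinner (\<Sum>i\<in>J. x i \<otimes>\<^sub>v y i) (\<Sum>i\<in>J. x i \<otimes>\<^sub>v y i)"
    unfolding cinner_sum_left cinner_sum_right cinner_tensor_vec by (subst sum.swap) simp
  finally show ?thesis
    unfolding norm_eq_cinner by (rule has_sum_Re)
qed

lemma norm_tensor_sum_flip: "norm (\<Sum>i\<in>J. y i \<otimes>\<^sub>v x i) = norm (\<Sum>i\<in>J. x i \<otimes>\<^sub>v y i)"
  using norm_sum_eq_of_cinner_eq[of J "\<lambda>i. y i \<otimes>\<^sub>v x i" "\<lambda>i. x i \<otimes>\<^sub>v y i" "\<lambda>_. 1"]
  by (simp add: cinner_tensor_vec mult.commute)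

text \<open>\<open>S\<close> acts on each slice separately, so the bound holds slice by slice and
  can be summed.\<close>

lemma norm_tensor_sum_left:
  "norm (\<Sum>i\<in>J. (S \<cdot> x i) \<otimes>\<^sub>v y i) \<le> norm S * norm (\<Sum>i\<in>J. x i \<otimes>\<^sub>v y i)"
proof -
  let ?v = "\<lambda>f. \<Sum>i\<in>J. cinner (y i) f *\<^sub>C x i"
  have "(\<Sum>i\<in>J. cinner (y i) f *\<^sub>C S \<cdot> x i) = S \<cdot> ?v f" for f
    by (simp add: bop_apply_sum bop_apply_scaleC)
  then have "((\<lambda>f. (norm (S \<cdot> ?v f))\<^sup>2) has_sum (norm (\<Sum>i\<in>J. (S \<cdot> x i) \<otimes>\<^sub>v y i))\<^sup>2) onb"
    using has_sum_norm_tensor_sum[of y "\<lambda>i. S \<cdot> x i" J] by simp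
  moreover have "((\<lambda>f. (norm S)\<^sup>2 * (norm (?v f))\<^sup>2) has_sum ((norm S)\<^sup>2 * (norm (\<Sum>i\<in>J. x i \<otimes>\<^sub>v y i))\<^sup>2)) onb"
    by (intro has_sum_cmult_right has_sum_norm_tensor_sum)
  moreover have "(norm (S \<cdot> z))\<^sup>2 \<le> (norm S)\<^sup>2 * (norm z)\<^sup>2" for z
    unfolding power_mult_distrib[symmetric] by (intro power_mono norm_bop_apply) auto
  ultimately have "(norm (\<Sum>i\<in>J. (S \<cdot> x i) \<otimes>\<^sub>v y i))\<^sup>2 \<le> (norm S)\<^sup>2 * (norm (\<Sum>i\<in>J. x i \<otimes>\<^sub>v y i))\<^sup>2"
    by (rule has_sum_mono)
  then show ?thesis
    unfolding power_mult_distrib[symmetric] by (rule power2_le_imp_le) simp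
qed

lemma norm_tensor_sum_both:
  "norm (\<Sum>i\<in>J. (S \<cdot> x i) \<otimes>\<^sub>v (T \<cdot> y i)) \<le> norm S * norm T * norm (\<Sum>i\<in>J. x i \<otimes>\<^sub>v y i)"
proof -
  have "norm (\<Sum>i\<in>J. (S \<cdot> x i) \<otimes>\<^sub>v (T \<cdot> y i)) \<le> norm S * norm (\<Sum>i\<in>J. (T \<cdot> y i) \<otimes>\<^sub>v x i)"
    using norm_tensor_sum_left[where y="\<lambda>i. T \<cdot> y i"] by (simp only: norm_tensor_sum_flip[of _ "\<lambda>i. T \<cdot> y i"])
  also have "\<dots> \<le> norm S * (norm T * norm (\<Sum>i\<in>J. y i \<otimes>\<^sub>v x i))"
    by (intro mult_left_mono norm_tensor_sum_left) auto
  finally show ?thesis by (simp add: norm_tensor_sum_flip[of _ y] mult.assoc)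
qed

text \<open>The norm estimate for sums of elementary tensors produces an operator with the required
  values, so the definite description in \<open>op_tensor\<close> denotes.\<close>

lemma op_tensor_apply [simp]: "(S \<otimes>\<^sub>o T) \<cdot> (x \<otimes>\<^sub>v y) = (S \<cdot> x) \<otimes>\<^sub>v (T \<cdot> y)"
  and norm_op_tensor: "norm (S \<otimes>\<^sub>o T) \<le> norm S * norm T"
proof -
  let ?g = "\<lambda>(x, y). x \<otimes>\<^sub>v y" and ?g' = "\<lambda>(x, y). (S \<cdot> x) \<otimes>\<^sub>v (T \<cdot> y)"
  let ?W = "cont_ext UNIV ?g ?g'"
  have "norm (\<Sum>i\<in>J. k i *\<^sub>C ?g' i) \<le> norm S * norm T * norm (\<Sum>i\<in>J. k i *\<^sub>C ?g i)" for J k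
    using norm_tensor_sum_both[where S=S and T=T and x="\<lambda>i. k i *\<^sub>C fst i" and y=snd and J=J]
    by (simp add: case_prod_beta tensor_vec_scaleC_left bop_apply_scaleC)
  note W = cont_ext_bounded[of UNIV ?g' "norm S * norm T" ?g, OF this, unfolded dense_range_tensor_vec]
  obtain R where R: "bop_apply R = ?W"
    by (rule bop_exists[of ?W "norm S * norm T"])
      (use W(1) W(4) in \<open>auto simp: clinear_on_def mult.commute\<close>)
  have "R \<cdot> (x \<otimes>\<^sub>v y) = (S \<cdot> x) \<otimes>\<^sub>v (T \<cdot> y)" for x y
    unfolding R using W(3)[of "(x, y)"] by simp
  then have eq: "S \<otimes>\<^sub>o T = R" by (rule op_tensor_eqI)
  show "(S \<otimes>\<^sub>o T) \<cdot> (x \<otimes>\<^sub>v y) = (S \<cdot> x) \<otimes>\<^sub>v (T \<cdot> y)"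
    unfolding eq by fact
  show "norm (S \<otimes>\<^sub>o T) \<le> norm S * norm T"
    unfolding eq by (rule norm_bop_bound) (use W(4) R in auto)
qed

lemma op_tensor_add_left: "(S + S') \<otimes>\<^sub>o T = S \<otimes>\<^sub>o T + S' \<otimes>\<^sub>o T"
  by (rule op_tensor_eqI) (simp add: bop_add_apply tensor_vec_add_left)

lemma op_tensor_add_right: "S \<otimes>\<^sub>o (T + T') = S \<otimes>\<^sub>o T + S \<otimes>\<^sub>o T'"
  by (rule op_tensor_eqI) (simp add: bop_add_apply tensor_vec_add_right)

lemma op_tensor_scaleC_left: "(c *\<^sub>C S) \<otimes>\<^sub>o T = c *\<^sub>C (S \<otimes>\<^sub>o T)"
  by (rule op_tensor_eqI) (simp add: bop_scaleC_apply tensor_vec_scaleC_left)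

lemma op_tensor_scaleC_right: "S \<otimes>\<^sub>o (c *\<^sub>C T) = c *\<^sub>C (S \<otimes>\<^sub>o T)"
  by (rule op_tensor_eqI) (simp add: bop_scaleC_apply tensor_vec_scaleC_right)

lemma op_tensor_mult: "(S \<otimes>\<^sub>o T) * (S' \<otimes>\<^sub>o T') = (S * S') \<otimes>\<^sub>o (T * T')"
  by (rule op_tensor_eqI[symmetric]) (simp add: bop_times_apply)

lemma op_tensor_one: "1 \<otimes>\<^sub>o 1 = 1"
  by (rule op_tensor_eqI) (simp add: bop_one_apply)

lemma op_tensor_zero_left [simp]: "0 \<otimes>\<^sub>o T = 0"
  by (rule op_tensor_eqI) simp

lemma op_tensor_zero_right [simp]: "S \<otimes>\<^sub>o 0 = 0"
  by (rule op_tensor_eqI) simp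

lemma op_tensor_sum_left: "(\<Sum>i\<in>I. f i) \<otimes>\<^sub>o T = (\<Sum>i\<in>I. f i \<otimes>\<^sub>o T)"
  by (induction I rule: infinite_finite_induct) (auto simp: op_tensor_add_left)

lemma op_tensor_sum_right: "S \<otimes>\<^sub>o (\<Sum>i\<in>I. f i) = (\<Sum>i\<in>I. S \<otimes>\<^sub>o f i)"
  by (induction I rule: infinite_finite_induct) (auto simp: op_tensor_add_right)

lemma cinner_tensor_ext:
  assumes "\<And>x y. cinner (x \<otimes>\<^sub>v y) a = cinner (x \<otimes>\<^sub>v y) b"
  shows "a = b"
proof (rule cinner_ext)
  fix z
  show "cinner z a = cinner z b"
    by (rule clinear_on_closure_eq[where G="range (\<lambda>(x, y). x \<otimes>\<^sub>v y)"], unfold dense_range_tensor_vec)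
      (use assms in \<open>auto intro!: clinear_onI linear_continuous_on bounded_linear_cinner_left
        simp: cinner_add_left cinner_scaleC_left scaleC_complex_def\<close>)
qed

lemma op_tensor_star: "star (S \<otimes>\<^sub>o T) = star S \<otimes>\<^sub>o star T"
  by (rule op_tensor_eqI[symmetric], rule cinner_tensor_ext)
    (simp add: cinner_star_right cinner_tensor_vec)

lemma bounded_linear_op_tensor_left: "bounded_linear (\<lambda>S. S \<otimes>\<^sub>o T)"
  by (rule bounded_linear_intro[where K="norm T"])
    (auto simp: op_tensor_add_left scaleR_scaleC op_tensor_scaleC_left norm_op_tensor)

lemma bounded_linear_op_tensor_right: "bounded_linear (\<lambda>T. S \<otimes>\<^sub>o T)"
  by (rule bounded_linear_intro[where K="norm S"])
    (use norm_op_tensor[of S] in \<open>auto simp: op_tensor_add_right scaleR_scaleC op_tensor_scaleC_right mult.commute\<close>)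

text \<open>The two sums are conjugate under the flip of the tensor factors. This later turns
  estimates for the right leg into estimates for the left leg.\<close>

lemma norm_op_tensor_sum_flip_le:
  "norm (\<Sum>i\<in>J. T i \<otimes>\<^sub>o S i) \<le> norm (\<Sum>i\<in>J. S i \<otimes>\<^sub>o T i)"
proof -
  let ?g = "\<lambda>(x, y). x \<otimes>\<^sub>v y" and ?g' = "\<lambda>(x, y). y \<otimes>\<^sub>v x"
  have "range (\<lambda>(x, y). y \<otimes>\<^sub>v x) = range (\<lambda>(x, y). x \<otimes>\<^sub>v y)" by auto
  then have dense': "closure (cspan (range ?g')) = UNIV" using dense_range_tensor_vec by metis
  have eq: "cinner (?g' i) (?g' j) = cinner (?g i) (?g j)" for i j
    by (auto simp: cinner_tensor_vec case_prod_beta)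
  note dense = dense_range_tensor_vec dense'
  have V: "cont_ext UNIV ?g ?g' (x \<otimes>\<^sub>v y) = y \<otimes>\<^sub>v x" for x y
    using isometry_apply[OF dense(1) eq, of "(x, y)"] by simp
  note lin = isometry_linear[OF dense(1) eq]
  obtain R' where R': "\<And>t. R' \<cdot> cont_ext UNIV ?g ?g' t = cont_ext UNIV ?g ?g' ((\<Sum>i\<in>J. S i \<otimes>\<^sub>o T i) \<cdot> t)"
    and n: "norm R' \<le> norm (\<Sum>i\<in>J. S i \<otimes>\<^sub>o T i)"
    using isometry_conj_exists[OF dense eq] by blast
  have "(\<Sum>i\<in>J. T i \<otimes>\<^sub>o S i) = R'"
  proof (rule bop_tensor_eqI)
    fix y x
    have "R' \<cdot> (y \<otimes>\<^sub>v x) = cont_ext UNIV ?g ?g' (\<Sum>i\<in>J. (S i \<cdot> x) \<otimes>\<^sub>v (T i \<cdot> y))"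
      using R'[of "x \<otimes>\<^sub>v y"] by (simp add: V bop_sum_apply)
    also have "\<dots> = (\<Sum>i\<in>J. (T i \<cdot> y) \<otimes>\<^sub>v (S i \<cdot> x))"
      by (simp add: clinear_on_sum[OF lin cvec.subspace_UNIV] V)
    finally show "(\<Sum>i\<in>J. T i \<otimes>\<^sub>o S i) \<cdot> (y \<otimes>\<^sub>v x) = R' \<cdot> (y \<otimes>\<^sub>v x)"
      by (simp add: bop_sum_apply)
  qed
  with n show ?thesis by simp
qed

lemma norm_op_tensor_sum_flip: "norm (\<Sum>i\<in>J. T i \<otimes>\<^sub>o S i) = norm (\<Sum>i\<in>J. S i \<otimes>\<^sub>o T i)"
  by (intro antisym norm_op_tensor_sum_flip_le)

section \<open>Rank-one operators\<close>

lemma rank_one_exists: "\<exists>T. \<forall>z. T \<cdot> z = cinner z y *\<^sub>C (x::'h::chilbert_space)"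
proof -
  have "norm (cinner z y *\<^sub>C x) \<le> norm z * (norm y * norm x)" for z
    using mult_right_mono[OF cauchy_schwarz[of z y] norm_ge_zero[of x]] by (simp add: norm_scaleC mult.assoc)
  then obtain T where "bop_apply T = (\<lambda>z. cinner z y *\<^sub>C x)"
    by (rule bop_exists[rotated 2, of "\<lambda>z. cinner z y *\<^sub>C x"])
      (auto simp: cinner_add_left scaleC_add_left cinner_scaleC_left scaleC_scaleC)
  then show ?thesis by metis
qed

definition rank_one :: "'h::chilbert_space \<Rightarrow> 'h \<Rightarrow> 'h bop"
  where "rank_one x y = (SOME T. \<forall>z. T \<cdot> z = cinner z y *\<^sub>C x)"

lemma rank_one_apply [simp]: "rank_one x y \<cdot> z = cinner z y *\<^sub>C x"
  using someI_ex[OF rank_one_exists[of y x]] by (simp add: rank_one_def)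

text \<open>The unit ball is mapped into the multiples of \<open>x\<close> by scalars of modulus at
  most norm y, a continuous image of a compact disc.\<close>

lemma rank_one_compact: "rank_one x y \<in> compact_ops"
proof -
  let ?K = "(\<lambda>c. c *\<^sub>C x) ` cball (0::complex) (norm y)" and ?I = "(\<lambda>z. rank_one x y \<cdot> z) ` cball 0 1"
  have "bounded_linear (\<lambda>c. c *\<^sub>C x)"
    by (rule bounded_linear_intro[where K="norm x"])
      (auto simp: scaleC_add_left scaleR_scaleC scaleC_scaleC norm_scaleC scaleR_conv_of_real scaleC_complex_def)
  then have K: "compact ?K"
    by (intro compact_continuous_image linear_continuous_on compact_cball)
  have "?I \<subseteq> ?K"
  proof clarify
    fix z :: 'a assume "z \<in> cball 0 1"
    then have "norm z * norm y \<le> 1 * norm y" by (intro mult_right_mono) auto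
    then have "cinner z y \<in> cball 0 (norm y)"
      using cauchy_schwarz[of z y] by (simp add: order_trans)
    then show "rank_one x y \<cdot> z \<in> ?K" by auto
  qed
  then have "closure ?I \<subseteq> ?K"
    using K by (intro closure_minimal compact_imp_closed)
  then have "compact (closure ?I)"
    using K compact_Int_closed[of ?K "closure ?I"] by (simp add: Int_absorb1)
  then show ?thesis by (simp add: compact_ops_def)
qed

lemma mult_rank_one: "T * rank_one x y = rank_one (T \<cdot> x) y"
  by (rule bop_eqI) (simp add: bop_times_apply bop_apply_scaleC)

lemma star_rank_one: "star (rank_one x y) = rank_one y x"
  by (rule adjoint_unique) (simp add: cinner_scaleC_left cinner_scaleC_right cinner_commute[of x])

lemma rank_one_scaleC_left: "rank_one (c *\<^sub>C x) y = c *\<^sub>C rank_one x y"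
  by (rule bop_eqI) (simp add: bop_scaleC_apply scaleC_scaleC mult.commute)

section \<open>Tensor products with representations\<close>

text \<open>The amplification of \<open>\<rho>\<close> to matrices over A indexed by
  \<open>F\<close>, with the operators \<open>rank_one e f\<close> as matrix units. A matrix is just
  a function; its norm is borrowed from the operator it defines.\<close>

definition mat_op :: "('a \<Rightarrow> 'l::chilbert_space bop) \<Rightarrow> 'h::chilbert_space set \<Rightarrow> ('h \<Rightarrow> 'h \<Rightarrow> 'a) \<Rightarrow> ('h \<otimes>\<^sub>H 'l) bop"
  where "mat_op \<rho> F m = (\<Sum>e\<in>F. \<Sum>f\<in>F. rank_one e f \<otimes>\<^sub>o \<rho> (m e f))"

lemma mat_op_cong: "(\<And>e f. e \<in> F \<Longrightarrow> f \<in> F \<Longrightarrow> m e f = n e f) \<Longrightarrow> mat_op \<rho> F m = mat_op \<rho> F n"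
  unfolding mat_op_def by (intro sum.cong refl) auto

context
  fixes \<rho> :: "'a::unital_cstar_algebra \<Rightarrow> 'l::chilbert_space bop"
  assumes \<rho>: "star_rep \<rho>"
begin

lemma mat_op_add: "mat_op \<rho> F (\<lambda>e f. m e f + n e f) = mat_op \<rho> F m + mat_op \<rho> F n"
  unfolding mat_op_def star_rep_add[OF \<rho>] op_tensor_add_right sum.distrib ..

lemma mat_op_diff: "mat_op \<rho> F (\<lambda>e f. m e f - n e f) = mat_op \<rho> F m - mat_op \<rho> F n"
  using mat_op_add[of F "\<lambda>e f. m e f - n e f" n] by (simp add: algebra_simps)

lemma mat_op_scaleC: "mat_op \<rho> F (\<lambda>e f. c *\<^sub>C m e f) = c *\<^sub>C mat_op \<rho> F m"
  unfolding mat_op_def star_rep_scaleC[OF \<rho>] op_tensor_scaleC_right cvec.scale_sum_right ..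

lemma mat_op_sum: "mat_op \<rho> F (\<lambda>e f. \<Sum>i\<in>J. m i e f) = (\<Sum>i\<in>J. mat_op \<rho> F (m i))"
proof -
  have "mat_op \<rho> F (\<lambda>e f. \<Sum>i\<in>J. m i e f) = (\<Sum>e\<in>F. \<Sum>f\<in>F. \<Sum>i\<in>J. rank_one e f \<otimes>\<^sub>o \<rho> (m i e f))"
    unfolding mat_op_def star_rep_sum[OF \<rho>] op_tensor_sum_right ..
  also have "\<dots> = (\<Sum>e\<in>F. \<Sum>i\<in>J. \<Sum>f\<in>F. rank_one e f \<otimes>\<^sub>o \<rho> (m i e f))"
    by (intro sum.cong refl sum.swap)
  also have "\<dots> = (\<Sum>i\<in>J. mat_op \<rho> F (m i))"
    unfolding mat_op_def by (rule sum.swap)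
  finally show ?thesis .
qed

lemma mat_op_star: "star (mat_op \<rho> F m) = mat_op \<rho> F (\<lambda>e f. star (m f e))"
  unfolding mat_op_def star_sum op_tensor_star star_rank_one star_rep_star[OF \<rho>] by (rule sum.swap)

lemma mat_op_mult:
  assumes "finite F" "F \<subseteq> onb"
  shows "mat_op \<rho> F m * mat_op \<rho> F n = mat_op \<rho> F (\<lambda>e g. \<Sum>f\<in>F. m e f * n f g)"
proof -
  have rr: "rank_one e f * rank_one f' g = (if f' = f then rank_one e g else 0)" if "f \<in> F" "f' \<in> F" for e f f' g
  proof -
    have "f \<in> onb" "f' \<in> onb" using assms that by auto
    then show ?thesis
      by (intro bop_eqI) (auto simp: bop_times_apply bop_apply_scaleC cinner_onb)
  qed
  have "mat_op \<rho> F m * mat_op \<rho> F n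
      = (\<Sum>e\<in>F. \<Sum>f\<in>F. \<Sum>f'\<in>F. \<Sum>g\<in>F. (rank_one e f * rank_one f' g) \<otimes>\<^sub>o \<rho> (m e f * n f' g))"
    unfolding mat_op_def sum_distrib_right
    unfolding sum_distrib_left op_tensor_mult star_rep_mult[OF \<rho>] ..
  also have "\<dots> = (\<Sum>e\<in>F. \<Sum>f\<in>F. \<Sum>f'\<in>F. if f' = f then (\<Sum>g\<in>F. rank_one e g \<otimes>\<^sub>o \<rho> (m e f * n f' g)) else 0)"
    by (intro sum.cong refl) (simp add: rr)
  also have "\<dots> = (\<Sum>e\<in>F. \<Sum>f\<in>F. \<Sum>g\<in>F. rank_one e g \<otimes>\<^sub>o \<rho> (m e f * n f g))"
    using assms by simp
  also have "\<dots> = (\<Sum>e\<in>F. \<Sum>g\<in>F. \<Sum>f\<in>F. rank_one e g \<otimes>\<^sub>o \<rho> (m e f * n f g))"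
    by (intro sum.cong refl sum.swap)
  also have "\<dots> = mat_op \<rho> F (\<lambda>e g. \<Sum>f\<in>F. m e f * n f g)"
    unfolding mat_op_def star_rep_sum[OF \<rho>] op_tensor_sum_right ..
  finally show ?thesis .
qed

text \<open>The operator is tested on f \<otimes> \<eta> against e \<otimes> \<xi>, which isolates
  one entry. For an isometric representation the operator therefore controls all entries with
  indices in \<open>F\<close>.\<close>

lemma norm_entry_le_mat_op:
  assumes F: "finite F" "F \<subseteq> onb" and ef: "e \<in> F" "f \<in> F"
  shows "norm (\<rho> (m e f)) \<le> norm (mat_op \<rho> F m)"
proof (rule norm_bop_bound)
  fix \<eta>
  let ?R = "mat_op \<rho> F m" and ?\<xi> = "\<rho> (m e f) \<cdot> \<eta>"
  have n1: "norm e = 1" "norm f = 1" using ef F norm_onb by auto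
  have c: "cinner f g = (if g = f then 1 else 0)" "cinner g e = (if g = e then 1 else 0)" if "g \<in> F" for g
  proof -
    have "e \<in> onb" "f \<in> onb" "g \<in> onb" using that ef F by auto
    then show "cinner f g = (if g = f then 1 else 0)" "cinner g e = (if g = e then 1 else 0)"
      by (auto simp: cinner_onb)
  qed
  have "?R \<cdot> (f \<otimes>\<^sub>v \<eta>) = (\<Sum>e'\<in>F. \<Sum>f'\<in>F. cinner f f' *\<^sub>C (e' \<otimes>\<^sub>v \<rho> (m e' f') \<cdot> \<eta>))"
    unfolding mat_op_def bop_sum_apply by (simp add: tensor_vec_scaleC_left)
  also have "\<dots> = (\<Sum>e'\<in>F. \<Sum>f'\<in>F. if f' = f then e' \<otimes>\<^sub>v \<rho> (m e' f') \<cdot> \<eta> else 0)"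
    by (intro sum.cong refl) (simp add: c)
  also have "\<dots> = (\<Sum>e'\<in>F. e' \<otimes>\<^sub>v \<rho> (m e' f) \<cdot> \<eta>)"
    using F ef by simp
  finally have "cinner (?R \<cdot> (f \<otimes>\<^sub>v \<eta>)) (e \<otimes>\<^sub>v ?\<xi>) = (\<Sum>e'\<in>F. cinner e' e * cinner (\<rho> (m e' f) \<cdot> \<eta>) ?\<xi>)"
    by (simp add: cinner_sum_left cinner_tensor_vec)
  also have "\<dots> = (\<Sum>e'\<in>F. if e' = e then cinner (\<rho> (m e' f) \<cdot> \<eta>) ?\<xi> else 0)"
    by (intro sum.cong refl) (simp add: c)
  also have "\<dots> = cinner ?\<xi> ?\<xi>"
    using F ef by simp
  finally have "(norm ?\<xi>)\<^sup>2 = cmod (cinner (?R \<cdot> (f \<otimes>\<^sub>v \<eta>)) (e \<otimes>\<^sub>v ?\<xi>))"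
    by (simp add: cinner_self norm_power)
  also have "\<dots> \<le> norm (?R \<cdot> (f \<otimes>\<^sub>v \<eta>)) * norm (e \<otimes>\<^sub>v ?\<xi>)" by (rule cauchy_schwarz)
  also have "\<dots> \<le> norm ?R * norm \<eta> * norm ?\<xi>"
    using norm_bop_apply[of ?R "f \<otimes>\<^sub>v \<eta>"] n1 by (simp add: norm_tensor_vec mult_right_mono)
  finally have "norm ?\<xi> * norm ?\<xi> \<le> norm ?R * norm \<eta> * norm ?\<xi>"
    by (simp add: power2_eq_square)
  then show "norm ?\<xi> \<le> norm ?R * norm \<eta>"
    by (metis mult_right_le_imp_le mult_nonneg_nonneg norm_ge_zero order_le_less zero_less_norm_iff)
qed simp

lemma bounded_linear_star_rep: "bounded_linear \<rho>"
  by (rule bounded_linear_intro[where K=1])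
    (auto simp: star_rep_add[OF \<rho>] scaleR_scaleC star_rep_scaleC[OF \<rho>] star_rep_contractive[OF \<rho>])

end

text \<open>The passage from the \<open>\<pi>\<close>-operator to the
  \<open>\<theta>\<close>-operator of a matrix is a *-homomorphism, hence contractive. It is well
  defined, and its domain is closed, because \<open>\<pi>\<close> is isometric: a convergent
  sequence of such operators has convergent entries.\<close>

lemma norm_mat_op_le:
  fixes \<pi> :: "'a::unital_cstar_algebra \<Rightarrow> 'k::chilbert_space bop" and \<theta> :: "'a \<Rightarrow> 'l::chilbert_space bop"
    and F :: "'h::chilbert_space set"
  assumes \<pi>: "star_rep \<pi>" "inj \<pi>" "\<pi> 1 = 1" and \<theta>: "star_rep \<theta>" and F: "finite F" "F \<subseteq> onb"
  shows "norm (mat_op \<theta> F m) \<le> norm (mat_op \<pi> F m)"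
proof -
  let ?D = "range (mat_op \<pi> F)"
  \<comment> \<open>The matrix chosen here is determined only on F \<times> F, which is all that
    \<open>mat_op\<close> sees.\<close>
  define \<Theta> where "\<Theta> R = mat_op \<theta> F (SOME m. mat_op \<pi> F m = R)" for R
  have entry: "norm (m e f) \<le> norm (mat_op \<pi> F m)" if "e \<in> F" "f \<in> F" for m e f
    using norm_entry_le_mat_op[OF \<pi>(1) F that, of m] by (simp add: star_rep_isometric[OF \<pi>])
  have inj: "m e f = n e f" if "mat_op \<pi> F m = mat_op \<pi> F n" "e \<in> F" "f \<in> F" for m n e f
    using entry[OF that(2,3), of "\<lambda>e f. m e f - n e f"] that(1) by (simp add: mat_op_diff[OF \<pi>(1)])
  have \<Theta>: "\<Theta> (mat_op \<pi> F m) = mat_op \<theta> F m" for m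
    unfolding \<Theta>_def
    by (rule mat_op_cong, rule inj, rule someI[where P="\<lambda>n. mat_op \<pi> F n = mat_op \<pi> F m"]) (rule refl)
  have "closed ?D"
    unfolding closed_sequential_limits
  proof (intro allI impI, elim conjE)
    fix R L assume R: "\<forall>i. R i \<in> ?D" and L: "R \<longlonglongrightarrow> L"
    from R have "\<forall>i. \<exists>m. R i = mat_op \<pi> F m" by auto
    then obtain M where M: "\<And>i. R i = mat_op \<pi> F (M i)" by metis
    have "Cauchy R" using L LIMSEQ_imp_Cauchy by blast
    have "\<exists>l. e \<in> F \<longrightarrow> f \<in> F \<longrightarrow> (\<lambda>i. M i e f) \<longlonglongrightarrow> l" for e f
    proof (cases "e \<in> F \<and> f \<in> F")
      case True
      have "dist (M i e f) (M j e f) \<le> dist (R i) (R j)" for i j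
        unfolding M dist_norm mat_op_diff[OF \<pi>(1), symmetric] using True by (intro entry) auto
      then have "Cauchy (\<lambda>i. M i e f)"
        using \<open>Cauchy R\<close> unfolding Cauchy_def by (meson order_le_less_trans)
      then show ?thesis by (auto simp: Cauchy_convergent_iff convergent_def)
    qed auto
    then obtain l where l: "\<And>e f. e \<in> F \<Longrightarrow> f \<in> F \<Longrightarrow> (\<lambda>i. M i e f) \<longlonglongrightarrow> l e f"
      by metis
    have "R \<longlonglongrightarrow> mat_op \<pi> F l"
      unfolding M mat_op_def
      by (intro tendsto_sum bounded_linear.tendsto[OF bounded_linear_op_tensor_right]
          bounded_linear.tendsto[OF bounded_linear_star_rep[OF \<pi>(1)]] l)
    then show "L \<in> ?D" using L LIMSEQ_unique by blast
  qed
  show ?thesis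
    unfolding \<Theta>[symmetric]
  proof (rule star_hom_contractive[where S="?D" and \<Theta>=\<Theta>])
    show "cvec.subspace ?D"
    proof (rule cvec.subspaceI)
      show "0 \<in> ?D" using mat_op_scaleC[OF \<pi>(1), of F 0] by (metis cvec.scale_zero_left rangeI)
      show "x + y \<in> ?D" if "x \<in> ?D" "y \<in> ?D" for x y
        using that by (auto simp: mat_op_add[OF \<pi>(1), symmetric])
      show "c *\<^sub>C x \<in> ?D" if "x \<in> ?D" for c x
        using that by (auto simp: mat_op_scaleC[OF \<pi>(1), symmetric])
    qed
    show "clinear_on ?D \<Theta>"
      by (rule clinear_onI)
        (auto simp: mat_op_add[OF \<pi>(1), symmetric] mat_op_scaleC[OF \<pi>(1), symmetric] \<Theta> mat_op_add[OF \<theta>] mat_op_scaleC[OF \<theta>])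
  qed (use \<open>closed ?D\<close> in \<open>auto simp: mat_op_mult[OF \<pi>(1) F] mat_op_mult[OF \<theta> F]
      mat_op_star[OF \<pi>(1)] mat_op_star[OF \<theta>] \<Theta>\<close>)
qed

section \<open>Compressions by finite-rank projections\<close>

definition onb_proj :: "'h::chilbert_space set \<Rightarrow> 'h bop"
  where "onb_proj F = (\<Sum>e\<in>F. rank_one e e)"

lemma onb_proj_apply: "onb_proj F \<cdot> x = (\<Sum>e\<in>F. cinner x e *\<^sub>C e)"
  by (simp add: onb_proj_def bop_sum_apply)

lemma norm_onb_proj:
  assumes "finite F" "F \<subseteq> onb"
  shows "norm (onb_proj F) \<le> 1"
proof (rule norm_bop_bound)
  fix x
  have "(norm (onb_proj F \<cdot> x))\<^sup>2 \<le> (norm x)\<^sup>2"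
    unfolding onb_proj_apply norm_sum_onb[OF assms] by (rule bessel[OF assms])
  then show "norm (onb_proj F \<cdot> x) \<le> 1 * norm x" by (simp add: power2_le_iff_abs_le)
qed simp

lemma onb_proj_tendsto: "((\<lambda>F. onb_proj F \<cdot> x) \<longlongrightarrow> x) (finite_subsets_at_top onb)"
  using onb_expansion[of x] unfolding has_sum_def onb_proj_apply .

lemma norm_onb_proj_tensor:
  assumes "finite F" "F \<subseteq> onb"
  shows "norm (onb_proj F \<otimes>\<^sub>o 1) \<le> 1"
  using order_trans[OF norm_op_tensor mult_le_one[OF norm_onb_proj[OF assms] norm_ge_zero norm_one_le]] .

text \<open>Convergence is clear on elementary tensors. It passes to the closed span because the
  projections are uniformly bounded by 1.\<close>

lemma onb_proj_tensor_tendsto: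
  fixes z :: "'h::chilbert_space \<otimes>\<^sub>H 'l::chilbert_space"
  shows "((\<lambda>F. (onb_proj F \<otimes>\<^sub>o 1) \<cdot> z) \<longlongrightarrow> z) (finite_subsets_at_top onb)"
proof -
  let ?P = "\<lambda>F::'h set. (onb_proj F \<otimes>\<^sub>o 1 :: ('h \<otimes>\<^sub>H 'l) bop)" and ?\<F> = "finite_subsets_at_top (onb :: 'h set)"
  let ?V = "{z. ((\<lambda>F. ?P F \<cdot> z) \<longlongrightarrow> z) ?\<F>}"
  have ev: "\<forall>\<^sub>F F in ?\<F>. norm (?P F) \<le> 1"
    by (rule eventually_finite_subsets_at_top_weakI) (rule norm_onb_proj_tensor)
  have "closure (cspan (range (\<lambda>(x, y). x \<otimes>\<^sub>v y))) \<subseteq> ?V"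
  proof (rule closure_cspan_minimal)
    show "range (\<lambda>(x, y). x \<otimes>\<^sub>v y) \<subseteq> ?V"
      by (auto simp: bop_one_apply intro!: bounded_linear.tendsto[OF bounded_linear_tensor_vec_left] onb_proj_tendsto)
    show "cvec.subspace ?V"
      by (rule cvec.subspaceI)
        (auto simp: bop_apply_add bop_apply_scaleC intro: tendsto_add bounded_linear.tendsto[OF bounded_linear_scaleC])
    show "closed ?V"
      unfolding closed_sequential_limits
    proof (intro allI impI, elim conjE, rule CollectI)
      fix f l assume f: "\<forall>n. f n \<in> ?V" and l: "f \<longlonglongrightarrow> l"
      show "((\<lambda>F. ?P F \<cdot> l) \<longlongrightarrow> l) ?\<F>"
      proof (rule tendstoI)
        fix d :: real assume "d > 0"
        then obtain n where n: "norm (f n - l) < d/3"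
          using l by (metis LIMSEQ_iff_nz zero_less_divide_iff zero_less_numeral dist_norm order_refl)
        have "\<forall>\<^sub>F F in ?\<F>. dist (?P F \<cdot> f n) (f n) < d/3"
          using f \<open>d > 0\<close> by (intro tendstoD) auto
        then show "\<forall>\<^sub>F F in ?\<F>. dist (?P F \<cdot> l) l < d"
          using ev
        proof eventually_elim
          case (elim F)
          have "norm (?P F \<cdot> (f n - l)) \<le> 1 * norm (f n - l)"
            using elim norm_bop_apply[of "?P F" "f n - l"] by (meson mult_right_mono norm_ge_zero order_trans)
          then have 1: "norm (?P F \<cdot> f n - ?P F \<cdot> l) < d/3"
            using n by (simp add: bop_apply_diff)
          have "norm (?P F \<cdot> l - l) = norm ((?P F \<cdot> f n - f n) - (?P F \<cdot> f n - ?P F \<cdot> l) + (f n - l))"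
            by simp
          also have "\<dots> \<le> norm (?P F \<cdot> f n - f n) + norm (?P F \<cdot> f n - ?P F \<cdot> l) + norm (f n - l)"
            by (intro order_trans[OF norm_triangle_ineq] add_mono norm_triangle_ineq4 order_refl)
          also have "\<dots> < d" using elim 1 n by (simp add: dist_norm)
          finally show ?case by (simp add: dist_norm)
        qed
      qed
    qed
  qed
  then show ?thesis unfolding dense_range_tensor_vec by blast
qed

text \<open>For P the projection of \<open>F\<close>, write P T P z = P (T P z - T z) + P T z. The
  first summand tends to 0 since norm P \<le> 1, the second to T z, so a common bound on the
  compressions passes to the limit.\<close>

lemma norm_le_of_compressions:
  fixes T :: "('h::chilbert_space \<otimes>\<^sub>H 'l::chilbert_space) bop"
  assumes c: "c \<ge> 0" and le: "\<And>F. finite F \<Longrightarrow> F \<subseteq> onb \<Longrightarrow> norm ((onb_proj F \<otimes>\<^sub>o 1) * T * (onb_proj F \<otimes>\<^sub>o 1)) \<le> c"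
  shows "norm T \<le> c"
proof (rule norm_bop_bound[OF c])
  fix z
  let ?P = "\<lambda>F::'h set. (onb_proj F \<otimes>\<^sub>o 1 :: ('h \<otimes>\<^sub>H 'l) bop)" and ?\<F> = "finite_subsets_at_top (onb :: 'h set)"
  have lim1: "((\<lambda>F. T \<cdot> (?P F \<cdot> z) - T \<cdot> z) \<longlongrightarrow> T \<cdot> z - T \<cdot> z) ?\<F>"
    by (intro tendsto_diff bounded_linear.tendsto[OF bounded_linear_bop_apply] onb_proj_tensor_tendsto tendsto_const)
  have "((\<lambda>F. ?P F \<cdot> (T \<cdot> (?P F \<cdot> z) - T \<cdot> z)) \<longlongrightarrow> 0) ?\<F>"
  proof (rule Lim_null_comparison)
    show "((\<lambda>F. norm (T \<cdot> (?P F \<cdot> z) - T \<cdot> z)) \<longlongrightarrow> 0) ?\<F>"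
      using tendsto_norm[OF lim1] by simp
    show "\<forall>\<^sub>F F in ?\<F>. norm (?P F \<cdot> (T \<cdot> (?P F \<cdot> z) - T \<cdot> z)) \<le> norm (T \<cdot> (?P F \<cdot> z) - T \<cdot> z)"
    proof (rule eventually_finite_subsets_at_top_weakI)
      fix F :: "'h set" assume "finite F" "F \<subseteq> onb"
      then have n: "norm (?P F) \<le> 1" by (rule norm_onb_proj_tensor)
      show "norm (?P F \<cdot> (T \<cdot> (?P F \<cdot> z) - T \<cdot> z)) \<le> norm (T \<cdot> (?P F \<cdot> z) - T \<cdot> z)"
        by (rule order_trans[OF norm_bop_apply]) (use n in \<open>simp add: mult_left_le_one_le\<close>)
    qed
  qed
  from tendsto_add[OF this onb_proj_tensor_tendsto[of "T \<cdot> z"]]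
  have "((\<lambda>F. (?P F * T * ?P F) \<cdot> z) \<longlongrightarrow> T \<cdot> z) ?\<F>"
    by (simp add: bop_apply_diff bop_times_apply)
  then have "((\<lambda>F. norm ((?P F * T * ?P F) \<cdot> z)) \<longlongrightarrow> norm (T \<cdot> z)) ?\<F>"
    by (rule tendsto_norm)
  moreover have "\<forall>\<^sub>F F in ?\<F>. norm ((?P F * T * ?P F) \<cdot> z) \<le> c * norm z"
    by (rule eventually_finite_subsets_at_top_weakI)
      (meson le mult_right_mono norm_bop_apply norm_ge_zero order_trans)
  ultimately show "norm (T \<cdot> z) \<le> c * norm z"
    by (rule tendsto_upperbound) simp
qed

text \<open>Compression turns \<open>x\<close> into a matrix of scalars, and these can be absorbed
  into the element of A.\<close>

lemma compression_op_tensor: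
  assumes "star_rep \<rho>"
  shows "(onb_proj F \<otimes>\<^sub>o 1) * (x \<otimes>\<^sub>o \<rho> a) * (onb_proj F \<otimes>\<^sub>o 1) = mat_op \<rho> F (\<lambda>e f. cinner (x \<cdot> f) e *\<^sub>C a)"
proof -
  have "onb_proj F * x * onb_proj F = (\<Sum>e\<in>F. \<Sum>f\<in>F. cinner (x \<cdot> f) e *\<^sub>C rank_one e f)"
    unfolding onb_proj_def sum_distrib_left sum_distrib_right mult.assoc
    by (subst sum.swap) (simp add: mult_rank_one rank_one_scaleC_left)
  then show ?thesis
    unfolding op_tensor_mult mat_op_def star_rep_scaleC[OF assms] op_tensor_scaleC_right
    by (simp add: op_tensor_sum_left op_tensor_scaleC_left)
qed

text \<open>For every \<open>F\<close> the compressions of both sums come from one and the same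
  matrix over A, so \<open>norm_mat_op_le\<close> compares them. The \<open>x i\<close> are
  arbitrary operators, so the two legs can be treated one after the other.\<close>

lemma norm_op_tensor_rep_right:
  fixes \<pi> :: "'a::unital_cstar_algebra \<Rightarrow> 'k::chilbert_space bop" and \<theta> :: "'a \<Rightarrow> 'l::chilbert_space bop"
    and x :: "'i \<Rightarrow> 'h::chilbert_space bop"
  assumes \<pi>: "star_rep \<pi>" "inj \<pi>" "\<pi> 1 = 1" and \<theta>: "star_rep \<theta>"
  shows "norm (\<Sum>i\<in>J. x i \<otimes>\<^sub>o \<theta> (a i)) \<le> norm (\<Sum>i\<in>J. x i \<otimes>\<^sub>o \<pi> (a i))"
proof (rule norm_le_of_compressions)
  fix F :: "'h set" assume F: "finite F" "F \<subseteq> onb"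
  let ?m = "\<lambda>e f. \<Sum>i\<in>J. cinner (x i \<cdot> f) e *\<^sub>C a i"
  have eq: "(onb_proj F \<otimes>\<^sub>o 1) * (\<Sum>i\<in>J. x i \<otimes>\<^sub>o \<rho> (a i)) * (onb_proj F \<otimes>\<^sub>o 1) = mat_op \<rho> F ?m"
    if "star_rep \<rho>" for \<rho> :: "'a \<Rightarrow> 'z::chilbert_space bop"
    unfolding sum_distrib_left sum_distrib_right compression_op_tensor[OF that] mat_op_sum[OF that] ..
  let ?P = "onb_proj F \<otimes>\<^sub>o 1 :: ('h \<otimes>\<^sub>H 'k) bop" and ?R = "\<Sum>i\<in>J. x i \<otimes>\<^sub>o \<pi> (a i)"
  have P: "norm ?P \<le> 1" using F by (rule norm_onb_proj_tensor)
  have "norm (?P * ?R * ?P) \<le> norm ?P * norm ?R * norm ?P"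
    by (meson mult_right_mono norm_ge_zero norm_mult_ineq order_trans)
  also have "\<dots> \<le> 1 * norm ?R * 1"
    using P by (intro mult_mono) auto
  finally have "norm (mat_op \<pi> F ?m) \<le> norm ?R" unfolding eq[OF \<pi>(1)] by simp
  then show "norm ((onb_proj F \<otimes>\<^sub>o 1) * (\<Sum>i\<in>J. x i \<otimes>\<^sub>o \<theta> (a i)) * (onb_proj F \<otimes>\<^sub>o 1)) \<le> norm ?R"
    unfolding eq[OF \<theta>] using norm_mat_op_le[OF \<pi> \<theta> F, of ?m] by simp
qed simp

lemma norm_op_tensor_rep_left:
  assumes "star_rep \<pi>" "inj \<pi>" "\<pi> 1 = 1" "star_rep \<theta>"
  shows "norm (\<Sum>i\<in>J. \<theta> (a i) \<otimes>\<^sub>o x i) \<le> norm (\<Sum>i\<in>J. \<pi> (a i) \<otimes>\<^sub>o x i)"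
  using norm_op_tensor_rep_right[OF assms, of x a J] by (simp only: norm_op_tensor_sum_flip[of _ x])

lemma norm_op_tensor_rep_both:
  assumes \<pi>: "star_rep \<pi>" "inj \<pi>" "\<pi> 1 = 1" and "star_rep \<rho>" "star_rep \<theta>"
  shows "norm (\<Sum>i\<in>J. \<rho> (a i) \<otimes>\<^sub>o \<theta> (b i)) \<le> norm (\<Sum>i\<in>J. \<pi> (a i) \<otimes>\<^sub>o \<pi> (b i))"
  using norm_op_tensor_rep_left[OF \<pi> assms(4)] norm_op_tensor_rep_right[OF \<pi> assms(5)]
  by (rule order_trans)

section \<open>Transport of identities from generators to closed spans\<close>

definition cont_clinear_on :: "'p::complex_normed_vector set \<Rightarrow> ('p \<Rightarrow> 'q::complex_normed_vector) \<Rightarrow> bool"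
  where "cont_clinear_on V f \<longleftrightarrow> clinear_on V f \<and> continuous_on V f"

lemma cont_clinear_on_id: "cont_clinear_on V (\<lambda>t. t)"
  by (auto simp: cont_clinear_on_def clinear_on_def continuous_on_id)

lemma cont_clinear_on_compose:
  assumes "cont_clinear_on V f" "cont_clinear_on U f'" "f ` V \<subseteq> U"
  shows "cont_clinear_on V (\<lambda>t. f' (f t))"
  using assms clinear_on_compose[of V f U f'] continuous_on_compose2[of U f' V f]
  by (auto simp: cont_clinear_on_def)

lemma cont_clinear_on_bounded_linear:
  assumes "cont_clinear_on V f" "bounded_linear g" "\<And>c x. g (c *\<^sub>C x) = c *\<^sub>C g x"
  shows "cont_clinear_on V (\<lambda>t. g (f t))"
  using assms bounded_linear.continuous_on[OF assms(2)] linear_add[OF bounded_linear.linear[OF assms(2)]]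
  by (auto simp: cont_clinear_on_def clinear_on_def)

lemma cont_clinear_on_bop: "cont_clinear_on V f \<Longrightarrow> cont_clinear_on V (\<lambda>t. T \<cdot> f t)"
  by (rule cont_clinear_on_bounded_linear[OF _ bounded_linear_bop_apply bop_apply_scaleC])

lemma cont_clinear_on_eval: "cont_clinear_on V f \<Longrightarrow> cont_clinear_on V (\<lambda>t. f t \<cdot> x)"
  by (rule cont_clinear_on_bounded_linear[OF _ bounded_linear_bop_eval bop_scaleC_apply])

lemma cont_clinear_on_mult_left: "cont_clinear_on V f \<Longrightarrow> cont_clinear_on V (\<lambda>t. (s::'a::unital_cstar_algebra) * f t)"
  by (rule cont_clinear_on_bounded_linear[OF _ bounded_linear_mult_right mult_scaleC_right])

lemma cont_clinear_on_mult_right: "cont_clinear_on V f \<Longrightarrow> cont_clinear_on V (\<lambda>t. f t * (s::'a::unital_cstar_algebra))"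
  by (rule cont_clinear_on_bounded_linear[OF _ bounded_linear_mult_left mult_scaleC_left])

lemma cont_clinear_on_op_tensor: "cont_clinear_on V f \<Longrightarrow> cont_clinear_on V (\<lambda>t. f t \<otimes>\<^sub>o T)"
  by (rule cont_clinear_on_bounded_linear[OF _ bounded_linear_op_tensor_left op_tensor_scaleC_left])

lemma cont_clinear_on_eq:
  assumes "cont_clinear_on (closure (cspan G)) f" "cont_clinear_on (closure (cspan G)) f'"
    and "\<And>x. x \<in> G \<Longrightarrow> f x = f' x" "t \<in> closure (cspan G)"
  shows "f t = f' t"
  using clinear_on_closure_eq[of G f f' t] assms by (auto simp: cont_clinear_on_def)

text \<open>Provides the domain conditions for compositions of maps defined by
  \<open>cont_ext\<close>.\<close>

lemma cont_clinear_on_mem: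
  assumes "cont_clinear_on (closure (cspan G)) f" "\<And>x. x \<in> G \<Longrightarrow> f x \<in> closure (cspan G')"
    and "t \<in> closure (cspan G)"
  shows "f t \<in> closure (cspan G')"
  using clinear_on_closure_image[of G f "closure (cspan G')"] assms subspace_closure_cspan[of G']
  by (auto simp: cont_clinear_on_def)

lemma closure_cspan_mult:
  fixes G :: "'a::unital_cstar_algebra set"
  assumes G: "\<And>x y. x \<in> G \<Longrightarrow> y \<in> G \<Longrightarrow> x * y \<in> G"
    and "s \<in> closure (cspan G)" "t \<in> closure (cspan G)"
  shows "s * t \<in> closure (cspan G)"
proof (rule cont_clinear_on_mem[where f="\<lambda>t. s * t"])
  fix y assume "y \<in> G"
  show "s * y \<in> closure (cspan G)"
    by (rule cont_clinear_on_mem[where f="\<lambda>s. s * y"])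
      (use assms \<open>y \<in> G\<close> in \<open>auto intro: cont_clinear_on_mult_right cont_clinear_on_id closure_cspan_base\<close>)
qed (use assms in \<open>auto intro: cont_clinear_on_mult_left cont_clinear_on_id\<close>)

text \<open>Both sides are linear and continuous in each factor, so the factors pass from generators
  to the closed span one at a time.\<close>

lemma cont_clinear_on_hom:
  fixes G :: "'a::unital_cstar_algebra set" and W :: "'a \<Rightarrow> 'b::unital_cstar_algebra"
  assumes G: "\<And>x y. x \<in> G \<Longrightarrow> y \<in> G \<Longrightarrow> x * y \<in> G"
    and W: "cont_clinear_on (closure (cspan G)) W" "\<And>x y. x \<in> G \<Longrightarrow> y \<in> G \<Longrightarrow> W (x * y) = W x * W y"
    and st: "s \<in> closure (cspan G)" "t \<in> closure (cspan G)"
  shows "W (s * t) = W s * W t"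
proof (rule cont_clinear_on_eq[where G=G and f="\<lambda>t. W (s * t)"])
  note mem = closure_cspan_mult[OF G]
  show "cont_clinear_on (closure (cspan G)) (\<lambda>t. W (s * t))"
    by (rule cont_clinear_on_compose[OF _ W(1)]) (use mem st in \<open>auto intro: cont_clinear_on_mult_left cont_clinear_on_id\<close>)
  fix y assume "y \<in> G"
  show "W (s * y) = W s * W y"
  proof (rule cont_clinear_on_eq[where G=G and f="\<lambda>s. W (s * y)"])
    show "cont_clinear_on (closure (cspan G)) (\<lambda>s. W (s * y))"
      by (rule cont_clinear_on_compose[OF _ W(1)])
        (use mem st closure_cspan_base[OF \<open>y \<in> G\<close>] in \<open>auto intro: cont_clinear_on_mult_right cont_clinear_on_id\<close>)
  qed (use W st \<open>y \<in> G\<close> in \<open>auto intro: cont_clinear_on_mult_right\<close>)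
qed (use W st in \<open>auto intro: cont_clinear_on_mult_left\<close>)

lemma closure_cspan_star:
  fixes G :: "'a::unital_cstar_algebra set"
  assumes G: "\<And>x. x \<in> G \<Longrightarrow> star x \<in> G" and "s \<in> closure (cspan G)"
  shows "star s \<in> closure (cspan G)"
proof -
  let ?V = "closure (cspan G)"
  have "?V \<subseteq> star -` ?V"
  proof (rule closure_cspan_minimal)
    show "closed (star -` ?V)"
      by (intro closed_vimage closed_closure linear_continuous_on bounded_linear_star)
    show "cvec.subspace (star -` ?V)"
      using subspace_closure_cspan[of G] by (auto simp: cvec.subspace_def star_add star_scaleC)
  qed (use G closure_cspan_base in auto)
  then show ?thesis using assms by auto
qed

text \<open>The map s \<mapsto> W (star s) is conjugate-linear and falls outside
  \<open>cont_clinear_on\<close>. Applying \<open>star\<close> once more makes it linear, and the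
  result is compared with \<open>W\<close>.\<close>

lemma cont_clinear_on_star:
  fixes G :: "'a::unital_cstar_algebra set" and W :: "'a \<Rightarrow> 'b::unital_cstar_algebra"
  assumes G: "\<And>x. x \<in> G \<Longrightarrow> star x \<in> G"
    and W: "cont_clinear_on (closure (cspan G)) W" "\<And>x. x \<in> G \<Longrightarrow> W (star x) = star (W x)"
    and s: "s \<in> closure (cspan G)"
  shows "W (star s) = star (W s)"
proof -
  let ?V = "closure (cspan G)"
  note mem = closure_cspan_star[OF G]
  have "star (W (star s)) = W s"
  proof (rule cont_clinear_on_eq[where G=G and f="\<lambda>s. star (W (star s))"])
    have "continuous_on ?V (\<lambda>s. W (star s))"
      by (rule continuous_on_compose2[of ?V W])
        (use W mem in \<open>auto simp: cont_clinear_on_def intro: linear_continuous_on bounded_linear_star\<close>)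
    then have "continuous_on ?V (\<lambda>s. star (W (star s)))"
      by (rule bounded_linear.continuous_on[OF bounded_linear_star])
    moreover have "clinear_on ?V (\<lambda>s. star (W (star s)))"
      using W(1) mem by (auto simp: cont_clinear_on_def clinear_on_def star_add star_scaleC)
    ultimately show "cont_clinear_on ?V (\<lambda>s. star (W (star s)))" by (simp add: cont_clinear_on_def)
  qed (use W s in \<open>auto simp: star_star\<close>)
  then show ?thesis by (metis star_star)
qed

lemma bop_eq_on_dense_vec:
  assumes "closure (range f) = UNIV" "\<And>a \<zeta>. S \<cdot> (f a \<otimes>\<^sub>v \<zeta>) = T \<cdot> (f a \<otimes>\<^sub>v \<zeta>)"
  shows "S = T"
proof -
  have "closure (range f) \<subseteq> closure (cspan (range f))"
    by (intro closure_mono cvec.span_superset)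
  then have "closure (cspan (range f)) = UNIV" using assms(1) by auto
  from dense_tensor_span[OF this cspan_UNIV] show ?thesis
    by (rule bop_eq_on_dense) (use assms(2) in auto)
qed

text \<open>Conjugation by the associator. The last clause turns coassociativity, which
  \<open>comultiplication\<close> states as an intertwining relation, into an equation between
  operators.\<close>

lemma tensor_assoc_conj_exists:
  "\<exists>\<alpha> :: (('h::chilbert_space \<otimes>\<^sub>H 'k::chilbert_space) \<otimes>\<^sub>H 'l::chilbert_space) bop \<Rightarrow> ('h \<otimes>\<^sub>H 'k \<otimes>\<^sub>H 'l) bop.
    cont_clinear_on UNIV \<alpha> \<and> (\<forall>S T R. \<alpha> ((S \<otimes>\<^sub>o T) \<otimes>\<^sub>o R) = S \<otimes>\<^sub>o (T \<otimes>\<^sub>o R)) \<and>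
    (\<forall>R R'. (\<forall>t. tensor_assoc (R \<cdot> t) = R' \<cdot> tensor_assoc t) \<longrightarrow> \<alpha> R = R')"
proof -
  let ?g = "\<lambda>(x::'h, y::'k, z::'l). (x \<otimes>\<^sub>v y) \<otimes>\<^sub>v z" and ?g' = "\<lambda>(x::'h, y::'k, z::'l). x \<otimes>\<^sub>v (y \<otimes>\<^sub>v z)"
  have eq: "cinner (?g' i) (?g' j) = cinner (?g i) (?g j)" for i j
    by (auto simp: cinner_tensor_vec case_prod_beta)
  note dense = dense_tensor_vec_left dense_tensor_vec_right
  let ?V = "tensor_assoc :: ('h \<otimes>\<^sub>H 'k) \<otimes>\<^sub>H 'l \<Rightarrow> _"
  note iso = isometry_exists[OF dense(1) eq, folded tensor_assoc_def]
  have V: "?V ((x \<otimes>\<^sub>v y) \<otimes>\<^sub>v z) = x \<otimes>\<^sub>v (y \<otimes>\<^sub>v z)" for x y z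
    using iso(3)[of "(x, y, z)"] by simp
  have surj: "\<exists>t. ?V t = s" for s
    using isometry_inverse[OF dense(2,1) eq[symmetric], folded tensor_assoc_def] by blast
  obtain \<alpha> where \<alpha>: "\<And>R t. \<alpha> R \<cdot> ?V t = ?V (R \<cdot> t)" and n: "\<And>R. norm (\<alpha> R) \<le> norm R"
    using isometry_conj_exists[OF dense eq, folded tensor_assoc_def] by metis
  have uniq: "\<alpha> R = R'" if "\<And>t. ?V (R \<cdot> t) = R' \<cdot> ?V t" for R R'
    by (rule bop_eqI) (metis surj \<alpha> that)
  have lin: "\<alpha> (R + R') = \<alpha> R + \<alpha> R'" "\<alpha> (c *\<^sub>C R) = c *\<^sub>C \<alpha> R" for R R' c
    by (rule uniq; use iso(1) in \<open>simp add: bop_add_apply bop_scaleC_apply \<alpha> clinear_on_def\<close>)+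
  have "bounded_linear \<alpha>"
    by (rule bounded_linear_intro[where K=1]) (use n lin in \<open>auto simp: scaleR_scaleC\<close>)
  then have "cont_clinear_on UNIV \<alpha>"
    using lin by (auto simp: cont_clinear_on_def clinear_on_def linear_continuous_on)
  moreover have "\<alpha> ((S \<otimes>\<^sub>o T) \<otimes>\<^sub>o R) = S \<otimes>\<^sub>o (T \<otimes>\<^sub>o R)" for S T R
  proof (rule bop_eq_on_dense[OF dense(2)])
    fix v assume "v \<in> range ?g'"
    then obtain x y z where "v = ?V ((x \<otimes>\<^sub>v y) \<otimes>\<^sub>v z)" by (auto simp: V)
    then show "\<alpha> ((S \<otimes>\<^sub>o T) \<otimes>\<^sub>o R) \<cdot> v = (S \<otimes>\<^sub>o (T \<otimes>\<^sub>o R)) \<cdot> v"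
      by (simp only: \<alpha>) (simp add: V)
  qed
  ultimately show ?thesis using uniq by blast
qed

section \<open>Tensor products of representations and their amplifications\<close>

lemma range_case_prodI: "f a b \<in> range (\<lambda>(a, b). f a b)"
  by force

text \<open>Covers \<open>comult_tensor_id\<close>, \<open>id_tensor_comult\<close> and
  \<open>rep_tensor\<close>, so that continuity is proved once for all of them.\<close>

definition tensor_rep :: "('a::unital_cstar_algebra \<Rightarrow> 'k::chilbert_space bop) \<Rightarrow> ('a \<Rightarrow> 'h::chilbert_space bop)
    \<Rightarrow> ('a \<Rightarrow> 'l::chilbert_space bop) \<Rightarrow> ('k \<otimes>\<^sub>H 'k) bop \<Rightarrow> ('h \<otimes>\<^sub>H 'l) bop"
  where "tensor_rep \<pi> \<rho> \<theta> = cont_ext UNIV (\<lambda>(a, b). \<pi> a \<otimes>\<^sub>o \<pi> b) (\<lambda>(a, b). \<rho> a \<otimes>\<^sub>o \<theta> b)"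

text \<open>This is \<rho> \<otimes> \<iota>. As the second leg may be any operator, it can be
  applied to elements of A \<otimes> (A \<otimes> A).\<close>

definition amp_left :: "('a::unital_cstar_algebra \<Rightarrow> 'k::chilbert_space bop) \<Rightarrow> ('a \<Rightarrow> 'h::chilbert_space bop)
    \<Rightarrow> ('k \<otimes>\<^sub>H 'l::chilbert_space) bop \<Rightarrow> ('h \<otimes>\<^sub>H 'l) bop"
  where "amp_left \<pi> \<rho> = cont_ext UNIV (\<lambda>(a, x). \<pi> a \<otimes>\<^sub>o x) (\<lambda>(a, x). \<rho> a \<otimes>\<^sub>o x)"

text \<open>This is \<iota> \<otimes> \<theta> on a domain that contains
  \<open>compact_tensor \<pi>\<close>.\<close>

definition amp_right :: "('a::unital_cstar_algebra \<Rightarrow> 'k::chilbert_space bop) \<Rightarrow> ('a \<Rightarrow> 'l::chilbert_space bop)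
    \<Rightarrow> ('h::chilbert_space \<otimes>\<^sub>H 'k) bop \<Rightarrow> ('h \<otimes>\<^sub>H 'l) bop"
  where "amp_right \<pi> \<theta> = cont_ext UNIV (\<lambda>(x, a). x \<otimes>\<^sub>o \<pi> a) (\<lambda>(x, a). x \<otimes>\<^sub>o \<theta> a)"

lemma min_tensor_range: "min_tensor (range \<pi>) (range \<pi>) = closure (cspan (range (\<lambda>(a, b). \<pi> a \<otimes>\<^sub>o \<pi> b)))"
proof -
  have "{S \<otimes>\<^sub>o T |S T. S \<in> range \<pi> \<and> T \<in> range \<pi>} = range (\<lambda>(a, b). \<pi> a \<otimes>\<^sub>o \<pi> b)"
    by auto
  then show ?thesis unfolding min_tensor_def by simp
qed

lemma compact_tensor_eq:
  "compact_tensor \<pi> = closure (cspan ((\<lambda>(x :: 'h::chilbert_space bop, a). x \<otimes>\<^sub>o \<pi> a) ` (compact_ops \<times> UNIV)))"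
proof -
  have "{S \<otimes>\<^sub>o T |S T. S \<in> (compact_ops :: 'h bop set) \<and> T \<in> range \<pi>} = (\<lambda>(x, a). x \<otimes>\<^sub>o \<pi> a) ` (compact_ops \<times> UNIV)"
    by auto
  then show ?thesis unfolding compact_tensor_def min_tensor_def by simp
qed

lemma compact_tensor_subset:
  "compact_tensor \<pi> \<subseteq> closure (cspan (range (\<lambda>(x, a). x \<otimes>\<^sub>o \<pi> a)))"
  unfolding compact_tensor_eq by (intro closure_cspan_mono image_mono) auto

lemma op_tensor_mem_compact_tensor: "x \<in> compact_ops \<Longrightarrow> x \<otimes>\<^sub>o \<pi> a \<in> compact_tensor \<pi>"
  unfolding compact_tensor_eq by (rule closure_cspan_base) force

context
  fixes \<pi> :: "'a::unital_cstar_algebra \<Rightarrow> 'k::chilbert_space bop"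
  assumes \<pi>: "star_rep \<pi>" "inj \<pi>" "\<pi> 1 = 1"
begin

lemma
  assumes "star_rep \<rho>" "star_rep \<theta>"
  shows tensor_rep_cont_clinear: "cont_clinear_on (min_tensor (range \<pi>) (range \<pi>)) (tensor_rep \<pi> \<rho> \<theta>)"
    and tensor_rep_apply: "tensor_rep \<pi> \<rho> \<theta> (\<pi> a \<otimes>\<^sub>o \<pi> b) = \<rho> a \<otimes>\<^sub>o \<theta> b"
proof -
  have "norm (\<Sum>i\<in>J. k i *\<^sub>C (case i of (a, b) \<Rightarrow> \<rho> a \<otimes>\<^sub>o \<theta> b))
      \<le> 1 * norm (\<Sum>i\<in>J. k i *\<^sub>C (case i of (a, b) \<Rightarrow> \<pi> a \<otimes>\<^sub>o \<pi> b))" for J k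
    using norm_op_tensor_rep_both[OF \<pi> assms, of "\<lambda>i. k i *\<^sub>C fst i" snd J]
    by (simp add: case_prod_beta star_rep_scaleC[OF assms(1)] star_rep_scaleC[OF \<pi>(1)] op_tensor_scaleC_left)
  note * = cont_ext_bounded[of UNIV _ 1, OF this, folded min_tensor_range tensor_rep_def]
  show "cont_clinear_on (min_tensor (range \<pi>) (range \<pi>)) (tensor_rep \<pi> \<rho> \<theta>)"
    using *(1,2) by (simp add: cont_clinear_on_def)
  show "tensor_rep \<pi> \<rho> \<theta> (\<pi> a \<otimes>\<^sub>o \<pi> b) = \<rho> a \<otimes>\<^sub>o \<theta> b"
    using *(3)[of "(a, b)"] by simp
qed

lemma
  assumes "star_rep \<rho>"
  shows amp_left_cont_clinear: "cont_clinear_on (closure (cspan (range (\<lambda>(a, x). \<pi> a \<otimes>\<^sub>o x)))) (amp_left \<pi> \<rho>)"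
    and amp_left_apply: "amp_left \<pi> \<rho> (\<pi> a \<otimes>\<^sub>o x) = \<rho> a \<otimes>\<^sub>o x"
proof -
  have "norm (\<Sum>i\<in>J. k i *\<^sub>C (case i of (a, x) \<Rightarrow> \<rho> a \<otimes>\<^sub>o x))
      \<le> 1 * norm (\<Sum>i\<in>J. k i *\<^sub>C (case i of (a, x) \<Rightarrow> \<pi> a \<otimes>\<^sub>o x))" for J k
    using norm_op_tensor_rep_left[OF \<pi> assms, of "\<lambda>i. k i *\<^sub>C fst i" snd J]
    by (simp add: case_prod_beta star_rep_scaleC[OF assms(1)] star_rep_scaleC[OF \<pi>(1)] op_tensor_scaleC_left)
  note * = cont_ext_bounded[of UNIV _ 1, OF this, folded amp_left_def]
  show "cont_clinear_on (closure (cspan (range (\<lambda>(a, x). \<pi> a \<otimes>\<^sub>o x)))) (amp_left \<pi> \<rho>)"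
    using *(1,2) by (simp add: cont_clinear_on_def)
  show "amp_left \<pi> \<rho> (\<pi> a \<otimes>\<^sub>o x) = \<rho> a \<otimes>\<^sub>o x"
    using *(3)[of "(a, x)"] by simp
qed

lemma
  assumes "star_rep \<theta>"
  shows amp_right_cont_clinear: "cont_clinear_on (closure (cspan (range (\<lambda>(x, a). x \<otimes>\<^sub>o \<pi> a)))) (amp_right \<pi> \<theta>)"
    and amp_right_apply: "amp_right \<pi> \<theta> (x \<otimes>\<^sub>o \<pi> a) = x \<otimes>\<^sub>o \<theta> a"
proof -
  have "norm (\<Sum>i\<in>J. k i *\<^sub>C (case i of (x, a) \<Rightarrow> x \<otimes>\<^sub>o \<theta> a))
      \<le> 1 * norm (\<Sum>i\<in>J. k i *\<^sub>C (case i of (x, a) \<Rightarrow> x \<otimes>\<^sub>o \<pi> a))" for J k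
    using norm_op_tensor_rep_right[OF \<pi> assms, of "\<lambda>i. k i *\<^sub>C fst i" snd J]
    by (simp add: case_prod_beta op_tensor_scaleC_left)
  note * = cont_ext_bounded[of UNIV _ 1, OF this, folded amp_right_def]
  show "cont_clinear_on (closure (cspan (range (\<lambda>(x, a). x \<otimes>\<^sub>o \<pi> a)))) (amp_right \<pi> \<theta>)"
    using *(1,2) by (simp add: cont_clinear_on_def)
  show "amp_right \<pi> \<theta> (x \<otimes>\<^sub>o \<pi> a) = x \<otimes>\<^sub>o \<theta> a"
    using *(3)[of "(x, a)"] by simp
qed

lemma amp_right_mult:
  assumes \<theta>: "star_rep \<theta>" and "s \<in> closure (cspan (range (\<lambda>(x, a). x \<otimes>\<^sub>o \<pi> a)))" "t \<in> closure (cspan (range (\<lambda>(x, a). x \<otimes>\<^sub>o \<pi> a)))"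
  shows "amp_right \<pi> \<theta> (s * t) = amp_right \<pi> \<theta> s * amp_right \<pi> \<theta> t"
  by (rule cont_clinear_on_hom[OF _ amp_right_cont_clinear[OF \<theta>] _ assms(2,3)])
    (auto simp: op_tensor_mult star_rep_mult[OF \<pi>(1), symmetric] amp_right_apply[OF \<theta>] star_rep_mult[OF \<theta>]
      intro: range_case_prodI[of "\<lambda>x a. x \<otimes>\<^sub>o \<pi> a"])

lemma amp_right_star:
  assumes \<theta>: "star_rep \<theta>" and "s \<in> closure (cspan (range (\<lambda>(x, a). x \<otimes>\<^sub>o \<pi> a)))"
  shows "amp_right \<pi> \<theta> (star s) = star (amp_right \<pi> \<theta> s)"
  by (rule cont_clinear_on_star[OF _ amp_right_cont_clinear[OF \<theta>] _ assms(2)])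
    (auto simp: op_tensor_star star_rep_star[OF \<pi>(1), symmetric] amp_right_apply[OF \<theta>] star_rep_star[OF \<theta>]
      intro: range_case_prodI[of "\<lambda>x a. x \<otimes>\<^sub>o \<pi> a"])

lemma amp_left_tensor_rep:
  assumes "star_rep \<rho>" "star_rep \<theta>" and t: "t \<in> min_tensor (range \<pi>) (range \<pi>)"
  shows "amp_left \<pi> \<rho> (tensor_rep \<pi> \<pi> \<theta> t) = tensor_rep \<pi> \<rho> \<theta> t"
proof -
  note [simp] = tensor_rep_apply[OF \<pi>(1) assms(2)] tensor_rep_apply[OF assms(1,2)] amp_left_apply[OF assms(1)]
  note l = tensor_rep_cont_clinear[OF \<pi>(1) assms(2), unfolded min_tensor_range]
  \<comment> \<open>The value has to lie where \<open>amp_left\<close> is meaningful.\<close>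
  have mem: "tensor_rep \<pi> \<pi> \<theta> s \<in> closure (cspan (range (\<lambda>(a, x). \<pi> a \<otimes>\<^sub>o x)))"
    if "s \<in> closure (cspan (range (\<lambda>(a, b). \<pi> a \<otimes>\<^sub>o \<pi> b)))" for s
    by (rule cont_clinear_on_mem[OF l _ that])
      (auto intro!: closure_cspan_base intro: range_case_prodI[of "\<lambda>a x. \<pi> a \<otimes>\<^sub>o x"])
  show ?thesis
    by (rule cont_clinear_on_eq[OF _ _ _ t[unfolded min_tensor_range]])
      (use mem in \<open>auto intro!: cont_clinear_on_compose[OF l amp_left_cont_clinear[OF assms(1)]]
        tensor_rep_cont_clinear[OF assms(1,2), unfolded min_tensor_range]\<close>)
qed

end

section \<open>The right regular representation\<close>

context
  fixes \<pi> :: "'a::unital_cstar_algebra \<Rightarrow> 'k::chilbert_space bop"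
  assumes \<pi>: "star_rep \<pi>" "inj \<pi>" "\<pi> 1 = 1"
begin

text \<open>Since \<open>u\<^sup>* u = 1\<close>, the assignment \<open>\<theta> c \<zeta> \<mapsto> \<theta> (u c) \<zeta>\<close> is isometric, where \<open>\<theta> = \<iota> \<otimes> \<psi>\<close>; this gives the
  operator described by \<^const>\<open>multiplier_ext\<close> without an approximate unit.\<close>

lemma id_tensor_ext_mult:
  fixes \<psi> :: "'a \<Rightarrow> ('k \<otimes>\<^sub>H 'k) bop" and u :: "('h::chilbert_space \<otimes>\<^sub>H 'k) bop"
  assumes \<psi>: "star_rep \<psi>" "\<psi> 1 = 1" and u: "u \<in> multipliers (compact_tensor \<pi>)" "star u * u = 1"
    and c: "c \<in> compact_tensor \<pi>"
  shows "id_tensor_ext \<pi> \<psi> u * amp_right \<pi> \<psi> c = amp_right \<pi> \<psi> (u * c)"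
proof -
  let ?C = "compact_tensor \<pi> :: ('h \<otimes>\<^sub>H 'k) bop set" and ?W = "amp_right \<pi> \<psi> :: ('h \<otimes>\<^sub>H 'k) bop \<Rightarrow> _"
  let ?G = "range (\<lambda>(x, a). x \<otimes>\<^sub>o \<pi> a) :: ('h \<otimes>\<^sub>H 'k) bop set"
  have CG: "d \<in> closure (cspan ?G)" if "d \<in> ?C" for d
    using compact_tensor_subset that by blast
  have uC: "u * d \<in> ?C" if "d \<in> ?C" for d
    using u(1) that by (auto simp: multipliers_def)
  \<comment> \<open>Here the larger span helps: its stability under adjoints does not involve
    adjoints of compact operators.\<close>
  have starG: "star d \<in> closure (cspan ?G)" if "d \<in> ?C" for d
    by (rule closure_cspan_star[OF _ CG[OF that]])
      (auto simp: op_tensor_star star_rep_star[OF \<pi>(1), symmetric] intro: range_case_prodI[of "\<lambda>x a. x \<otimes>\<^sub>o \<pi> a"])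
  \<comment> \<open>The map inside \<open>id_tensor_ext\<close>. On \<open>?C\<close> it agrees with
    \<open>amp_right\<close>, which is known to respect products and adjoints on a larger
    algebra.\<close>
  define \<theta> where "\<theta> = cont_ext (compact_ops \<times> UNIV) (\<lambda>(x::'h bop, a). x \<otimes>\<^sub>o \<pi> a) (\<lambda>(x, a). x \<otimes>\<^sub>o \<psi> a)"
  have \<theta>: "\<theta> d = ?W d" if "d \<in> ?C" for d
    unfolding \<theta>_def
  proof (rule cont_ext_eqI)
    note W = amp_right_cont_clinear[OF \<pi> \<psi>(1), unfolded cont_clinear_on_def]
    note sub = compact_tensor_subset[of \<pi>, unfolded compact_tensor_eq]
    show "clinear_on (closure (cspan ((\<lambda>(x, a). x \<otimes>\<^sub>o \<pi> a) ` (compact_ops \<times> UNIV)))) ?W"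
      by (rule clinear_on_subset[OF conjunct1[OF W] sub])
    show "continuous_on (closure (cspan ((\<lambda>(x, a). x \<otimes>\<^sub>o \<pi> a) ` (compact_ops \<times> UNIV)))) ?W"
      by (rule continuous_on_subset[OF conjunct2[OF W] sub])
  qed (use that in \<open>auto simp: compact_tensor_eq amp_right_apply[OF \<pi> \<psi>(1)]\<close>)
  let ?g = "\<lambda>(d, \<zeta>). ?W d \<cdot> \<zeta>" and ?g' = "\<lambda>(d, \<zeta>). ?W (u * d) \<cdot> \<zeta>"
  \<comment> \<open>The product of the adjoint of u d with u d' is d^* (u^* u) d' = d^* d', and
    \<open>?W\<close> respects products and adjoints.\<close>
  have inner: "cinner (?g' i) (?g' j) = cinner (?g i) (?g j)" if "i \<in> ?C \<times> UNIV" "j \<in> ?C \<times> UNIV" for i j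
  proof -
    obtain d \<zeta> d' \<zeta>' where ij: "i = (d, \<zeta>)" "j = (d', \<zeta>')" and d: "d \<in> ?C" "d' \<in> ?C"
      using \<open>i \<in> ?C \<times> UNIV\<close> \<open>j \<in> ?C \<times> UNIV\<close> by auto
    have W: "star (?W s) * ?W t = ?W (star s * t)" if "s \<in> ?C" "t \<in> ?C" for s t
      using that starG CG by (simp add: amp_right_mult[OF \<pi> \<psi>(1)] amp_right_star[OF \<pi> \<psi>(1)])
    have "star (u * d) * (u * d') = star d * (star u * u) * d'"
      by (simp add: star_mult mult.assoc)
    then have "star (?W (u * d)) * ?W (u * d') = star (?W d) * ?W d'"
      using d uC by (simp add: W u(2))
    then have "cinner \<zeta> ((star (?W (u * d)) * ?W (u * d')) \<cdot> \<zeta>') = cinner \<zeta> ((star (?W d) * ?W d') \<cdot> \<zeta>')"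
      by simp
    then show ?thesis by (simp add: ij bop_times_apply cinner_star_right)
  qed
  have unit: "?W (rank_one x y \<otimes>\<^sub>o \<pi> 1) \<cdot> (z \<otimes>\<^sub>v \<zeta>) = cinner z y *\<^sub>C (x \<otimes>\<^sub>v \<zeta>)" for x y z \<zeta>
    by (simp add: amp_right_apply[OF \<pi> \<psi>(1)] \<psi>(2) bop_one_apply tensor_vec_scaleC_left)
  have rC: "rank_one x y \<otimes>\<^sub>o \<pi> 1 \<in> ?C" for x y
    by (intro op_tensor_mem_compact_tensor rank_one_compact)
  have dense: "closure (cspan (?g ` (?C \<times> UNIV))) = UNIV"
  proof -
    let ?S = "cspan (?g ` (?C \<times> UNIV))"
    have "x \<otimes>\<^sub>v \<zeta> \<in> ?S" for x \<zeta>
    proof (cases "x = 0")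
      case False
      have "cinner x x *\<^sub>C (x \<otimes>\<^sub>v \<zeta>) \<in> ?S"
        by (intro cvec.span_base image_eqI[of _ _ "(rank_one x x \<otimes>\<^sub>o \<pi> 1, x \<otimes>\<^sub>v \<zeta>)"])
          (use rC unit in auto)
      then have "inverse (cinner x x) *\<^sub>C cinner x x *\<^sub>C (x \<otimes>\<^sub>v \<zeta>) \<in> ?S"
        by (rule cvec.span_scale)
      then show ?thesis using False by (simp add: scaleC_scaleC cinner_self)
    qed (simp add: cvec.span_zero)
    then have "closure (cspan (range (\<lambda>(x, y). x \<otimes>\<^sub>v y))) \<subseteq> closure ?S"
      by (intro closure_mono cvec.span_minimal) auto
    then show ?thesis unfolding dense_range_tensor_vec by auto
  qed
  have "norm (\<Sum>i\<in>J. k i *\<^sub>C ?g' i) \<le> 1 * norm (\<Sum>i\<in>J. k i *\<^sub>C ?g i)" if "J \<subseteq> ?C \<times> UNIV" for J k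
  proof -
    have "norm (\<Sum>i\<in>J. k i *\<^sub>C ?g' i) = norm (\<Sum>i\<in>J. k i *\<^sub>C ?g i)"
      by (rule norm_sum_eq_of_cinner_eq) (rule inner; use that in blast)
    then show ?thesis by simp
  qed
  note E = cont_ext_bounded[of "?C \<times> UNIV" ?g' 1 ?g, OF this, unfolded dense]
  obtain T where T: "bop_apply T = cont_ext (?C \<times> UNIV) ?g ?g'"
    by (rule bop_exists[of "cont_ext (?C \<times> UNIV) ?g ?g'" 1])
      (use E(1) E(4) in \<open>auto simp: clinear_on_def\<close>)
  have TW: "T * ?W d = ?W (u * d)" if "d \<in> ?C" for d
    by (rule bop_eqI) (use E(3)[of "(d, _)"] that in \<open>simp add: bop_times_apply T\<close>)
  have "id_tensor_ext \<pi> \<psi> u = T"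
    unfolding id_tensor_ext_def multiplier_ext_def \<theta>_def[symmetric]
  proof (rule the_equality)
    show "\<forall>d\<in>?C. T * \<theta> d = \<theta> (u * d)" using TW \<theta> uC by simp
    \<comment> \<open>The rank-one elements of \<open>?C\<close> already reach every elementary
      tensor, which determines the operator.\<close>
    fix T' assume T': "\<forall>d\<in>?C. T' * \<theta> d = \<theta> (u * d)"
    show "T' = T"
    proof (rule bop_tensor_eqI)
      fix x :: 'h and \<zeta>
      let ?d = "rank_one x x \<otimes>\<^sub>o \<pi> 1"
      have "T' * ?W ?d = T * ?W ?d" using T' TW[OF rC] \<theta> uC rC by metis
      then have "(T' * ?W ?d) \<cdot> (x \<otimes>\<^sub>v \<zeta>) = (T * ?W ?d) \<cdot> (x \<otimes>\<^sub>v \<zeta>)" by simp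
      then have "cinner x x *\<^sub>C (T' \<cdot> (x \<otimes>\<^sub>v \<zeta>)) = cinner x x *\<^sub>C (T \<cdot> (x \<otimes>\<^sub>v \<zeta>))"
        by (simp add: bop_times_apply unit bop_apply_scaleC)
      then show "T' \<cdot> (x \<otimes>\<^sub>v \<zeta>) = T \<cdot> (x \<otimes>\<^sub>v \<zeta>)"
        by (cases "x = 0") (auto simp: cinner_self)
    qed
  qed
  then show ?thesis using TW c by simp
qed

text \<open>Write p for the projection onto \<xi>. The product of \<open>u\<close> with the operator
  sending \<xi> to \<xi>', amplified by 1, equals (\<rho> \<otimes> \<pi>)(t) (p \<otimes> 1). This
  lies in the domain of \<iota> \<otimes> \<psi>, which maps it to (\<rho> \<otimes> \<psi>)(t) (p
  \<otimes> 1); evaluation at \<xi> \<otimes> \<zeta> gives the claim.\<close>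

lemma id_tensor_ext_apply:
  fixes \<psi> :: "'a \<Rightarrow> ('k \<otimes>\<^sub>H 'k) bop" and \<rho> :: "'a \<Rightarrow> 'h::chilbert_space bop" and u :: "('h \<otimes>\<^sub>H 'k) bop"
  assumes \<psi>: "star_rep \<psi>" "\<psi> 1 = 1" and u: "u \<in> multipliers (compact_tensor \<pi>)" "star u * u = 1"
    and \<rho>: "star_rep \<rho>" and \<xi>: "cinner \<xi> \<xi> = 1" and t: "t \<in> min_tensor (range \<pi>) (range \<pi>)"
    and ut: "\<And>\<eta>. u \<cdot> (\<xi>' \<otimes>\<^sub>v \<eta>) = rep_tensor \<pi> \<rho> t \<cdot> (\<xi> \<otimes>\<^sub>v \<eta>)"
  shows "id_tensor_ext \<pi> \<psi> u \<cdot> (\<xi>' \<otimes>\<^sub>v \<zeta>) = tensor_rep \<pi> \<rho> \<psi> t \<cdot> (\<xi> \<otimes>\<^sub>v \<zeta>)"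
proof -
  let ?G = "range (\<lambda>(x, a). x \<otimes>\<^sub>o \<pi> a) :: ('h \<otimes>\<^sub>H 'k) bop set"
  let ?p = "rank_one \<xi> \<xi>" and ?c = "rank_one \<xi>' \<xi> \<otimes>\<^sub>o \<pi> 1"
  note t' = t[unfolded min_tensor_range]
  note R = tensor_rep_cont_clinear[OF \<pi> \<rho> \<pi>(1), unfolded min_tensor_range]
    and N = tensor_rep_cont_clinear[OF \<pi> \<rho> \<psi>(1), unfolded min_tensor_range]
  have mem: "tensor_rep \<pi> \<rho> \<pi> s * (?p \<otimes>\<^sub>o 1) \<in> closure (cspan ?G)"
    if "s \<in> closure (cspan (range (\<lambda>(a, b). \<pi> a \<otimes>\<^sub>o \<pi> b)))" for s
    by (rule cont_clinear_on_mem[OF cont_clinear_on_mult_right[OF R] _ that])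
      (auto simp: tensor_rep_apply[OF \<pi> \<rho> \<pi>(1)] op_tensor_mult
        intro!: closure_cspan_base intro: range_case_prodI[of "\<lambda>x a. x \<otimes>\<^sub>o \<pi> a"])
  have "amp_right \<pi> \<psi> (tensor_rep \<pi> \<rho> \<pi> t * (?p \<otimes>\<^sub>o 1)) = tensor_rep \<pi> \<rho> \<psi> t * (?p \<otimes>\<^sub>o 1)"
  proof (rule cont_clinear_on_eq[OF _ _ _ t'])
    show "cont_clinear_on (closure (cspan (range (\<lambda>(a, b). \<pi> a \<otimes>\<^sub>o \<pi> b))))
        (\<lambda>t. amp_right \<pi> \<psi> (tensor_rep \<pi> \<rho> \<pi> t * (?p \<otimes>\<^sub>o 1)))"
      by (rule cont_clinear_on_compose[OF cont_clinear_on_mult_right[OF R] amp_right_cont_clinear[OF \<pi> \<psi>(1)]])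
        (use mem in auto)
  qed (auto intro!: cont_clinear_on_mult_right N simp: tensor_rep_apply[OF \<pi> \<rho> \<pi>(1)]
      tensor_rep_apply[OF \<pi> \<rho> \<psi>(1)] op_tensor_mult amp_right_apply[OF \<pi> \<psi>(1)])
  moreover have "u * ?c = tensor_rep \<pi> \<rho> \<pi> t * (?p \<otimes>\<^sub>o 1)"
    by (rule bop_tensor_eqI)
      (simp add: bop_times_apply bop_one_apply \<pi>(3) tensor_vec_scaleC_left bop_apply_scaleC ut
        rep_tensor_def tensor_rep_def)
  moreover have "id_tensor_ext \<pi> \<psi> u * amp_right \<pi> \<psi> ?c = amp_right \<pi> \<psi> (u * ?c)"
    by (intro id_tensor_ext_mult \<psi> u op_tensor_mem_compact_tensor rank_one_compact)
  ultimately have "(id_tensor_ext \<pi> \<psi> u * (rank_one \<xi>' \<xi> \<otimes>\<^sub>o \<psi> 1)) \<cdot> (\<xi> \<otimes>\<^sub>v \<zeta>)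
      = (tensor_rep \<pi> \<rho> \<psi> t * (?p \<otimes>\<^sub>o 1)) \<cdot> (\<xi> \<otimes>\<^sub>v \<zeta>)"
    by (simp add: amp_right_apply[OF \<pi> \<psi>(1)])
  then show ?thesis
    by (simp add: bop_times_apply \<psi>(2) bop_one_apply \<xi>)
qed

text \<open>By coassociativity (\<rho> \<otimes> \<Phi>)(\<Phi> a) is the image of \<Phi> a under
  (\<rho> \<otimes> \<iota> \<otimes> \<iota>)(\<Phi> \<otimes> \<iota>). On b \<otimes> c the
  latter map, applied to \<xi> \<otimes> \<zeta>, gives (\<rho> \<otimes> \<psi>12)(\<Phi> b) on
  \<xi> \<otimes> \<psi>13 c \<zeta>, which is the first-leg factor of the claim applied to \<rho> b
  \<xi> \<otimes> \<psi>13 c \<zeta>. By linearity b \<otimes> c may be replaced by \<Phi> a, and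
  then the remaining vector is the value of the second factor.\<close>

lemma id_tensor_ext_comult:
  fixes \<Phi> :: "'a \<Rightarrow> ('k \<otimes>\<^sub>H 'k) bop" and \<rho> :: "'a \<Rightarrow> 'h::chilbert_space bop" and u :: "('h \<otimes>\<^sub>H 'k) bop"
  assumes \<Phi>: "comultiplication \<pi> \<Phi>" and u: "u \<in> multipliers (compact_tensor \<pi>)" "star u * u = 1"
    and \<rho>: "star_rep \<rho>" and \<xi>: "cinner \<xi> \<xi> = 1" "closure (range (\<lambda>a. \<rho> a \<cdot> \<xi>)) = UNIV"
    and u_eq: "\<And>a \<eta>. u \<cdot> ((\<rho> a \<cdot> \<xi>) \<otimes>\<^sub>v \<eta>) = rep_tensor \<pi> \<rho> (\<Phi> a) \<cdot> (\<xi> \<otimes>\<^sub>v \<eta>)"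
  shows "id_tensor_ext \<pi> \<Phi> u = leg12 \<pi> u * leg13 \<pi> u"
proof (rule bop_eq_on_dense_vec[OF \<xi>(2)])
  fix a \<zeta>
  have \<Phi>rep: "star_rep \<Phi>" "\<Phi> 1 = 1" and \<Phi>min: "\<And>a. \<Phi> a \<in> min_tensor (range \<pi>) (range \<pi>)"
    and coassoc: "\<And>a \<zeta>. tensor_assoc (tensor_rep \<pi> \<Phi> \<pi> (\<Phi> a) \<cdot> \<zeta>) = tensor_rep \<pi> \<pi> \<Phi> (\<Phi> a) \<cdot> tensor_assoc \<zeta>"
    using \<Phi> unfolding comultiplication_def unital_star_hom_def star_rep_def comult_tensor_id_def
      id_tensor_comult_def tensor_rep_def by auto
  define \<psi>12 \<psi>13 where "\<psi>12 a = \<pi> a \<otimes>\<^sub>o \<pi> 1" and "\<psi>13 a = \<pi> 1 \<otimes>\<^sub>o \<pi> a" for a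
  have \<psi>12: "star_rep \<psi>12" "\<psi>12 1 = 1"
    unfolding \<psi>12_def star_rep_def clinear_on_def \<pi>(3)
    by (simp_all add: star_rep_add[OF \<pi>(1)] star_rep_scaleC[OF \<pi>(1)] star_rep_mult[OF \<pi>(1)] star_rep_star[OF \<pi>(1)]
      op_tensor_add_left op_tensor_scaleC_left op_tensor_mult op_tensor_star \<pi>(3) op_tensor_one)
  have \<psi>13: "star_rep \<psi>13" "\<psi>13 1 = 1"
    unfolding \<psi>13_def star_rep_def clinear_on_def \<pi>(3)
    by (simp_all add: star_rep_add[OF \<pi>(1)] star_rep_scaleC[OF \<pi>(1)] star_rep_mult[OF \<pi>(1)] star_rep_star[OF \<pi>(1)]
      op_tensor_add_right op_tensor_scaleC_right op_tensor_mult op_tensor_star \<pi>(3) op_tensor_one)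
  have legs: "\<psi>12 b * \<psi>13 c = \<pi> b \<otimes>\<^sub>o \<pi> c" for b c
    by (simp add: \<psi>12_def \<psi>13_def op_tensor_mult \<pi>(3))
  have leg: "leg12 \<pi> u = id_tensor_ext \<pi> \<psi>12 u" "leg13 \<pi> u = id_tensor_ext \<pi> \<psi>13 u"
    by (simp_all add: leg12_def leg13_def \<psi>12_def[abs_def] \<psi>13_def[abs_def])
  have ext: "id_tensor_ext \<pi> \<psi> u \<cdot> ((\<rho> b \<cdot> \<xi>) \<otimes>\<^sub>v \<zeta>) = tensor_rep \<pi> \<rho> \<psi> (\<Phi> b) \<cdot> (\<xi> \<otimes>\<^sub>v \<zeta>)"
    if "star_rep \<psi>" "\<psi> 1 = 1" for \<psi> b \<zeta>
    using that u \<rho> \<xi>(1) \<Phi>min u_eq by (intro id_tensor_ext_apply)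
  obtain \<alpha> :: "(('k \<otimes>\<^sub>H 'k) \<otimes>\<^sub>H 'k) bop \<Rightarrow> ('k \<otimes>\<^sub>H 'k \<otimes>\<^sub>H 'k) bop"
    where \<alpha>: "cont_clinear_on UNIV \<alpha>" "\<And>S T R. \<alpha> ((S \<otimes>\<^sub>o T) \<otimes>\<^sub>o R) = S \<otimes>\<^sub>o (T \<otimes>\<^sub>o R)"
      "\<And>R R'. (\<And>t. tensor_assoc (R \<cdot> t) = R' \<cdot> tensor_assoc t) \<Longrightarrow> \<alpha> R = R'"
    using tensor_assoc_conj_exists by blast
  let ?M = "closure (cspan (range (\<lambda>(a, b). \<pi> a \<otimes>\<^sub>o \<pi> b)))"
  let ?L = "closure (cspan (range (\<lambda>(a, x). \<pi> a \<otimes>\<^sub>o x))) :: ('k \<otimes>\<^sub>H 'k \<otimes>\<^sub>H 'k) bop set"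
  note \<Phi>M = \<Phi>min[unfolded min_tensor_range]
  note L = amp_left_cont_clinear[OF \<pi> \<rho>]
  have \<alpha>c: "cont_clinear_on ?M (\<lambda>s. \<alpha> (s \<otimes>\<^sub>o \<pi> c))" for c
    by (rule cont_clinear_on_compose[OF cont_clinear_on_op_tensor[OF cont_clinear_on_id] \<alpha>(1)]) auto
  have memc: "\<alpha> (s \<otimes>\<^sub>o \<pi> c) \<in> ?L" if "s \<in> ?M" for s c
    by (rule cont_clinear_on_mem[OF \<alpha>c _ that])
      (auto simp: \<alpha>(2) intro!: closure_cspan_base intro: range_case_prodI[of "\<lambda>a x. \<pi> a \<otimes>\<^sub>o x"])
  \<comment> \<open>The last leg splits off because \<pi> b \<otimes> \<pi> c is the product of
    \<psi>12 b and \<psi>13 c.\<close>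
  have step: "amp_left \<pi> \<rho> (\<alpha> (s \<otimes>\<^sub>o \<pi> c)) = tensor_rep \<pi> \<rho> \<psi>12 s * (1 \<otimes>\<^sub>o \<psi>13 c)" if "s \<in> ?M" for s c
  proof (rule cont_clinear_on_eq[OF _ _ _ that])
    show "cont_clinear_on ?M (\<lambda>s. amp_left \<pi> \<rho> (\<alpha> (s \<otimes>\<^sub>o \<pi> c)))"
      by (rule cont_clinear_on_compose[OF \<alpha>c L]) (use memc in auto)
    show "cont_clinear_on ?M (\<lambda>s. tensor_rep \<pi> \<rho> \<psi>12 s * (1 \<otimes>\<^sub>o \<psi>13 c))"
      by (intro cont_clinear_on_mult_right tensor_rep_cont_clinear[OF \<pi> \<rho> \<psi>12(1), unfolded min_tensor_range])
  qed (auto simp: \<alpha>(2) amp_left_apply[OF \<pi> \<rho>] tensor_rep_apply[OF \<pi> \<rho> \<psi>12(1)] op_tensor_mult legs)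
  note K = tensor_rep_cont_clinear[OF \<pi> \<Phi>rep(1) \<pi>(1), unfolded min_tensor_range]
  have \<alpha>K: "cont_clinear_on ?M (\<lambda>t. \<alpha> (tensor_rep \<pi> \<Phi> \<pi> t))"
    by (rule cont_clinear_on_compose[OF K \<alpha>(1)]) auto
  have memK: "\<alpha> (tensor_rep \<pi> \<Phi> \<pi> t) \<in> ?L" if "t \<in> ?M" for t
  proof (rule cont_clinear_on_mem[OF \<alpha>K _ that])
    fix s assume "s \<in> range (\<lambda>(a, b). \<pi> a \<otimes>\<^sub>o \<pi> b)"
    then obtain b c where s: "s = \<pi> b \<otimes>\<^sub>o \<pi> c" by auto
    show "\<alpha> (tensor_rep \<pi> \<Phi> \<pi> s) \<in> ?L"
      unfolding s tensor_rep_apply[OF \<pi> \<Phi>rep(1) \<pi>(1)] by (rule memc[OF \<Phi>M])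
  qed
  \<comment> \<open>Stated for every \<open>t\<close> in A \<otimes> A, although only t = \<Phi> a
    is wanted, so that linearity and continuity reduce it to elementary tensors.\<close>
  have main: "amp_left \<pi> \<rho> (\<alpha> (tensor_rep \<pi> \<Phi> \<pi> t)) \<cdot> (\<xi> \<otimes>\<^sub>v \<zeta>) = leg12 \<pi> u \<cdot> (tensor_rep \<pi> \<rho> \<psi>13 t \<cdot> (\<xi> \<otimes>\<^sub>v \<zeta>))"
    if "t \<in> ?M" for t
  proof (rule cont_clinear_on_eq[OF _ _ _ that])
    show "cont_clinear_on ?M (\<lambda>t. amp_left \<pi> \<rho> (\<alpha> (tensor_rep \<pi> \<Phi> \<pi> t)) \<cdot> (\<xi> \<otimes>\<^sub>v \<zeta>))"
      by (rule cont_clinear_on_eval[OF cont_clinear_on_compose[OF \<alpha>K L]]) (use memK in auto)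
    show "cont_clinear_on ?M (\<lambda>t. leg12 \<pi> u \<cdot> (tensor_rep \<pi> \<rho> \<psi>13 t \<cdot> (\<xi> \<otimes>\<^sub>v \<zeta>)))"
      by (intro cont_clinear_on_bop cont_clinear_on_eval
          tensor_rep_cont_clinear[OF \<pi> \<rho> \<psi>13(1), unfolded min_tensor_range])
    fix s assume "s \<in> range (\<lambda>(a, b). \<pi> a \<otimes>\<^sub>o \<pi> b)"
    then obtain b c where s: "s = \<pi> b \<otimes>\<^sub>o \<pi> c" by auto
    show "amp_left \<pi> \<rho> (\<alpha> (tensor_rep \<pi> \<Phi> \<pi> s)) \<cdot> (\<xi> \<otimes>\<^sub>v \<zeta>) = leg12 \<pi> u \<cdot> (tensor_rep \<pi> \<rho> \<psi>13 s \<cdot> (\<xi> \<otimes>\<^sub>v \<zeta>))"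
      unfolding s tensor_rep_apply[OF \<pi> \<Phi>rep(1) \<pi>(1)] tensor_rep_apply[OF \<pi> \<rho> \<psi>13(1)] step[OF \<Phi>M] leg
      by (simp add: bop_times_apply bop_one_apply ext[OF \<psi>12])
  qed
  have "id_tensor_ext \<pi> \<Phi> u \<cdot> ((\<rho> a \<cdot> \<xi>) \<otimes>\<^sub>v \<zeta>) = tensor_rep \<pi> \<rho> \<Phi> (\<Phi> a) \<cdot> (\<xi> \<otimes>\<^sub>v \<zeta>)"
    by (rule ext[OF \<Phi>rep])
  also have "\<dots> = amp_left \<pi> \<rho> (tensor_rep \<pi> \<pi> \<Phi> (\<Phi> a)) \<cdot> (\<xi> \<otimes>\<^sub>v \<zeta>)"
    by (simp add: amp_left_tensor_rep[OF \<pi> \<rho> \<Phi>rep(1) \<Phi>min])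
  also have "tensor_rep \<pi> \<pi> \<Phi> (\<Phi> a) = \<alpha> (tensor_rep \<pi> \<Phi> \<pi> (\<Phi> a))"
    by (rule \<alpha>(3)[symmetric]) (rule coassoc)
  also have "amp_left \<pi> \<rho> (\<alpha> (tensor_rep \<pi> \<Phi> \<pi> (\<Phi> a))) \<cdot> (\<xi> \<otimes>\<^sub>v \<zeta>)
      = leg12 \<pi> u \<cdot> (tensor_rep \<pi> \<rho> \<psi>13 (\<Phi> a) \<cdot> (\<xi> \<otimes>\<^sub>v \<zeta>))"
    by (rule main[OF \<Phi>M])
  also have "\<dots> = (leg12 \<pi> u * leg13 \<pi> u) \<cdot> ((\<rho> a \<cdot> \<xi>) \<otimes>\<^sub>v \<zeta>)"
    by (simp add: bop_times_apply leg(2) ext[OF \<psi>13])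
  finally show "id_tensor_ext \<pi> \<Phi> u \<cdot> ((\<rho> a \<cdot> \<xi>) \<otimes>\<^sub>v \<zeta>) = (leg12 \<pi> u * leg13 \<pi> u) \<cdot> ((\<rho> a \<cdot> \<xi>) \<otimes>\<^sub>v \<zeta>)" .
qed

end

text \<open>\<open>star_rep\<close> does not ask for the unit to be preserved. It is, since \<pi> 1
  fixes all vectors \<pi> a \<eta> and these span a dense subspace.\<close>

lemma star_rep_one:
  assumes "star_rep \<pi>" "closure (cspan {\<pi> a \<cdot> \<eta> | a \<eta>. True}) = UNIV"
  shows "\<pi> 1 = 1"
  by (rule bop_eq_on_dense[OF assms(2)])
    (auto simp: bop_one_apply bop_times_apply[symmetric] star_rep_mult[OF assms(1), symmetric])

theorem theorem5p4:
  fixes \<pi> :: "'a::unital_cstar_algebra \<Rightarrow> 'k::chilbert_space bop"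
    and \<Phi> :: "'a \<Rightarrow> ('k \<otimes>\<^sub>H 'k) bop"
    and h :: "'a \<Rightarrow> complex"
    and \<pi>\<^sub>h :: "'a \<Rightarrow> 'h::chilbert_space bop"
    and \<xi>\<^sub>0 :: "'h"
    and u :: "('h \<otimes>\<^sub>H 'k) bop"
  assumes "faithful_nondegenerate_rep \<pi>"
    and "compact_quantum_group \<pi> \<Phi>"
    and "haar_measure \<pi> \<Phi> h"
    and "gns_triple h \<pi>\<^sub>h \<xi>\<^sub>0"
    and "u \<in> multipliers (compact_tensor \<pi>)"
    and "unitary u"
    and "\<And>a \<eta>. u \<cdot> ((\<pi>\<^sub>h a \<cdot> \<xi>\<^sub>0) \<otimes>\<^sub>v \<eta>) = rep_tensor \<pi> \<pi>\<^sub>h (\<Phi> a) \<cdot> (\<xi>\<^sub>0 \<otimes>\<^sub>v \<eta>)"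
  shows "id_tensor_ext \<pi> \<Phi> u = leg12 \<pi> u * leg13 \<pi> u \<and> unitary_cqg_representation \<pi> \<Phi> u"
proof -
  have \<pi>: "star_rep \<pi>" "inj \<pi>" "\<pi> 1 = 1"
    using assms(1) star_rep_one by (auto simp: faithful_nondegenerate_rep_def)
  have \<pi>\<^sub>h: "star_rep \<pi>\<^sub>h" "closure (range (\<lambda>a. \<pi>\<^sub>h a \<cdot> \<xi>\<^sub>0)) = UNIV" "\<And>a. h a = cinner (\<pi>\<^sub>h a \<cdot> \<xi>\<^sub>0) \<xi>\<^sub>0"
    using assms(4) by (auto simp: gns_triple_def)
  \<comment> \<open>Cyclicity makes the GNS representation non-degenerate, hence unital, and then
    the squared norm of the cyclic vector is h 1 = 1.\<close>
  have "closure (range (\<lambda>a. \<pi>\<^sub>h a \<cdot> \<xi>\<^sub>0)) \<subseteq> closure (cspan {\<pi>\<^sub>h a \<cdot> \<eta> | a \<eta>. True})"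
    by (intro closure_mono) (auto intro!: cvec.span_base)
  then have "\<pi>\<^sub>h 1 = 1"
    using \<pi>\<^sub>h by (intro star_rep_one) auto
  then have "cinner \<xi>\<^sub>0 \<xi>\<^sub>0 = 1"
    using assms(3) \<pi>\<^sub>h(3)[of 1] by (simp add: haar_measure_def state_def bop_one_apply)
  then have "id_tensor_ext \<pi> \<Phi> u = leg12 \<pi> u * leg13 \<pi> u"
    using assms(2,5-7) \<pi>\<^sub>h by (intro id_tensor_ext_comult[OF \<pi>]) (auto simp: compact_quantum_group_def unitary_def)
  then show ?thesis
    using assms(5,6) by (simp add: unitary_cqg_representation_def cqg_representation_def)
qed

end
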